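(* Let $X$ be a conservative affine process on $S_d^+$ under the risk neutral probability measure $\mathbb{Q}$, with admissible parameters $(\alpha,b,\beta^{ij},c=0,\gamma=0,m,\mu)$ with respect to a truncation function $\chi$. Let $a\ge 0$, $B\in S_d^+$, and let the short rate be $r_t=a+\mathrm{Tr}[BX_t]$. Then for $0\le t\le T$, with $\tau=T-t$, the price of a zero-coupon bond is $$P_t(\tau):=\mathbb{E}^{\mathbb{Q}}\Big[e^{-\int_t^T (a+\mathrm{Tr}[BX_u])\,du}\,\Big|\,\mathcal{F}_t\Big]=\exp\big\{-\tilde\phi(\tau,B)-\mathrm{Tr}[\tilde\psi(\tau,B)X_t]\big\},$$ where $\tilde\phi$ (real-valued) and $\tilde\psi$ (symmetric $d\times d$ matrix-valued) satisfy the ODEs $$\frac{\partial\tilde\phi}{\partial\tau}=\mathrm{Tr}[b\tilde\psi(\tau,B)]-\int_{S_d^+\setminus\{0\}}\big(e^{-\mathrm{Tr}[\tilde\psi(\tau,B)\xi]}-1\big)m(d\xi)+a,\qquad\tilde\phi(0,B)=0,$$ $$\frac{\partial\tilde\psi}{\partial\tau}=-2\tilde\psi(\tau,B)\alpha\tilde\psi(\tau,B)+\beta^{\top}(\tilde\psi(\tau,B))-\int_{S_d^+\setminus\{0\}}\frac{e^{-\mathrm{Tr}[\tilde\psi(\tau,B)\xi]}-1+\mathrm{Tr}[\chi(\xi)\tilde\psi(\tau,B)]}{\|\xi\|^2\wedge 1}\,\mu(d\xi)+B,\qquad\tilde\psi(0,B)=0.$$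
   Context: $S_d$ denotes the real symmetric $d\times d$ matrices and $S_d^+$ the cone of positive semidefinite ones, with scalar product $\langle x,y\rangle=\mathrm{Tr}[xy]$; $A\succeq C$ means $A-C\in S_d^+$. The probability space carries a filtration $(\mathcal{F}_t)_{t\ge0}$ satisfying the usual conditions. Affine process: a Markov process $X$ on $S_d^+$ (with respect to $(\mathcal F_t)$), with transition probabilities $p_t(x,\cdot)$, is affine if (1) it is stochastically continuous, i.e. $p_s(x,\cdot)\to p_t(x,\cdot)$ weakly as $s\to t$ for all $t\ge 0$, $x\in S_d^+$; and (2) $\int_{S_d^+}e^{-\mathrm{Tr}[u\xi]}p_t(x,d\xi)=e^{-\phi(t,u)-\mathrm{Tr}[\psi(t,u)x]}$ for all $t\ge0$, $u,x\in S_d^+$, for some $\phi:\mathbb{R}_{\ge0}\times S_d^+\to\mathbb{R}_{\ge0}$ and $\psi:\mathbb{R}_{\ge0}\times S_d^+\to S_d^+$. It is conservative if $p_t(x,S_d^+)=1$ for all $t,x$ (no killing, so the killing parameters $c,\gamma$ vanish). Admissible parameters (with zero killing): let $\chi:S_d^+\to S_d^+$ be bounded continuous with $\chi(\xi)=\xi$ near $0$. The parameters are $\alpha\in S_d^+$; $b\succeq(d-1)\alpha$; a Borel measure $m$ on $S_d^+\setminus\{0\}$ with $\int(\|\xi\|\wedge1)\,m(d\xi)<\infty$; a $d\times d$ matrix $\mu=(\mu_{ij})$ of finite signed measures on $S_d^+\setminus\{0\}$ with $\mu(E)\in S_d^+$ for all Borel $E$, such that the kernel $M(x,d\xi):=\frac{\mathrm{Tr}[x\mu(d\xi)]}{\|\xi\|^2\wedge1}$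 satisfies $\int\mathrm{Tr}[\chi(\xi)u]M(x,d\xi)<\infty$ for all $x,u\in S_d^+$ with $\mathrm{Tr}[xu]=0$; and matrices $\beta^{ij}=\beta^{ji}\in S_d$ such that $\beta(x)=\sum_{i,j}\beta^{ij}x_{ij}$ satisfies $\mathrm{Tr}[\beta(x)u]-\int\mathrm{Tr}[\chi(\xi)u]M(x,d\xi)\ge0$ for all $x,u\in S_d^+$ with $\mathrm{Tr}[xu]=0$. Moreover $\beta^{\top}$ is defined by $(\beta^{\top}(u))_{ij}=\mathrm{Tr}[\beta^{ij}u]$. Every conservative affine process on $S_d^+$ is a Feller process to which such parameters are associated through its generator: for $f$ a rapidly decreasing $C^\infty$ function on $S_d^+$, $$\mathcal{A}f(x)=\tfrac12\sum_{i,j,k,l}A_{ijkl}(x)\frac{\partial^2f(x)}{\partial x_{ij}\partial x_{kl}}+\sum_{i,j}(b_{ij}+\beta_{ij}(x))\frac{\partial f(x)}{\partial x_{ij}}+\int(f(x+\xi)-f(x))m(d\xi)+\int\big(f(x+\xi)-f(x)-\mathrm{Tr}[\chi(\xi)\nabla f(x)]\big)M(x,d\xi),$$ with $A_{ijkl}(x)=x_{ik}\alpha_{jl}+x_{il}\alpha_{jk}+x_{jk}\alpha_{il}+x_{jl}\alpha_{ik}$ and integrals over $S_d^+\setminus\{0\}$. *)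

theory Defs
  imports "HOL-Probability.Probability"
begin

section \<open>Positive semidefinite matrices\<close>

text \<open>On \<^typ>\<open>real^'d^'d\<close> the library norm is the Frobenius norm, which on symmetric
  matrices is the norm of the scalar product \<open>trace (x ** y)\<close>.\<close>

definition symmetric_matrix :: "real^'d^'d \<Rightarrow> bool" where
  "symmetric_matrix A \<longleftrightarrow> transpose A = A"

definition psd :: "(real^'d^'d) set" where
  "psd = {A. symmetric_matrix A \<and> (\<forall>v. 0 \<le> v \<bullet> (A *v v))}"

definition psd_space :: "(real^'d^'d) measure" where
  "psd_space = restrict_space borel psd"

definition psd0_space :: "(real^'d^'d) measure" where
  "psd0_space = restrict_space borel (psd - {0})"

section \<open>Finite signed measures\<close>

definition finite_signed_measure :: "'a measure \<Rightarrow> ('a set \<Rightarrow> real) \<Rightarrow> bool" where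
  "finite_signed_measure N \<nu> \<longleftrightarrow> \<nu> {} = 0 \<and>
     (\<forall>A :: nat \<Rightarrow> 'a set. range A \<subseteq> sets N \<longrightarrow> disjoint_family A \<longrightarrow>
        (\<lambda>n. \<nu> (A n)) sums \<nu> (\<Union>n. A n))"

text \<open>The positive part of the Jordan decomposition; the negative part is that of \<open>- \<nu>\<close>.
  Negative values of \<open>\<nu>\<close> are cut off at \<open>0\<close> by \<^const>\<open>ennreal\<close>, which is harmless
  since \<open>\<nu> {} = 0\<close> takes part in the supremum.\<close>

definition jordan_pos :: "'a measure \<Rightarrow> ('a set \<Rightarrow> real) \<Rightarrow> 'a measure" where
  "jordan_pos N \<nu> = measure_of (space N) (sets N)
     (\<lambda>E. SUP G\<in>{G \<in> sets N. G \<subseteq> E}. ennreal (\<nu> G))"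

definition jordan_neg :: "'a measure \<Rightarrow> ('a set \<Rightarrow> real) \<Rightarrow> 'a measure" where
  "jordan_neg N \<nu> = jordan_pos N (\<lambda>E. - \<nu> E)"

definition signed_integrable :: "'a measure \<Rightarrow> ('a set \<Rightarrow> real) \<Rightarrow> ('a \<Rightarrow> real) \<Rightarrow> bool" where
  "signed_integrable N \<nu> f \<longleftrightarrow> integrable (jordan_pos N \<nu>) f \<and> integrable (jordan_neg N \<nu>) f"

definition signed_integral :: "'a measure \<Rightarrow> ('a set \<Rightarrow> real) \<Rightarrow> ('a \<Rightarrow> real) \<Rightarrow> real" where
  "signed_integral N \<nu> f = (LINT \<xi>|jordan_pos N \<nu>. f \<xi>) - (LINT \<xi>|jordan_neg N \<nu>. f \<xi>)"

text \<open>A matrix of signed measures on \<^const>\<open>psd0_space\<close> is encoded as the matrix-valued set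
  function \<open>\<mu>\<close> whose entries are \<open>\<mu>\<^sub>i\<^sub>j E = \<mu> E $ i $ j\<close>.\<close>

definition matrix_integrable ::
    "((real^'d^'d) set \<Rightarrow> real^'d^'d) \<Rightarrow> (real^'d^'d \<Rightarrow> real) \<Rightarrow> bool" where
  "matrix_integrable \<mu> f \<longleftrightarrow> (\<forall>i j. signed_integrable psd0_space (\<lambda>E. \<mu> E $ i $ j) f)"

definition matrix_integral ::
    "((real^'d^'d) set \<Rightarrow> real^'d^'d) \<Rightarrow> (real^'d^'d \<Rightarrow> real) \<Rightarrow> real^'d^'d" where
  "matrix_integral \<mu> f = (\<chi> i j. signed_integral psd0_space (\<lambda>E. \<mu> E $ i $ j) f)"

section \<open>Admissible parameters\<close>

definition truncation_function :: "(real^'d^'d \<Rightarrow> real^'d^'d) \<Rightarrow> bool" where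
  "truncation_function chi \<longleftrightarrow> chi \<in> psd \<rightarrow> psd \<and> bounded (chi ` psd) \<and> continuous_on psd chi \<and>
     (\<exists>\<epsilon>>0. \<forall>\<xi>\<in>psd. norm \<xi> < \<epsilon> \<longrightarrow> chi \<xi> = \<xi>)"

text \<open>\<open>M(x, d\<xi>) = Tr[x \<mu>(d\<xi>)] / min (norm \<xi>\<^sup>2) 1\<close>, used for \<open>x \<in> psd\<close> only, where
  \<open>Tr[x \<mu>(E)] \<ge> 0\<close>.\<close>

definition jump_kernel ::
    "((real^'d^'d) set \<Rightarrow> real^'d^'d) \<Rightarrow> real^'d^'d \<Rightarrow> (real^'d^'d) measure" where
  "jump_kernel \<mu> x =
     density (measure_of (space psd0_space) (sets psd0_space) (\<lambda>E. ennreal (trace (x ** \<mu> E))))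
       (\<lambda>\<xi>. ennreal (1 / min ((norm \<xi>)\<^sup>2) 1))"

definition drift :: "('d \<Rightarrow> 'd \<Rightarrow> real^'d^'d) \<Rightarrow> real^'d^'d \<Rightarrow> real^'d^'d" where
  "drift \<beta> x = (\<Sum>i\<in>UNIV. \<Sum>j\<in>UNIV. x $ i $ j *\<^sub>R \<beta> i j)"

definition drift_transpose :: "('d \<Rightarrow> 'd \<Rightarrow> real^'d^'d) \<Rightarrow> real^'d^'d \<Rightarrow> real^'d^'d" where
  "drift_transpose \<beta> u = (\<chi> i j. trace (\<beta> i j ** u))"

definition admissible_parameters ::
    "(real^'d^'d \<Rightarrow> real^'d^'d) \<Rightarrow> real^'d^'d \<Rightarrow> real^'d^'d \<Rightarrow> ('d \<Rightarrow> 'd \<Rightarrow> real^'d^'d) \<Rightarrow>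
     (real^'d^'d) measure \<Rightarrow> ((real^'d^'d) set \<Rightarrow> real^'d^'d) \<Rightarrow> bool" where
  "admissible_parameters chi \<alpha> b \<beta> m \<mu> \<longleftrightarrow>
     \<alpha> \<in> psd \<and>
     b - (real CARD('d) - 1) *\<^sub>R \<alpha> \<in> psd \<and>
     sets m = sets psd0_space \<and> (\<integral>\<^sup>+\<xi>. ennreal (min (norm \<xi>) 1) \<partial>m) < \<infinity> \<and>
     (\<forall>i j. finite_signed_measure psd0_space (\<lambda>E. \<mu> E $ i $ j)) \<and>
     (\<forall>E\<in>sets psd0_space. \<mu> E \<in> psd) \<and>
     (\<forall>x\<in>psd. \<forall>u\<in>psd. trace (x ** u) = 0 \<longrightarrow>
        (\<integral>\<^sup>+\<xi>. ennreal (trace (chi \<xi> ** u)) \<partial>jump_kernel \<mu> x) < \<infinity>) \<and>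
     (\<forall>i j. symmetric_matrix (\<beta> i j) \<and> \<beta> i j = \<beta> j i) \<and>
     (\<forall>x\<in>psd. \<forall>u\<in>psd. trace (x ** u) = 0 \<longrightarrow>
        0 \<le> trace (drift \<beta> x ** u) - (LINT \<xi>|jump_kernel \<mu> x. trace (chi \<xi> ** u)))"

section \<open>Affine processes\<close>

definition usual_conditions :: "'w measure \<Rightarrow> (real \<Rightarrow> 'w measure) \<Rightarrow> bool" where
  "usual_conditions Q F \<longleftrightarrow>
     (\<forall>t\<ge>0. subalgebra Q (F t)) \<and>
     (\<forall>s t. 0 \<le> s \<longrightarrow> s \<le> t \<longrightarrow> sets (F s) \<subseteq> sets (F t)) \<and>
     (\<forall>t\<ge>0. sets (F t) = (\<Inter>s\<in>{t<..}. sets (F s))) \<and>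
     complete_measure Q \<and> null_sets Q \<subseteq> sets (F 0)"

text \<open>Time-homogeneous, possibly sub-Markovian, transition functions on \<^const>\<open>psd\<close>.\<close>

definition transition_function ::
    "(real \<Rightarrow> real^'d^'d \<Rightarrow> (real^'d^'d) measure) \<Rightarrow> bool" where
  "transition_function p \<longleftrightarrow>
     (\<forall>t\<ge>0. p t \<in> measurable psd_space (subprob_algebra psd_space)) \<and>
     (\<forall>x\<in>psd. p 0 x = return psd_space x) \<and>
     (\<forall>s\<ge>0. \<forall>t\<ge>0. \<forall>x\<in>psd. p (s + t) x = p s x \<bind> p t)"

definition conservative :: "(real \<Rightarrow> real^'d^'d \<Rightarrow> (real^'d^'d) measure) \<Rightarrow> bool" where
  "conservative p \<longleftrightarrow> (\<forall>t\<ge>0. \<forall>x\<in>psd. emeasure (p t x) psd = 1)"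

definition stochastically_continuous ::
    "(real \<Rightarrow> real^'d^'d \<Rightarrow> (real^'d^'d) measure) \<Rightarrow> bool" where
  "stochastically_continuous p \<longleftrightarrow>
     (\<forall>t\<ge>0. \<forall>x\<in>psd. \<forall>f :: real^'d^'d \<Rightarrow> real. continuous_on psd f \<longrightarrow> bounded (f ` psd) \<longrightarrow>
        ((\<lambda>s. LINT \<xi>|p s x. f \<xi>) \<longlongrightarrow> (LINT \<xi>|p t x. f \<xi>)) (at t within {0..}))"

definition affine_transform :: "(real \<Rightarrow> real^'d^'d \<Rightarrow> (real^'d^'d) measure) \<Rightarrow> bool" where
  "affine_transform p \<longleftrightarrow>
     (\<exists>(\<phi> :: real \<Rightarrow> real^'d^'d \<Rightarrow> real) (\<psi> :: real \<Rightarrow> real^'d^'d \<Rightarrow> real^'d^'d).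
        (\<forall>t\<ge>0. \<forall>u\<in>psd. 0 \<le> \<phi> t u \<and> \<psi> t u \<in> psd) \<and>
        (\<forall>t\<ge>0. \<forall>u\<in>psd. \<forall>x\<in>psd.
           (LINT \<xi>|p t x. exp (- trace (u ** \<xi>))) = exp (- \<phi> t u - trace (\<psi> t u ** x))))"

text \<open>A Markov process with values in \<^const>\<open>psd\<close>; the initial law is arbitrary.\<close>

definition markov_process ::
    "'w measure \<Rightarrow> (real \<Rightarrow> 'w measure) \<Rightarrow> (real \<Rightarrow> real^'d^'d \<Rightarrow> (real^'d^'d) measure) \<Rightarrow>
     (real \<Rightarrow> 'w \<Rightarrow> real^'d^'d) \<Rightarrow> bool" where
  "markov_process Q F p X \<longleftrightarrow>
     transition_function p \<and>
     (\<forall>t\<ge>0. X t \<in> measurable (F t) psd_space) \<and>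
     (\<forall>s t. 0 \<le> s \<longrightarrow> s \<le> t \<longrightarrow>
        (\<forall>f. f \<in> borel_measurable psd_space \<longrightarrow> bounded (f ` psd) \<longrightarrow>
          (AE \<omega> in Q. real_cond_exp Q (F s) (\<lambda>\<omega>. f (X t \<omega>)) \<omega> = (LINT \<xi>|p (t - s) (X s \<omega>). f \<xi>))))"

definition affine_process ::
    "'w measure \<Rightarrow> (real \<Rightarrow> 'w measure) \<Rightarrow> (real \<Rightarrow> real^'d^'d \<Rightarrow> (real^'d^'d) measure) \<Rightarrow>
     (real \<Rightarrow> 'w \<Rightarrow> real^'d^'d) \<Rightarrow> bool" where
  "affine_process Q F p X \<longleftrightarrow>
     markov_process Q F p X \<and> stochastically_continuous p \<and> affine_transform p"

text \<open>Joint measurability in time and scenario (satisfied by every cadlag version), which makes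
  the time integral of a function of the process a random variable.\<close>

definition jointly_measurable :: "'w measure \<Rightarrow> (real \<Rightarrow> 'w \<Rightarrow> real^'d^'d) \<Rightarrow> bool" where
  "jointly_measurable Q X \<longleftrightarrow>
     (\<lambda>(t, \<omega>). X t \<omega>) \<in> measurable (restrict_space borel {0..} \<Otimes>\<^sub>M Q) psd_space"

section \<open>The generator\<close>

definition partial_deriv ::
    "'d \<Rightarrow> 'd \<Rightarrow> (real^'d^'d \<Rightarrow> real) \<Rightarrow> real^'d^'d \<Rightarrow> real" where
  "partial_deriv i j f x = frechet_derivative f (at x) (axis i (axis j 1))"

primrec iter_partial_deriv ::
    "('d \<times> 'd) list \<Rightarrow> (real^'d^'d \<Rightarrow> real) \<Rightarrow> real^'d^'d \<Rightarrow> real" where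
  "iter_partial_deriv [] f = f"
| "iter_partial_deriv (ij # ijs) f = partial_deriv (fst ij) (snd ij) (iter_partial_deriv ijs f)"

text \<open>A rapidly decreasing smooth function on \<^const>\<open>psd\<close> is represented by a smooth extension
  to all matrices, with rapid decrease of all derivatives required on \<^const>\<open>psd\<close> only.
  The operator below does not depend on the extension: its coefficients are symmetric in
  \<open>(i, j)\<close> and in \<open>(k, l)\<close>, so only derivatives in symmetric directions enter, and those
  are determined by the values on \<^const>\<open>psd\<close>, the closure of its interior within the symmetric
  matrices.\<close>

definition rapidly_decreasing_smooth :: "(real^'d^'d \<Rightarrow> real) \<Rightarrow> bool" where
  "rapidly_decreasing_smooth f \<longleftrightarrow>
     (\<forall>ijs. (\<forall>x. iter_partial_deriv ijs f differentiable at x) \<and>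
        (\<forall>k::nat. bounded ((\<lambda>x. norm x ^ k * iter_partial_deriv ijs f x) ` psd)))"

definition gradient :: "(real^'d^'d \<Rightarrow> real) \<Rightarrow> real^'d^'d \<Rightarrow> real^'d^'d" where
  "gradient f x = (\<chi> i j. partial_deriv i j f x)"

definition diffusion_coeff ::
    "real^'d^'d \<Rightarrow> 'd \<Rightarrow> 'd \<Rightarrow> 'd \<Rightarrow> 'd \<Rightarrow> real^'d^'d \<Rightarrow> real" where
  "diffusion_coeff \<alpha> i j k l x =
     x $ i $ k * \<alpha> $ j $ l + x $ i $ l * \<alpha> $ j $ k + x $ j $ k * \<alpha> $ i $ l + x $ j $ l * \<alpha> $ i $ k"

definition affine_operator ::
    "(real^'d^'d \<Rightarrow> real^'d^'d) \<Rightarrow> real^'d^'d \<Rightarrow> real^'d^'d \<Rightarrow> ('d \<Rightarrow> 'd \<Rightarrow> real^'d^'d) \<Rightarrow>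
     (real^'d^'d) measure \<Rightarrow> ((real^'d^'d) set \<Rightarrow> real^'d^'d) \<Rightarrow>
     (real^'d^'d \<Rightarrow> real) \<Rightarrow> real^'d^'d \<Rightarrow> real" where
  "affine_operator chi \<alpha> b \<beta> m \<mu> f x =
     1/2 * (\<Sum>i\<in>UNIV. \<Sum>j\<in>UNIV. \<Sum>k\<in>UNIV. \<Sum>l\<in>UNIV.
              diffusion_coeff \<alpha> i j k l x * partial_deriv i j (partial_deriv k l f) x) +
     (\<Sum>i\<in>UNIV. \<Sum>j\<in>UNIV. (b $ i $ j + drift \<beta> x $ i $ j) * partial_deriv i j f x) +
     (LINT \<xi>|m. f (x + \<xi>) - f x) +
     (LINT \<xi>|jump_kernel \<mu> x. f (x + \<xi>) - f x - trace (chi \<xi> ** gradient f x))"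

text \<open>The infinitesimal generator of the transition semigroup, in the sense of Feller semigroups
  (limit in the supremum norm on \<^const>\<open>psd\<close>), is given by the parameters.\<close>

definition has_affine_generator ::
    "(real \<Rightarrow> real^'d^'d \<Rightarrow> (real^'d^'d) measure) \<Rightarrow>
     (real^'d^'d \<Rightarrow> real^'d^'d) \<Rightarrow> real^'d^'d \<Rightarrow> real^'d^'d \<Rightarrow> ('d \<Rightarrow> 'd \<Rightarrow> real^'d^'d) \<Rightarrow>
     (real^'d^'d) measure \<Rightarrow> ((real^'d^'d) set \<Rightarrow> real^'d^'d) \<Rightarrow> bool" where
  "has_affine_generator p chi \<alpha> b \<beta> m \<mu> \<longleftrightarrow>
     (\<forall>f. rapidly_decreasing_smooth f \<longrightarrow>
        uniform_limit psd (\<lambda>t x. ((LINT \<xi>|p t x. f \<xi>) - f x) / t)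
          (affine_operator chi \<alpha> b \<beta> m \<mu> f) (at_right 0))"

end

theory Submission
  imports Defs "HOL-Complex_Analysis.Great_Picard"
begin

text \<open>The affine property yields a semiflow \<open>\<psi>\<close> on the cone that is monotone and, by Jensen's inequality,
  subhomogeneous in its argument; the generator, evaluated on exponentials, identifies its increments
  as \<open>h (F, R)(u) + o(h)\<close>, locally uniformly up to the boundary of the cone. Multiplying alternately by
  \<open>exp (- h Tr[B x])\<close> and applying the transition operator over time \<open>h\<close> keeps functions exponentially
  affine, so the bond price with the integral replaced by a Riemann sum is explicit. Monotonicity and
  subhomogeneity bound its exponents on compact time intervals, and a diagonal subsequence converges
  to a solution of the Riccati equations. No uniqueness is needed, and none is available: \<open>R\<close> is in
  general not Lipschitz at the boundary of the cone.

  No regularity of paths is assumed. Stochastic continuity makes the Riemann sums of the truncated rate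
  converge in mean, and a maximal inequality for the martingale \<open>E[exp (- \<epsilon> Tr[X\<^sub>T]) | \<F>\<^sub>s]\<close> removes the
  truncation uniformly in the mesh; it also shows that the rate is almost surely integrable in time,
  so that the integral in the bond price is not a junk value.\<close>

section \<open>Positive semidefinite matrices\<close>

text \<open>The obstacle is the boundary of the cone. The generator is given on rapidly decreasing
  functions only, so it can be evaluated at \<open>exp (- trace (u ** x))\<close> only for positive
  definite \<open>u\<close>, whereas the Riccati system starts at the vertex \<open>0\<close>. The
  way out: the flow keeps positive definite matrices positive definite, so right derivatives exist
  along whole orbits in the interior, and the integrated estimate mentions only
  \<open>riccati_F\<close> and \<open>riccati_R\<close>, which are continuous on the closed cone.
  The size bounds on the flow come from a single orbit, that of \<open>mat 1\<close>: being
  differentiable at time \<open>0\<close>, it satisfies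
  \<open>\<psi> h (mat 1) \<le> (1 + C h) mat 1\<close> in the cone order for small
  \<open>h\<close>, and every other point is compared with a multiple of \<open>mat 1\<close>. No
  moment of \<open>X\<close> is assumed, so mean continuity in time is proved for
  \<open>exp (- trace (B ** X))\<close>, where second moments are explicit because the square is the
  exponential for \<open>2 B\<close>, and is carried over to the truncated rate. Limits are taken in
  a fixed order: the mesh tends to zero at fixed truncation, then the truncation level tends to
  infinity.\<close>

lemma trace_mult: "trace (A ** B) = (\<Sum>i\<in>UNIV. \<Sum>j\<in>UNIV. A $ i $ j * B $ j $ i)"
  for A B :: "real^'d^'d"
  by (simp add: trace_def matrix_matrix_mult_def)

lemma trace_mult_eq_inner: "trace (A ** B) = transpose A \<bullet> B" for A B :: "real^'d^'d"
proof -
  have "trace (A ** B) = (\<Sum>i\<in>UNIV. \<Sum>j\<in>UNIV. A $ j $ i * B $ i $ j)"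
    unfolding trace_mult by (rule sum.swap)
  also have "\<dots> = transpose A \<bullet> B" by (simp add: inner_vec_def transpose_def)
  finally show ?thesis .
qed

lemma norm_transpose [simp]: "norm (transpose A) = norm A" for A :: "real^'d^'d"
proof -
  have "(norm (transpose A))\<^sup>2 = (norm A)\<^sup>2"
    unfolding power2_norm_eq_inner by (simp add: inner_vec_def transpose_def) (rule sum.swap)
  thus ?thesis by simp
qed

lemma abs_trace_mult_le: "\<bar>trace (A ** B)\<bar> \<le> norm A * norm B" for A B :: "real^'d^'d"
  unfolding trace_mult_eq_inner using Cauchy_Schwarz_ineq2[of "transpose A" B] by simp

lemma trace_mult_add_left: "trace ((A + B) ** C) = trace (A ** C) + trace (B ** C)"
  and trace_mult_add_right: "trace (C ** (A + B)) = trace (C ** A) + trace (C ** B)"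
  and trace_mult_diff_left: "trace ((A - B) ** C) = trace (A ** C) - trace (B ** C)"
  and trace_mult_diff_right: "trace (C ** (A - B)) = trace (C ** A) - trace (C ** B)"
  and trace_mult_scaleR_left: "trace ((c *\<^sub>R A) ** C) = c * trace (A ** C)"
  and trace_mult_scaleR_right: "trace (C ** (c *\<^sub>R A)) = c * trace (C ** A)"
  for A B C :: "real^'d^'d"
  by (simp_all add: trace_mult algebra_simps sum.distrib sum_subtractf sum_distrib_left)

lemma trace_mult_minus_left: "trace ((- A) ** C) = - trace (A ** C)" for A C :: "real^'d^'d"
  by (simp add: trace_mult sum_negf)

lemma trace_mult_zero [simp]: "trace (0 ** C) = 0" "trace (C ** 0) = 0" for C :: "real^'d^'d"
  by (simp_all add: trace_mult trace_def)

lemma trace_mult_commute: "trace (A ** B) = trace (B ** A)" for A B :: "real^'d^'d"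
  by (rule trace_mul_sym)

lemmas trace_mult_simps = trace_mult_add_left trace_mult_add_right trace_mult_diff_left
  trace_mult_diff_right trace_mult_scaleR_left trace_mult_scaleR_right trace_mult_minus_left

lemma bounded_bilinear_trace_mult:
  "bounded_bilinear (\<lambda>A B :: real^'d^'d. trace (A ** B))"
  by (rule bounded_bilinear.intro)
     (auto simp: trace_mult_simps intro!: exI[of _ 1] abs_trace_mult_le)

lemmas tendsto_trace_mult [tendsto_intros] =
  bounded_bilinear.tendsto[OF bounded_bilinear_trace_mult]
lemmas continuous_on_trace_mult [continuous_intros] =
  bounded_bilinear.continuous_on[OF bounded_bilinear_trace_mult]

lemma borel_measurable_trace_mult [measurable]:
  fixes f g :: "'a \<Rightarrow> real^'d^'d"
  assumes "f \<in> borel_measurable N" "g \<in> borel_measurable N"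
  shows "(\<lambda>x. trace (f x ** g x)) \<in> borel_measurable N"
proof -
  have "continuous_on UNIV (\<lambda>p :: (real^'d^'d) \<times> (real^'d^'d). trace (fst p ** snd p))"
    by (intro continuous_intros)
  from borel_measurable_continuous_Pair[OF assms this[unfolded fst_def snd_def, unfolded case_prod_beta]]
  show ?thesis by simp
qed

text \<open>The rank-one matrices \<open>v v^T\<close>: pairing with them turns quadratic forms into
  traces, the only quantities that the Laplace transform of the process reveals.\<close>

definition outer :: "real^'d \<Rightarrow> real^'d^'d" where
  "outer v = (\<chi> i j. v $ i * v $ j)"

lemma quadratic_form: "v \<bullet> (A *v w) = (\<Sum>i\<in>UNIV. \<Sum>j\<in>UNIV. v $ i * A $ i $ j * w $ j)"
  for A :: "real^'d^'d"
  by (simp add: inner_vec_def matrix_vector_mult_def sum_distrib_left mult.assoc)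

lemma trace_mult_outer: "trace (A ** outer v) = v \<bullet> (A *v v)"
  unfolding trace_mult quadratic_form by (simp add: outer_def ac_simps)

lemma symmetric_matrix_iff: "symmetric_matrix A \<longleftrightarrow> (\<forall>i j. A $ i $ j = A $ j $ i)"
  by (auto simp: symmetric_matrix_def transpose_def vec_eq_iff)

lemma symmetric_matrix_simps [simp]:
  "symmetric_matrix 0" "symmetric_matrix (mat 1)" "symmetric_matrix (outer v)"
  by (auto simp: symmetric_matrix_iff mat_def outer_def)

lemma symmetric_matrix_intros:
  "symmetric_matrix A \<Longrightarrow> symmetric_matrix B \<Longrightarrow> symmetric_matrix (A + B)"
  "symmetric_matrix A \<Longrightarrow> symmetric_matrix B \<Longrightarrow> symmetric_matrix (A - B)"
  "symmetric_matrix A \<Longrightarrow> symmetric_matrix (c *\<^sub>R A)"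
  "symmetric_matrix A \<Longrightarrow> symmetric_matrix (- A)"
  by (auto simp: symmetric_matrix_iff)

lemma psd_symmetric: "A \<in> psd \<Longrightarrow> symmetric_matrix A"
  and psd_quadratic_form: "A \<in> psd \<Longrightarrow> 0 \<le> v \<bullet> (A *v v)"
  by (auto simp: psd_def)

lemma psdI: "symmetric_matrix A \<Longrightarrow> (\<And>v. 0 \<le> v \<bullet> (A *v v)) \<Longrightarrow> A \<in> psd"
  by (auto simp: psd_def)

lemma psd_zero [simp]: "0 \<in> psd"
  by (simp add: psdI)

lemma psd_mat_1 [simp]: "mat 1 \<in> psd"
  by (simp add: psdI)

lemma quadratic_form_outer: "w \<bullet> (outer v *v w) = (w \<bullet> v)\<^sup>2"
proof -
  have "w \<bullet> (outer v *v w) = (\<Sum>i\<in>UNIV. w $ i * v $ i)\<^sup>2"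
    unfolding quadratic_form power2_eq_square sum_product by (simp add: outer_def ac_simps)
  thus ?thesis by (simp add: inner_vec_def)
qed

lemma psd_outer [simp]: "outer v \<in> psd"
  by (rule psdI) (simp_all add: quadratic_form_outer)

lemma psd_add: "A \<in> psd \<Longrightarrow> B \<in> psd \<Longrightarrow> A + B \<in> psd"
  by (simp add: psd_def symmetric_matrix_intros matrix_vector_mult_add_rdistrib inner_add_right)

lemma psd_scaleR: "A \<in> psd \<Longrightarrow> 0 \<le> c \<Longrightarrow> c *\<^sub>R A \<in> psd"
  by (simp add: psd_def symmetric_matrix_intros scaleR_matrix_vector_assoc[symmetric])

lemma closed_psd: "closed (psd :: (real^'d^'d) set)"
proof -
  have "psd = (\<Inter>i j. {A :: real^'d^'d. A $ i $ j = A $ j $ i}) \<inter>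
      (\<Inter>v. {A. 0 \<le> trace (A ** outer v)})"
    by (auto simp: psd_def symmetric_matrix_iff trace_mult_outer)
  also have "closed \<dots>"
    by (intro closed_Int closed_INT ballI closed_Collect_eq closed_Collect_le continuous_intros)
  finally show ?thesis .
qed

lemma matrix_vector_mult_axis: "A *v axis i c = c *\<^sub>R column i A" for A :: "real^'d^'d"
  by (simp add: vec_eq_iff matrix_vector_mult_def column_def axis_def if_distrib cong: if_cong)

lemma quadratic_form_axis: "axis i 1 \<bullet> (A *v axis j 1) = A $ i $ j" for A :: "real^'d^'d"
  by (simp add: matrix_vector_mult_axis inner_axis' column_def)

lemma psd_diagonal_nonneg: "A \<in> psd \<Longrightarrow> 0 \<le> A $ i $ i"
  using psd_quadratic_form[of A "axis i 1"] by (simp add: quadratic_form_axis)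

lemma psd_Cauchy_Schwarz:
  assumes "A \<in> psd"
  shows "(v \<bullet> (A *v w))\<^sup>2 \<le> (v \<bullet> (A *v v)) * (w \<bullet> (A *v w))"
proof -
  let ?a = "v \<bullet> (A *v v)" and ?b = "v \<bullet> (A *v w)" and ?c = "w \<bullet> (A *v w)"
  have sym: "w \<bullet> (A *v v) = ?b"
    using assms psd_symmetric[OF assms]
    by (metis dot_lmul_matrix inner_commute symmetric_matrix_def transpose_matrix_vector)
  have q: "0 \<le> s\<^sup>2 * ?a + 2 * s * t * ?b + t\<^sup>2 * ?c" for s t
  proof -
    have "0 \<le> (s *\<^sub>R v + t *\<^sub>R w) \<bullet> (A *v (s *\<^sub>R v + t *\<^sub>R w))"
      by (rule psd_quadratic_form[OF assms])
    also have "\<dots> = s\<^sup>2 * ?a + 2 * s * t * ?b + t\<^sup>2 * ?c"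
      using sym
      by (simp add: matrix_vector_right_distrib matrix_vector_mult_scaleR inner_add_left
          inner_add_right algebra_simps power2_eq_square)
    finally show ?thesis .
  qed
  have a: "0 \<le> ?a" and c: "0 \<le> ?c" using psd_quadratic_form[OF assms] by auto
  show ?thesis
  proof (cases "?c = 0")
    case True
    have "?b = 0"
    proof (rule ccontr)
      assume "?b \<noteq> 0"
      \<comment> \<open>With \<open>?c = 0\<close> the form is affine in \<open>t\<close>; this
        \<open>t\<close> gives it the value \<open>- 1\<close>.\<close>
      with q[of 1 "- (?a + 1) / (2 * ?b)"] True show False by (simp add: field_simps)
    qed
    thus ?thesis using True by simp
  next
    case False
    \<comment> \<open>The minimizer up to scaling, \<open>s = ?c\<close> and
      \<open>t = - ?b\<close>, turns the form into \<open>?c\<close> times the difference that is to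
      be shown nonnegative.\<close>
    have "0 \<le> ?c\<^sup>2 * ?a - 2 * ?c * ?b * ?b + ?b\<^sup>2 * ?c"
      using q[of ?c "- ?b"] by (simp add: algebra_simps)
    also have "\<dots> = ?c * (?a * ?c - ?b\<^sup>2)" by (simp add: algebra_simps power2_eq_square)
    finally show ?thesis using c False by (simp add: zero_le_mult_iff)
  qed
qed

lemma psd_entry_square_le: "A \<in> psd \<Longrightarrow> (A $ i $ j)\<^sup>2 \<le> A $ i $ i * A $ j $ j"
  using psd_Cauchy_Schwarz[of A "axis i 1" "axis j 1"] by (simp add: quadratic_form_axis)

text \<open>Self-duality of the cone: subtracting from \<open>A\<close> the rank-one matrix that eliminates its
  \<open>i\<close>-th row and column leaves a positive semidefinite matrix with fewer nonzero diagonal entries.\<close>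

lemma trace_mult_psd_nonneg:
  fixes A B :: "real^'d^'d"
  assumes "A \<in> psd" "B \<in> psd"
  shows "0 \<le> trace (A ** B)"
  using assms(1)
proof (induction "card {i. A $ i $ i \<noteq> 0}" arbitrary: A rule: less_induct)
  case less
  note A = less.prems
  show ?case
  proof (cases "\<exists>i. A $ i $ i \<noteq> 0")
    case False
    hence "A $ i $ j = 0" for i j
      using psd_entry_square_le[OF A, of i j] by simp
    thus ?thesis by (simp add: trace_mult)
  next
    case True
    then obtain i where i: "A $ i $ i \<noteq> 0" by blast
    hence pos: "0 < A $ i $ i" using psd_diagonal_nonneg[OF A, of i] by simp
    define w where "w = column i A"
    define A' where "A' = A - (1 / A $ i $ i) *\<^sub>R outer w"
    have sym: "A $ k $ l = A $ l $ k" for k l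
      using psd_symmetric[OF A] by (simp add: symmetric_matrix_iff)
    have A': "A' \<in> psd"
    proof (rule psdI)
      show "symmetric_matrix A'"
        unfolding A'_def using psd_symmetric[OF A] by (intro symmetric_matrix_intros) auto
      fix v :: "real^'d"
      have "(v \<bullet> w)\<^sup>2 \<le> (v \<bullet> (A *v v)) * A $ i $ i"
        using psd_Cauchy_Schwarz[OF A, of v "axis i 1"]
        by (simp add: matrix_vector_mult_axis w_def inner_axis' column_def)
      thus "0 \<le> v \<bullet> (A' *v v)"
        using pos by (simp add: A'_def quadratic_form_outer matrix_vector_mult_diff_rdistrib inner_diff_right
            scaleR_matrix_vector_assoc[symmetric] field_simps)
    qed
    \<comment> \<open>A vanishing diagonal entry forces its row to vanish, so
      \<open>w $ k = 0\<close> and the subtraction leaves the zero in place, while \<open>i\<close>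
      is a new zero.\<close>
    have "A' $ k $ k = 0" if "A $ k $ k = 0" for k
      using psd_entry_square_le[OF A, of k i] that
      by (simp add: A'_def outer_def w_def column_def)
    moreover have "A' $ i $ i = 0" using pos by (simp add: A'_def outer_def w_def column_def)
    ultimately have "{k. A' $ k $ k \<noteq> 0} \<subset> {k. A $ k $ k \<noteq> 0}" using i by blast
    hence "0 \<le> trace (A' ** B)" by (intro less.hyps A' psubset_card_mono) auto
    moreover have "A = A' + (1 / A $ i $ i) *\<^sub>R outer w" by (simp add: A'_def)
    moreover have "0 \<le> trace (outer w ** B)"
      using psd_quadratic_form[OF assms(2)] by (simp add: trace_mult_commute[of "outer w"] trace_mult_outer)
    ultimately show ?thesis
      using pos by (metis add_nonneg_nonneg divide_nonneg_pos mult_nonneg_nonneg trace_mult_add_left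
          trace_mult_scaleR_left zero_le_one)
  qed
qed

lemma psd_iff_trace_mult_nonneg:
  "A \<in> psd \<longleftrightarrow> symmetric_matrix A \<and> (\<forall>x\<in>psd. 0 \<le> trace (A ** x))"
proof
  assume "A \<in> psd" thus "symmetric_matrix A \<and> (\<forall>x\<in>psd. 0 \<le> trace (A ** x))"
    by (auto simp: psd_symmetric trace_mult_psd_nonneg)
next
  assume "symmetric_matrix A \<and> (\<forall>x\<in>psd. 0 \<le> trace (A ** x))"
  thus "A \<in> psd" by (intro psdI) (auto simp flip: trace_mult_outer)
qed

section \<open>The cone order, norms and traces\<close>

lemma trace_mult_mono: "v - u \<in> psd \<Longrightarrow> x \<in> psd \<Longrightarrow> trace (u ** x) \<le> trace (v ** x)"
  using trace_mult_psd_nonneg[of "v - u" x] by (simp add: trace_mult_simps)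

text \<open>The \<open>2 x 2\<close> minors bound each squared entry by a product of diagonal
  entries, and these products sum to the squared trace. On the cone the norm may thus be replaced by
  a linear functional.\<close>

lemma norm_le_trace_psd: assumes "A \<in> psd" shows "norm A \<le> trace A"
proof -
  have "(norm A)\<^sup>2 = (\<Sum>i\<in>UNIV. \<Sum>j\<in>UNIV. (A $ i $ j)\<^sup>2)"
    unfolding power2_norm_eq_inner by (simp add: inner_vec_def power2_eq_square)
  also have "\<dots> \<le> (\<Sum>i\<in>UNIV. \<Sum>j\<in>UNIV. A $ i $ i * A $ j $ j)"
    by (intro sum_mono psd_entry_square_le assms)
  also have "\<dots> = (trace A)\<^sup>2" by (simp add: trace_def power2_eq_square sum_product)
  finally have "(norm A)\<^sup>2 \<le> (trace A)\<^sup>2" .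
  moreover have "0 \<le> trace A" by (simp add: trace_def sum_nonneg psd_diagonal_nonneg assms)
  ultimately show ?thesis by (simp add: power2_le_iff_abs_le)
qed

lemma trace_psd_nonneg: "A \<in> psd \<Longrightarrow> 0 \<le> trace A"
  using norm_le_trace_psd[of A] norm_ge_zero order_trans by blast

lemma abs_quadratic_form_le: "\<bar>v \<bullet> (A *v v)\<bar> \<le> norm A * (v \<bullet> v)" for A :: "real^'d^'d"
proof -
  have "(norm (outer v))\<^sup>2 = (v \<bullet> v)\<^sup>2"
    unfolding power2_norm_eq_inner power2_eq_square[of "v \<bullet> v"]
    by (simp add: inner_vec_def outer_def sum_product ac_simps)
  hence "norm (outer v) = v \<bullet> v" by simp
  thus ?thesis using abs_trace_mult_le[of A "outer v"] by (simp add: trace_mult_outer)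
qed

text \<open>Leads from norms to the cone order, in which the flow is monotone;
  \<open>norm_le_of_psd_order\<close> leads back.\<close>

lemma norm_mat_diff_psd:
  assumes "symmetric_matrix A" "norm A \<le> c"
  shows "c *\<^sub>R mat 1 - A \<in> psd" "c *\<^sub>R mat 1 + A \<in> psd"
proof -
  have le: "\<bar>v \<bullet> (A *v v)\<bar> \<le> c * (v \<bullet> v)" for v
    using abs_quadratic_form_le[of v A] mult_right_mono[OF assms(2), of "v \<bullet> v"] by simp
  show "c *\<^sub>R mat 1 - A \<in> psd"
  proof (rule psdI)
    show "0 \<le> v \<bullet> ((c *\<^sub>R mat 1 - A) *v v)" for v
      using le[of v] by (simp add: matrix_vector_mult_diff_rdistrib inner_diff_right
        scaleR_matrix_vector_assoc[symmetric])
  qed (simp add: symmetric_matrix_intros assms)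
  show "c *\<^sub>R mat 1 + A \<in> psd"
  proof (rule psdI)
    show "0 \<le> v \<bullet> ((c *\<^sub>R mat 1 + A) *v v)" for v
      using le[of v] by (simp add: matrix_vector_mult_add_rdistrib inner_add_right
        scaleR_matrix_vector_assoc[symmetric])
  qed (simp add: symmetric_matrix_intros assms)
qed

lemma psd_scaled: "y \<le> x \<Longrightarrow> x *\<^sub>R mat 1 - y *\<^sub>R mat 1 \<in> psd"
  using psd_scaleR[OF psd_mat_1, of "x - y"] by (simp add: scaleR_diff_left)

lemma psd_of_lower_bound: "u - c *\<^sub>R mat 1 \<in> psd \<Longrightarrow> 0 \<le> c \<Longrightarrow> u \<in> psd"
  using psd_add[of "u - c *\<^sub>R mat 1" "c *\<^sub>R mat 1"] psd_scaleR[OF psd_mat_1, of c] by simp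

lemma psd_order_trans: "v - u \<in> psd \<Longrightarrow> w - v \<in> psd \<Longrightarrow> w - u \<in> psd"
  using psd_add[of "v - u" "w - v"] by simp

lemma trace_mat_mult: "trace ((c *\<^sub>R mat 1) ** x) = c * trace x" for x :: "real^'d^'d"
  by (simp add: trace_mult_simps)

lemma trace_mult_lower:
  assumes "u - c *\<^sub>R mat 1 \<in> psd" "x \<in> psd"
  shows "c * trace x \<le> trace (u ** x)"
  using trace_mult_mono[OF assms] by (simp add: trace_mat_mult)

lemma trace_mult_upper:
  assumes "c *\<^sub>R mat 1 - u \<in> psd" "x \<in> psd"
  shows "trace (u ** x) \<le> c * trace x"
  using trace_mult_mono[OF assms] by (simp add: trace_mat_mult)

lemma trace_mat_1: "trace (mat 1 :: real^'d^'d) = CARD('d)"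
  by (simp add: trace_I)

lemma norm_le_of_psd_order:
  fixes u :: "real^'d^'d"
  assumes "u \<in> psd" "c *\<^sub>R mat 1 - u \<in> psd"
  shows "norm u \<le> c * CARD('d)"
  using norm_le_trace_psd[OF assms(1)] trace_mult_upper[OF assms(2), of "mat 1"]
  by (simp add: trace_mat_1)

text \<open>Polarization. A symmetric matrix is determined by its traces against the cone, and
  convergence of these traces gives convergence of the matrix.\<close>

lemma symmetric_entry:
  fixes A :: "real^'d^'d"
  assumes "symmetric_matrix A"
  shows "A $ i $ j = (trace (A ** outer (axis i 1 + axis j 1)) - trace (A ** outer (axis i 1))
            - trace (A ** outer (axis j 1))) / 2"
  using assms unfolding trace_mult_outer
  by (simp add: matrix_vector_right_distrib inner_add_left inner_add_right quadratic_form_axis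
      symmetric_matrix_iff)

lemma tendsto_symmetricI:
  fixes f :: "'a \<Rightarrow> real^'d^'d"
  assumes "eventually (\<lambda>t. symmetric_matrix (f t)) G" "symmetric_matrix L"
    and lim: "\<And>x. x \<in> psd \<Longrightarrow> ((\<lambda>t. trace (f t ** x)) \<longlongrightarrow> trace (L ** x)) G"
  shows "(f \<longlongrightarrow> L) G"
proof (intro vec_tendstoI)
  fix i j
  have "((\<lambda>t. (trace (f t ** outer (axis i 1 + axis j 1)) - trace (f t ** outer (axis i 1))
            - trace (f t ** outer (axis j 1))) / 2) \<longlongrightarrow> L $ i $ j) G"
    unfolding symmetric_entry[OF assms(2), of i j] by (intro tendsto_divide tendsto_diff tendsto_const lim psd_outer) simp
  thus "((\<lambda>t. f t $ i $ j) \<longlongrightarrow> L $ i $ j) G"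
    by (rule Lim_transform_eventually)
       (use assms(1) in eventually_elim, simp add: symmetric_entry[symmetric])
qed

lemma symmetric_eqI:
  assumes "symmetric_matrix A" "symmetric_matrix B"
    and "\<And>x. x \<in> psd \<Longrightarrow> trace (A ** x) = trace (B ** x)"
  shows "A = B"
  by (simp add: vec_eq_iff symmetric_entry[OF assms(1)] symmetric_entry[OF assms(2)] assms(3))

section \<open>A mean value inequality for right derivatives\<close>

text \<open>Supremum argument: the times reached with average speed at most \<open>M + e\<close>
  form a closed set, and if its supremum were below \<open>b\<close>, the right derivative there
  would push it further; the slack \<open>e\<close> pays for the limit. Right derivatives are what a
  generator provides, since it describes motion forward in time.\<close>

lemma norm_diff_le_right_derivative:
  fixes f :: "real \<Rightarrow> 'a::real_normed_vector"
  assumes "a \<le> b" and cont: "continuous_on {a..b} f"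
    and deriv: "\<And>t. a \<le> t \<Longrightarrow> t < b \<Longrightarrow> ((\<lambda>h. (f (t + h) - f t) /\<^sub>R h) \<longlongrightarrow> f' t) (at_right 0)"
    and bound: "\<And>t. a \<le> t \<Longrightarrow> t < b \<Longrightarrow> norm (f' t) \<le> M"
  shows "norm (f b - f a) \<le> M * (b - a)"
proof -
  have "norm (f b - f a) \<le> (M + e) * (b - a)" if "e > 0" for e
  proof -
    define S where "S = {t \<in> {a..b}. norm (f t - f a) \<le> (M + e) * (t - a)}"
    have "closed S"
      unfolding S_def using cont
      by (intro continuous_on_closed_Collect_le continuous_intros) auto
    moreover have "a \<in> S" using \<open>a \<le> b\<close> by (auto simp: S_def)
    moreover have bdd: "bdd_above S" by (auto simp: S_def intro: bdd_aboveI[of _ b])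
    ultimately have c: "Sup S \<in> S" by (intro closed_contains_Sup) auto
    have upper: "t \<le> Sup S" if "t \<in> S" for t using that bdd by (rule cSup_upper)
    define c where "c = Sup S"
    have "c = b"
    proof (rule ccontr)
      assume "c \<noteq> b"
      hence cb: "a \<le> c" "c < b" using c by (auto simp: S_def c_def)
      have "((\<lambda>h. norm ((f (c + h) - f c) /\<^sub>R h)) \<longlongrightarrow> norm (f' c)) (at_right 0)"
        by (intro tendsto_norm deriv cb)
      hence "eventually (\<lambda>h. norm ((f (c + h) - f c) /\<^sub>R h) < M + e) (at_right 0)"
        using bound[OF cb] \<open>e > 0\<close> by (intro order_tendstoD) auto
      moreover have "eventually (\<lambda>h. h < b - c) (at_right (0::real))"
        using cb by (intro eventually_at_rightI[of 0 "b - c"]) auto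
      moreover have "eventually (\<lambda>h. 0 < h) (at_right (0::real))"
        by (simp add: eventually_at_right_less)
      ultimately have "eventually (\<lambda>h. norm ((f (c + h) - f c) /\<^sub>R h) < M + e \<and> h < b - c \<and> 0 < h)
          (at_right 0)" by eventually_elim simp
      then obtain h where h: "norm ((f (c + h) - f c) /\<^sub>R h) < M + e" "h < b - c" "0 < h"
        by (auto dest!: eventually_happens)
      have "norm (f (c + h) - f c) \<le> (M + e) * h"
        using h(1,3) less_imp_le[OF h(1)] unfolding norm_scaleR by (simp add: field_simps)
      moreover have "norm (f c - f a) \<le> (M + e) * (c - a)" using c by (auto simp: S_def c_def)
      ultimately have "norm (f (c + h) - f a) \<le> (M + e) * (c + h - a)"
        using norm_triangle_ineq[of "f (c + h) - f c" "f c - f a"] by (simp add: algebra_simps)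
      hence "c + h \<in> S" using h cb by (auto simp: S_def)
      thus False using upper[of "c + h"] h by (simp add: c_def)
    qed
    thus ?thesis using c by (simp add: S_def c_def)
  qed
  hence "eventually (\<lambda>e. norm (f b - f a) \<le> (M + e) * (b - a)) (at_right 0)"
    by (auto simp: eventually_at_filter)
  moreover have "((\<lambda>e. (M + e) * (b - a)) \<longlongrightarrow> (M + 0) * (b - a)) (at_right 0)"
    by (intro tendsto_intros)
  ultimately show ?thesis by (intro tendsto_lowerbound[where F="at_right (0::real)"]) auto
qed

section \<open>Jordan decomposition of dominated signed measures\<close>

lemma finite_signed_measure_empty: "finite_signed_measure N \<nu> \<Longrightarrow> \<nu> {} = 0"
  by (simp add: finite_signed_measure_def)

lemma finite_signed_measure_sums:
  "finite_signed_measure N \<nu> \<Longrightarrow> range A \<subseteq> sets N \<Longrightarrow> disjoint_family A \<Longrightarrow>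
    (\<lambda>n. \<nu> (A n)) sums \<nu> (\<Union>n. A n)"
  by (simp add: finite_signed_measure_def)

lemma finite_signed_measure_Un:
  assumes "finite_signed_measure N \<nu>" "A \<in> sets N" "B \<in> sets N" "A \<inter> B = {}"
  shows "\<nu> (A \<union> B) = \<nu> A + \<nu> B"
proof -
  have "(\<lambda>n. \<nu> (binaryset A B n)) sums \<nu> (\<Union>n. binaryset A B n)"
    using assms by (intro finite_signed_measure_sums) 
      (auto simp: range_binaryset_eq disjoint_family_on_def binaryset_def)
  moreover have "(\<lambda>n. \<nu> (binaryset A B n)) sums (\<nu> A + \<nu> B)"
    by (rule binaryset_sums) (rule finite_signed_measure_empty[OF assms(1)])
  ultimately show ?thesis by (simp add: UN_binaryset_eq sums_unique2)
qed

lemma finite_signed_measure_add: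
  "finite_signed_measure N \<nu> \<Longrightarrow> finite_signed_measure N \<kappa> \<Longrightarrow>
    finite_signed_measure N (\<lambda>E. \<nu> E + \<kappa> E)"
  by (simp add: finite_signed_measure_def sums_add)

lemma finite_signed_measure_mult:
  "finite_signed_measure N \<nu> \<Longrightarrow> finite_signed_measure N (\<lambda>E. c * \<nu> E)"
  by (simp add: finite_signed_measure_def sums_mult)

lemma finite_signed_measure_minus:
  "finite_signed_measure N \<nu> \<Longrightarrow> finite_signed_measure N (\<lambda>E. - \<nu> E)"
  by (simp add: finite_signed_measure_def sums_minus)

lemma finite_signed_measure_sum:
  assumes "\<And>k. k \<in> K \<Longrightarrow> finite_signed_measure N (\<nu> k)"
  shows "finite_signed_measure N (\<lambda>E. \<Sum>k\<in>K. \<nu> k E)"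
  using assms by (auto simp: finite_signed_measure_def intro!: sums_sum)

lemma finite_signed_measure_restrict:
  assumes "finite_signed_measure N \<nu>" "Y \<in> sets N"
  shows "finite_signed_measure N (\<lambda>E. \<nu> (E \<inter> Y))"
  unfolding finite_signed_measure_def
proof (intro conjI allI impI)
  fix A :: "nat \<Rightarrow> _" assume A: "range A \<subseteq> sets N" "disjoint_family A"
  have "(\<lambda>n. \<nu> (A n \<inter> Y)) sums \<nu> (\<Union>n. A n \<inter> Y)"
    using A assms(2) by (intro finite_signed_measure_sums[OF assms(1)])
      (auto simp: disjoint_family_on_def)
  moreover have "(\<Union>n. A n \<inter> Y) = (\<Union>n. A n) \<inter> Y" by blast
  ultimately show "(\<lambda>n. \<nu> (A n \<inter> Y)) sums \<nu> ((\<Union>n. A n) \<inter> Y)" by simp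
qed (use assms in \<open>simp add: finite_signed_measure_def\<close>)

text \<open>The set function \<open>g\<close> is kept apart from \<open>\<rho>\<close> because in
  \<open>jordan_pos\<close> it is a supremum, known to agree with a signed measure only on
  measurable sets.\<close>

lemma measure_of_signed:
  assumes \<rho>: "finite_signed_measure N \<rho>" and nonneg: "\<And>E. E \<in> sets N \<Longrightarrow> 0 \<le> \<rho> E"
    and g: "\<And>E. E \<in> sets N \<Longrightarrow> g E = ennreal (\<rho> E)"
  defines "P \<equiv> measure_of (space N) (sets N) g"
  shows "sets P = sets N" "finite_measure P" "\<And>E. E \<in> sets N \<Longrightarrow> measure P E = \<rho> E"
    "\<And>E. E \<in> sets N \<Longrightarrow> emeasure P E = ennreal (\<rho> E)"
proof -
  show sets: "sets P = sets N" by (simp add: P_def)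
  show em: "emeasure P E = ennreal (\<rho> E)" if E: "E \<in> sets N" for E
  proof -
    have "emeasure P E = g E"
      unfolding P_def
    proof (rule emeasure_measure_of_sigma[OF _ _ _ E])
      show "sigma_algebra (space N) (sets N)" by (rule sets.sigma_algebra_axioms)
      show "positive (sets N) g"
        using finite_signed_measure_empty[OF \<rho>] by (simp add: positive_def g)
      show "countably_additive (sets N) g"
      proof (rule countably_additiveI)
        fix A :: "nat \<Rightarrow> _"
        assume A: "range A \<subseteq> sets N" "disjoint_family A" "(\<Union>i. A i) \<in> sets N"
        hence "(\<Sum>i. ennreal (\<rho> (A i))) = ennreal (\<rho> (\<Union>i. A i))"
          by (intro suminf_ennreal_eq finite_signed_measure_sums[OF \<rho>] nonneg) auto
        moreover have "g (A i) = ennreal (\<rho> (A i))" for i using A(1) by (intro g) auto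
        ultimately show "(\<Sum>i. g (A i)) = g (\<Union>i. A i)" using g[OF A(3)] by simp
      qed
    qed
    thus ?thesis using g[OF E] by simp
  qed
  show "finite_measure P"
  proof (rule finite_measureI)
    have "space P = space N" by (rule sets_eq_imp_space_eq[OF sets])
    thus "emeasure P (space P) \<noteq> \<infinity>" using em[of "space N"] by simp
  qed
  show "measure P E = \<rho> E" if "E \<in> sets N" for E
    using em[OF that] nonneg[OF that] by (simp add: measure_def)
qed

text \<open>The dominating \<open>\<kappa>\<close> spares a finiteness proof for the total
  variation: \<open>\<kappa> + \<nu>\<close> and \<open>\<kappa> - \<nu>\<close> are finite positive
  measures, and a Hahn set for this pair is one for \<open>\<nu>\<close>. The supremum in
  \<open>jordan_pos\<close> is then attained at the part of \<open>E\<close> inside the Hahn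
  set.\<close>

lemma jordan_decomposition:
  assumes \<nu>: "finite_signed_measure N \<nu>" and \<kappa>: "finite_signed_measure N \<kappa>"
    and dom: "\<And>E. E \<in> sets N \<Longrightarrow> \<bar>\<nu> E\<bar> \<le> \<kappa> E"
  shows "sets (jordan_pos N \<nu>) = sets N" "finite_measure (jordan_pos N \<nu>)"
    "sets (jordan_neg N \<nu>) = sets N" "finite_measure (jordan_neg N \<nu>)"
    "\<And>E. E \<in> sets N \<Longrightarrow> measure (jordan_pos N \<nu>) E - measure (jordan_neg N \<nu>) E = \<nu> E"
proof -
  define P1 where "P1 = measure_of (space N) (sets N) (\<lambda>E. ennreal (\<kappa> E + \<nu> E))"
  define P2 where "P2 = measure_of (space N) (sets N) (\<lambda>E. ennreal (\<kappa> E + - \<nu> E))"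
  have nn: "0 \<le> \<kappa> E + \<nu> E" "0 \<le> \<kappa> E + - \<nu> E" if "E \<in> sets N" for E
    using dom[OF that] by auto
  note P1 = measure_of_signed[OF finite_signed_measure_add[OF \<kappa> \<nu>] nn(1) refl, folded P1_def]
  note P2 = measure_of_signed[OF finite_signed_measure_add[OF \<kappa> finite_signed_measure_minus[OF \<nu>]]
      nn(2) refl, folded P2_def]
  obtain Y where Y: "Y \<in> sets N" "\<And>X. X \<in> sets N \<Longrightarrow> X \<subseteq> Y \<Longrightarrow> emeasure P2 X \<le> emeasure P1 X"
    "\<And>X. X \<in> sets N \<Longrightarrow> X \<inter> Y = {} \<Longrightarrow> emeasure P1 X \<le> emeasure P2 X"
    using finite_unsigned_Hahn_decomposition[of P1 P2] P1(1,2) P2(1,2) by auto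
  have pos: "0 \<le> \<nu> X" if "X \<in> sets N" "X \<subseteq> Y" for X
    using Y(2)[OF that] nn[OF that(1)] by (simp add: P1(4) P2(4) that)
  have neg: "\<nu> X \<le> 0" if "X \<in> sets N" "X \<inter> Y = {}" for X
    using Y(3)[OF that] nn[OF that(1)] by (simp add: P1(4) P2(4) that)
  have split: "\<nu> E = \<nu> (E \<inter> Y) + \<nu> (E \<inter> (space N - Y))" if "E \<in> sets N" for E
  proof -
    have "E = (E \<inter> Y) \<union> (E \<inter> (space N - Y))" using sets.sets_into_space[OF that] by blast
    thus ?thesis
      using finite_signed_measure_Un[OF \<nu>, of "E \<inter> Y" "E \<inter> (space N - Y)"] that Y(1) by auto
  qed
  \<comment> \<open>Stated for any \<open>\<sigma>\<close> with positive set \<open>Z\<close>, to be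
    applied to \<open>\<nu>\<close> with \<open>Y\<close> and to \<open>- \<nu>\<close> with the
    complement of \<open>Y\<close>.\<close>
  have sup: "(SUP G\<in>{G \<in> sets N. G \<subseteq> E}. ennreal (\<sigma> G)) = ennreal (\<sigma> (E \<inter> Z))"
    if E: "E \<in> sets N" and Z: "Z \<in> sets N"
      and s: "\<And>E. E \<in> sets N \<Longrightarrow> \<sigma> E = \<sigma> (E \<inter> Z) + \<sigma> (E \<inter> (space N - Z))"
      and p: "\<And>X. X \<in> sets N \<Longrightarrow> X \<subseteq> Z \<Longrightarrow> 0 \<le> \<sigma> X"
      and n: "\<And>X. X \<in> sets N \<Longrightarrow> X \<inter> Z = {} \<Longrightarrow> \<sigma> X \<le> 0"
      and add: "\<And>A B. A \<in> sets N \<Longrightarrow> B \<in> sets N \<Longrightarrow> A \<inter> B = {} \<Longrightarrow> \<sigma> (A \<union> B) = \<sigma> A + \<sigma> B"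
    for E Z and \<sigma> :: "_ \<Rightarrow> real"
  proof (rule antisym)
    show "(SUP G\<in>{G \<in> sets N. G \<subseteq> E}. ennreal (\<sigma> G)) \<le> ennreal (\<sigma> (E \<inter> Z))"
    proof (rule SUP_least)
      fix G assume "G \<in> {G \<in> sets N. G \<subseteq> E}"
      hence G: "G \<in> sets N" "G \<subseteq> E" by auto
      have "\<sigma> (G \<inter> (space N - Z)) \<le> 0" using G Z by (intro n) auto
      hence "\<sigma> G \<le> \<sigma> (G \<inter> Z)" using s[OF G(1)] by linarith
      also have "0 \<le> \<sigma> ((E - G) \<inter> Z)" using G E Z by (intro p) auto
      moreover have "\<sigma> ((G \<inter> Z) \<union> ((E - G) \<inter> Z)) = \<sigma> (G \<inter> Z) + \<sigma> ((E - G) \<inter> Z)"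
        using G E Z by (intro add) auto
      moreover have "(G \<inter> Z) \<union> ((E - G) \<inter> Z) = E \<inter> Z" using G(2) by blast
      ultimately have "\<sigma> G \<le> \<sigma> (E \<inter> Z)" by simp
      thus "ennreal (\<sigma> G) \<le> ennreal (\<sigma> (E \<inter> Z))" by (rule ennreal_leI)
    qed
    show "ennreal (\<sigma> (E \<inter> Z)) \<le> (SUP G\<in>{G \<in> sets N. G \<subseteq> E}. ennreal (\<sigma> G))"
      using E Z by (intro SUP_upper2[of "E \<inter> Z"]) auto
  qed
  note Un = finite_signed_measure_Un[OF \<nu>]
  have YC: "space N - Y \<in> sets N" using Y(1) by auto
  have sup_pos: "(SUP G\<in>{G \<in> sets N. G \<subseteq> E}. ennreal (\<nu> G)) = ennreal (\<nu> (E \<inter> Y))"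
    if "E \<in> sets N" for E
    by (rule sup[OF that Y(1) split pos neg Un])
  have sup_neg: "(SUP G\<in>{G \<in> sets N. G \<subseteq> E}. ennreal (- \<nu> G)) = ennreal (- \<nu> (E \<inter> (space N - Y)))"
    if "E \<in> sets N" for E
  proof (rule sup[OF that YC, of "\<lambda>E. - \<nu> E"])
    fix E assume E: "E \<in> sets N"
    have "E \<inter> (space N - (space N - Y)) = E \<inter> Y" using sets.sets_into_space[OF E] by blast
    thus "- \<nu> E = - \<nu> (E \<inter> (space N - Y)) + - \<nu> (E \<inter> (space N - (space N - Y)))"
      using split[OF E] by simp
  next
    fix X assume X: "X \<in> sets N" "X \<subseteq> space N - Y"
    thus "0 \<le> - \<nu> X" using neg[OF X(1)] by auto
  next
    fix X assume X: "X \<in> sets N" "X \<inter> (space N - Y) = {}"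
    hence "X \<subseteq> Y" using sets.sets_into_space[OF X(1)] by blast
    thus "- \<nu> X \<le> 0" using pos[OF X(1)] by auto
  next
    fix A B assume "A \<in> sets N" "B \<in> sets N" "A \<inter> B = {}"
    thus "- \<nu> (A \<union> B) = - \<nu> A + - \<nu> B" using Un by simp
  qed
  have "0 \<le> \<nu> (E \<inter> Y)" "0 \<le> - \<nu> (E \<inter> (space N - Y))" if "E \<in> sets N" for E
    using pos[of "E \<inter> Y"] neg[of "E \<inter> (space N - Y)"] that Y(1) YC by auto
  note nn' = this
  note J1 = measure_of_signed[OF finite_signed_measure_restrict[OF \<nu> Y(1)] nn'(1) sup_pos,
      folded jordan_pos_def]
  note J2 = measure_of_signed[OF finite_signed_measure_minus[OF finite_signed_measure_restrict[OF \<nu> YC]]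
      nn'(2) sup_neg, folded jordan_pos_def, folded jordan_neg_def]
  show "sets (jordan_pos N \<nu>) = sets N" "finite_measure (jordan_pos N \<nu>)"
    "sets (jordan_neg N \<nu>) = sets N" "finite_measure (jordan_neg N \<nu>)"
    using J1(1,2) J2(1,2) by -
  show "measure (jordan_pos N \<nu>) E - measure (jordan_neg N \<nu>) E = \<nu> E" if "E \<in> sets N" for E
    using split[OF that] by (simp add: J1(3) J2(3) that)
qed

lemma jordan_pos_cong:
  assumes "\<And>E. E \<in> sets N \<Longrightarrow> \<nu> E = \<nu>' E"
  shows "jordan_pos N \<nu> = jordan_pos N \<nu>'"
  unfolding jordan_pos_def using assms
  by (intro measure_of_eq sets.space_closed SUP_cong) auto

lemma signed_integral_cong:
  assumes "\<And>E. E \<in> sets N \<Longrightarrow> \<nu> E = \<nu>' E"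
  shows "signed_integral N \<nu> f = signed_integral N \<nu>' f"
  using jordan_pos_cong[of N \<nu> \<nu>'] jordan_pos_cong[of N "\<lambda>E. - \<nu> E" "\<lambda>E. - \<nu>' E"] assms
  by (simp add: signed_integral_def jordan_neg_def)

text \<open>For indicators this is \<open>eq\<close>, and it spreads by approximation. The
  coefficients may be negative, so the limit step rests on dominated convergence for each measure
  separately, with a constant majorant; hence the bound on \<open>f\<close> and the finite
  measures.\<close>

lemma integral_linear_combination:
  fixes f :: "'a \<Rightarrow> real"
  assumes "finite K" "finite_measure \<nu>" and J: "\<And>k. k \<in> K \<Longrightarrow> finite_measure (J k)"
    and sets: "\<And>k. k \<in> K \<Longrightarrow> sets (J k) = sets \<nu>"
    and eq: "\<And>E. E \<in> sets \<nu> \<Longrightarrow> measure \<nu> E = (\<Sum>k\<in>K. c k * measure (J k) E)"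
    and f: "f \<in> borel_measurable \<nu>" and bound: "\<And>x. x \<in> space \<nu> \<Longrightarrow> \<bar>f x\<bar> \<le> C"
  shows "(LINT x|\<nu>. f x) = (\<Sum>k\<in>K. c k * (LINT x|J k. f x))"
proof -
  interpret \<nu>: finite_measure \<nu> by fact
  have space: "space (J k) = space \<nu>" if "k \<in> K" for k
    using sets[OF that] by (rule sets_eq_imp_space_eq)
  have meas: "g \<in> borel_measurable (J k)" if "g \<in> borel_measurable \<nu>" "k \<in> K" for g :: "'a \<Rightarrow> real" and k
    using that by (simp add: measurable_cong_sets[OF sets[OF that(2)] refl])
  have int\<nu>: "integrable \<nu> g" if "g \<in> borel_measurable \<nu>" "\<And>x. x \<in> space \<nu> \<Longrightarrow> \<bar>g x\<bar> \<le> B" for g :: "'a \<Rightarrow> real" and B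
    using that(1) by (rule \<nu>.integrable_const_bound[where B = B, rotated])
      (intro AE_I2, unfold real_norm_def, rule that(2))
  have intJ: "integrable (J k) g" if "g \<in> borel_measurable \<nu>" "\<And>x. x \<in> space \<nu> \<Longrightarrow> \<bar>g x\<bar> \<le> B" "k \<in> K"
    for g :: "'a \<Rightarrow> real" and k B
    using meas[OF that(1,3)]
    by (rule finite_measure.integrable_const_bound[OF J[OF that(3)], where B = B, rotated])
      (intro AE_I2, unfold real_norm_def space[OF that(3)], rule that(2))
  let ?eq = "\<lambda>g. (LINT x|\<nu>. g x) = (\<Sum>k\<in>K. c k * (LINT x|J k. g x))"
  \<comment> \<open>Boundedness stands inside the claim so that the induction can hand it down to
    the pieces of \<open>g\<close>.\<close>
  have nonneg: "(\<exists>B. \<forall>x\<in>space \<nu>. g x \<le> B) \<longrightarrow> ?eq g"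
    if g: "g \<in> borel_measurable \<nu>" "\<And>x. 0 \<le> g x" for g
    using g
  proof (induct rule: borel_measurable_induct_real)
    case (set A)
    have "(LINT x|J k. indicator A x) = measure (J k) A" if "k \<in> K" for k
      using set sets[OF that] sets.sets_into_space[OF set] space[OF that]
      by (simp add: Int_absorb2)
    thus ?case using set sets.sets_into_space[OF set] by (simp add: eq Int_absorb2)
  next
    case (mult u a)
    show ?case
    \<comment> \<open>For \<open>a = 0\<close> the factor \<open>u\<close> may be unbounded, but
      then both sides vanish.\<close>
    proof (cases "a = 0")
      case False
      have "\<exists>B. \<forall>x\<in>space \<nu>. u x \<le> B" if "\<forall>x\<in>space \<nu>. a * u x \<le> B" for B
        using that mult(1) False by (intro exI[of _ "B / a"]) (auto simp: field_simps)
      thus ?thesis using mult(4) by (auto simp: sum_distrib_left ac_simps)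
    qed simp
  next
    case (add u v)
    show ?case
    proof
      assume "\<exists>B. \<forall>x\<in>space \<nu>. v x + u x \<le> B"
      then obtain B where B: "\<And>x. x \<in> space \<nu> \<Longrightarrow> v x + u x \<le> B" by auto
      have uB: "\<bar>u x\<bar> \<le> B" "\<bar>v x\<bar> \<le> B" if "x \<in> space \<nu>" for x
        using B[OF that] add(2,5)[of x] by auto
      hence "?eq u" "?eq v" using add(3,7) by (auto intro!: exI[of _ B] simp: abs_le_iff)
      thus "?eq (\<lambda>x. v x + u x)"
        using int\<nu>[OF add(1) uB(1)] int\<nu>[OF add(4) uB(2)] intJ[OF add(1) uB(1)] intJ[OF add(4) uB(2)]
        by (simp add: sum.distrib distrib_left)
    qed
  next
    case (seq U)
    show ?case
    proof
      assume "\<exists>B. \<forall>x\<in>space \<nu>. g x \<le> B"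
      then obtain B where B: "\<And>x. x \<in> space \<nu> \<Longrightarrow> g x \<le> B" by auto
      have Ug: "U i x \<le> g x" if "x \<in> space \<nu>" for i x
        using seq(5)[OF that] seq(4) by (intro incseq_le[of "\<lambda>i. U i x"]) (auto simp: incseq_def le_fun_def)
      have UB: "\<bar>U i x\<bar> \<le> B" if "x \<in> space \<nu>" for i x
        using Ug[OF that, of i] B[OF that] seq(2)[of i x] by auto
      have "?eq (U i)" for i using seq(3)[of i] UB by (auto intro!: exI[of _ B] simp: abs_le_iff)
      moreover have "(\<lambda>i. LINT x|\<nu>. U i x) \<longlonglongrightarrow> (LINT x|\<nu>. g x)"
        using seq UB B g by (intro integral_dominated_convergence[where w = "\<lambda>_. B"]) auto
      moreover have "(\<lambda>i. \<Sum>k\<in>K. c k * (LINT x|J k. U i x)) \<longlonglongrightarrow> (\<Sum>k\<in>K. c k * (LINT x|J k. g x))"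
      proof (intro tendsto_sum tendsto_mult_left)
        fix k assume k: "k \<in> K"
        interpret Jk: finite_measure "J k" by (rule J[OF k])
        show "(\<lambda>i. LINT x|J k. U i x) \<longlonglongrightarrow> (LINT x|J k. g x)"
          using seq UB B g k by (intro integral_dominated_convergence[where w = "\<lambda>_. B"] meas) (auto simp: space)
      qed
      ultimately show "?eq g" by (simp add: LIMSEQ_unique)
    qed
  qed
  \<comment> \<open>The shift by \<open>C\<close> makes \<open>f\<close> nonnegative on the space;
    \<open>max 0\<close> does so outside it, where \<open>bound\<close> says nothing.\<close>
  let ?g = "\<lambda>x. max 0 (f x + C)"
  have eqg: "?eq ?g"
    using f bound by (intro nonneg[rule_format] exI[of _ "2 * \<bar>C\<bar>"]) (auto simp: abs_le_iff, smt (verit))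
  have fg: "f x = ?g x - C" if "x \<in> space \<nu>" for x using bound[OF that] by auto
  have gb: "\<bar>?g x\<bar> \<le> 2 * \<bar>C\<bar>" if "x \<in> space \<nu>" for x using bound[OF that] by auto
  have gm: "?g \<in> borel_measurable \<nu>" using f by simp
  have "(LINT x|\<nu>. f x) = (LINT x|\<nu>. ?g x - C)"
    by (rule Bochner_Integration.integral_cong) (auto intro: fg)
  also have "\<dots> = (LINT x|\<nu>. ?g x) - C * measure \<nu> (space \<nu>)"
    using int\<nu>[OF gm gb] by simp
  also have "\<dots> = (\<Sum>k\<in>K. c k * ((LINT x|J k. ?g x) - C * measure (J k) (space \<nu>)))"
    using eqg by (simp add: eq sum_distrib_left sum_subtractf right_diff_distrib ac_simps)
  also have "\<dots> = (\<Sum>k\<in>K. c k * (LINT x|J k. f x))"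
  proof (rule sum.cong[OF refl])
    fix k assume k: "k \<in> K"
    interpret Jk: finite_measure "J k" by (rule J[OF k])
    have "(LINT x|J k. f x) = (LINT x|J k. ?g x - C)"
      by (rule Bochner_Integration.integral_cong) (auto intro: fg simp: space[OF k])
    thus "c k * ((LINT x|J k. ?g x) - C * measure (J k) (space \<nu>)) = c k * (LINT x|J k. f x)"
      using intJ[OF gm gb k] by (simp add: space[OF k])
  qed
  finally show ?thesis .
qed

section \<open>The right-hand sides of the Riccati equations\<close>

lemma space_psd0: "space psd0_space = (psd - {0} :: (real^'d^'d) set)"
  by (simp add: psd0_space_def space_restrict_space)

lemma borel_measurable_psd0_spaceI:
  fixes f :: "real^'d^'d \<Rightarrow> 'b::topological_space"
  shows "continuous_on psd f \<Longrightarrow> f \<in> borel_measurable psd0_space"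
  unfolding psd0_space_def
  by (rule borel_measurable_continuous_on_restrict) (blast intro: continuous_on_subset)

lemma id_measurable_psd0_space [measurable]: "(\<lambda>\<xi>. \<xi>) \<in> borel_measurable psd0_space"
  by (rule borel_measurable_psd0_spaceI) (rule continuous_on_id)

text \<open>The upper bound comes from \<open>exp (- y) \<le> 1 / (1 + y)\<close>. Its quadratic
  order is what compensates the weight \<open>1 / (norm \<xi>)^2\<close> of the jump kernel near the
  origin.\<close>

lemma exp_minus_diff_bounds:
  fixes y :: real
  assumes "0 \<le> y"
  shows "0 \<le> exp (- y) - 1 + y" "exp (- y) - 1 + y \<le> y\<^sup>2"
proof -
  show "0 \<le> exp (- y) - 1 + y" using exp_ge_add_one_self[of "- y"] by simp
  have "exp (- y) \<le> 1 / (1 + y)"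
    using exp_ge_add_one_self[of y] assms by (simp add: exp_minus field_simps)
  also have "\<dots> \<le> 1 - y + y\<^sup>2"
  proof -
    have "1 \<le> (1 - y + y\<^sup>2) * (1 + y)"
      using assms by (simp add: algebra_simps power2_eq_square)
    thus ?thesis using assms by (simp add: field_simps)
  qed
  finally show "exp (- y) - 1 + y \<le> y\<^sup>2" by simp
qed

lemma abs_exp_minus_diff_le:
  fixes x y :: real
  assumes "0 \<le> x" "0 \<le> y"
  shows "\<bar>exp (- x) - exp (- y)\<bar> \<le> \<bar>x - y\<bar>"
proof -
  have *: "exp (- x) - exp (- y) \<le> \<bar>x - y\<bar>" "exp (- y) - exp (- x) \<le> \<bar>x - y\<bar>"
    if "0 \<le> x" "x \<le> y" for x y :: real
  proof -
    have "exp (- x) - exp (- y) = exp (- x) * (1 - exp (- (y - x)))"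
      by (simp add: algebra_simps exp_add[symmetric])
    also have "\<dots> \<le> 1 * (y - x)"
      using that exp_ge_add_one_self[of "x - y"] by (intro mult_mono) (auto simp: algebra_simps)
    finally show "exp (- x) - exp (- y) \<le> \<bar>x - y\<bar>" using that by simp
    have "exp (- y) \<le> exp (- x)" using that by simp
    thus "exp (- y) - exp (- x) \<le> \<bar>x - y\<bar>" by linarith
  qed
  show ?thesis
    using *[of x y] *[of y x] assms by (cases "x \<le> y") (auto simp: abs_le_iff)
qed

text \<open>The weight of the jump kernel is absorbed into the integrand, which leaves a function
  that is bounded on the cone, to be integrated against the finite signed entries of
  \<open>\<mu>\<close>.\<close>

definition jump_integrand :: "(real^'d^'d \<Rightarrow> real^'d^'d) \<Rightarrow> real^'d^'d \<Rightarrow> real^'d^'d \<Rightarrow> real" where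
  "jump_integrand chi u \<xi> =
     (exp (- trace (u ** \<xi>)) - 1 + trace (chi \<xi> ** u)) / min ((norm \<xi>)\<^sup>2) 1"

text \<open>This and \<open>riccati_R\<close> describe the process without discounting; the
  constants \<open>a\<close> and \<open>B\<close> of the short rate are added later.\<close>

definition riccati_F :: "real^'d^'d \<Rightarrow> (real^'d^'d) measure \<Rightarrow> real^'d^'d \<Rightarrow> real" where
  "riccati_F b m u = trace (b ** u) - (LINT \<xi>|m. exp (- trace (u ** \<xi>)) - 1)"

definition riccati_R :: "(real^'d^'d \<Rightarrow> real^'d^'d) \<Rightarrow> real^'d^'d \<Rightarrow> ('d \<Rightarrow> 'd \<Rightarrow> real^'d^'d) \<Rightarrow>
    ((real^'d^'d) set \<Rightarrow> real^'d^'d) \<Rightarrow> real^'d^'d \<Rightarrow> real^'d^'d" where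
  "riccati_R chi \<alpha> \<beta> \<mu> u = - (2 *\<^sub>R (u ** \<alpha> ** u)) + drift_transpose \<beta> u
     - matrix_integral \<mu> (jump_integrand chi u)"

locale affine_parameters =
  fixes chi :: "real^'d^'d \<Rightarrow> real^'d^'d" and \<alpha> b :: "real^'d^'d"
    and \<beta> :: "'d \<Rightarrow> 'd \<Rightarrow> real^'d^'d"
    and m :: "(real^'d^'d) measure" and \<mu> :: "(real^'d^'d) set \<Rightarrow> real^'d^'d"
  assumes truncation: "truncation_function chi"
    and admissible: "admissible_parameters chi \<alpha> b \<beta> m \<mu>"
begin

lemma
  shows alpha_psd: "\<alpha> \<in> psd"
    and sets_m: "sets m = sets psd0_space"
    and m_finite: "(\<integral>\<^sup>+\<xi>. ennreal (min (norm \<xi>) 1) \<partial>m) < \<infinity>"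
    and \<mu>_signed: "finite_signed_measure psd0_space (\<lambda>E. \<mu> E $ i $ j)"
    and \<mu>_psd: "E \<in> sets psd0_space \<Longrightarrow> \<mu> E \<in> psd"
    and \<beta>_symmetric: "symmetric_matrix (\<beta> i j)" "\<beta> i j = \<beta> j i"
  using admissible unfolding admissible_parameters_def by blast+

abbreviation "F \<equiv> riccati_F b m"
abbreviation "R \<equiv> riccati_R chi \<alpha> \<beta> \<mu>"

lemma id_measurable_m [measurable]: "(\<lambda>\<xi>. \<xi>) \<in> borel_measurable m"
  unfolding measurable_cong_sets[OF sets_m refl] by measurable

lemma space_m: "space m = psd - {0}"
  using sets_eq_imp_space_eq[OF sets_m] by (simp add: space_psd0)

lemma chi_measurable [measurable]: "chi \<in> borel_measurable psd0_space"
  using truncation by (auto simp: truncation_function_def intro: borel_measurable_psd0_spaceI)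

lemma jump_integrand_measurable [measurable]:
  "jump_integrand chi u \<in> borel_measurable psd0_space"
  unfolding jump_integrand_def[abs_def] by measurable

text \<open>Near the origin \<open>chi \<xi> = \<xi>\<close>, so the numerator is a second-order
  Taylor remainder; away from it the denominator is bounded below and \<open>chi\<close> is bounded.
  The explicit growth in \<open>u\<close> supplies a constant majorant on bounded sets of
  \<open>u\<close>.\<close>

lemma jump_integrand_bound:
  "\<exists>C. \<forall>u\<in>psd. \<forall>\<xi>\<in>psd. \<bar>jump_integrand chi u \<xi>\<bar> \<le> C * (1 + norm u)\<^sup>2"
proof -
  obtain \<epsilon> where \<epsilon>: "\<epsilon> > 0" "\<And>\<xi>. \<xi> \<in> psd \<Longrightarrow> norm \<xi> < \<epsilon> \<Longrightarrow> chi \<xi> = \<xi>"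
    using truncation by (auto simp: truncation_function_def)
  obtain K where K: "\<And>\<xi>. \<xi> \<in> psd \<Longrightarrow> norm (chi \<xi>) \<le> K"
    using truncation by (auto simp: truncation_function_def bounded_iff)
  have K0: "0 \<le> K" using K[OF psd_zero] norm_ge_zero order_trans by blast
  \<comment> \<open>Being at most \<open>1\<close>, \<open>\<delta>\<close> makes the minimum equal
    to \<open>(norm \<xi>)^2\<close> inside the ball and at least \<open>\<delta>^2\<close>
    outside.\<close>
  define \<delta> where "\<delta> = min \<epsilon> 1"
  have \<delta>: "0 < \<delta>" "\<delta> \<le> \<epsilon>" "\<delta> \<le> 1" using \<epsilon>(1) by (auto simp: \<delta>_def)
  have "\<bar>jump_integrand chi u \<xi>\<bar> \<le> (1 + (1 + K) / \<delta>\<^sup>2) * (1 + norm u)\<^sup>2"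
    if u: "u \<in> psd" and \<xi>: "\<xi> \<in> psd" for u \<xi>
  proof (cases "norm \<xi> < \<delta>")
    case True
    let ?y = "trace (u ** \<xi>)"
    have y: "0 \<le> ?y" by (rule trace_mult_psd_nonneg[OF u \<xi>])
    have "?y \<le> norm u * norm \<xi>" using abs_trace_mult_le[of u \<xi>] by simp
    hence y2: "?y\<^sup>2 \<le> (norm u * norm \<xi>)\<^sup>2" using y by (intro power_mono) auto
    have "(norm \<xi>)\<^sup>2 \<le> 1" using True \<delta>(3) by (simp add: power_le_one)
    hence "jump_integrand chi u \<xi> = (exp (- ?y) - 1 + ?y) / (norm \<xi>)\<^sup>2"
      using \<epsilon>(2)[OF \<xi>] True \<delta>(2) by (simp add: jump_integrand_def trace_mult_commute[of \<xi>] min_def)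
    also have "\<bar>\<dots>\<bar> \<le> (norm u * norm \<xi>)\<^sup>2 / (norm \<xi>)\<^sup>2"
      using exp_minus_diff_bounds[OF y] y2 by (auto simp: abs_divide intro!: divide_right_mono)
    also have "\<dots> \<le> (norm u)\<^sup>2" by (simp add: power_mult_distrib)
    also have "\<dots> \<le> (1 + norm u)\<^sup>2" by (intro power_mono) auto
    also have "\<dots> \<le> (1 + (1 + K) / \<delta>\<^sup>2) * (1 + norm u)\<^sup>2"
      using K0 by (intro mult_le_cancel_right1[THEN iffD2]) auto
    finally show ?thesis .
  next
    case False
    have "\<delta>\<^sup>2 \<le> (norm \<xi>)\<^sup>2" "\<delta>\<^sup>2 \<le> 1" using False \<delta> by (auto intro: power_mono power_le_one)
    hence d: "\<delta>\<^sup>2 \<le> min ((norm \<xi>)\<^sup>2) 1" by simp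
    have "\<bar>trace (chi \<xi> ** u)\<bar> \<le> K * norm u"
      using abs_trace_mult_le[of "chi \<xi>" u] mult_right_mono[OF K[OF \<xi>], of "norm u"] by simp
    moreover have "\<bar>exp (- trace (u ** \<xi>)) - 1\<bar> \<le> 1"
      using trace_mult_psd_nonneg[OF u \<xi>] by (simp add: abs_le_iff)
    ultimately have n: "\<bar>exp (- trace (u ** \<xi>)) - 1 + trace (chi \<xi> ** u)\<bar> \<le> 1 + K * norm u"
      by linarith
    have "\<bar>jump_integrand chi u \<xi>\<bar> \<le> (1 + K * norm u) / \<delta>\<^sup>2"
      unfolding jump_integrand_def abs_divide using d n \<delta>(1) K0
      by (intro frac_le) auto
    also have "\<dots> \<le> ((1 + K) * (1 + norm u)\<^sup>2) / \<delta>\<^sup>2"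
    proof (intro divide_right_mono)
      have "1 + K * norm u \<le> (1 + K) * (1 + norm u)" using K0 by (simp add: algebra_simps)
      also have "\<dots> \<le> (1 + K) * (1 + norm u)\<^sup>2"
        using K0 by (intro mult_left_mono) (auto simp: power2_eq_square algebra_simps)
      finally show "1 + K * norm u \<le> (1 + K) * (1 + norm u)\<^sup>2" .
    qed simp
    also have "\<dots> \<le> (1 + (1 + K) / \<delta>\<^sup>2) * (1 + norm u)\<^sup>2" by (simp add: algebra_simps)
    finally show ?thesis .
  qed
  thus ?thesis by blast
qed

text \<open>The \<open>2 x 2\<close> minors of the positive semidefinite values
  \<open>\<mu> E\<close> bound the off-diagonal entries; the sum of two diagonal entries is the
  dominating measure for \<open>jordan_decomposition\<close>.\<close>

lemma \<mu>_dominated: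
  assumes "E \<in> sets psd0_space"
  shows "\<bar>\<mu> E $ i $ j\<bar> \<le> \<mu> E $ i $ i + \<mu> E $ j $ j"
proof -
  have "(\<mu> E $ i $ j)\<^sup>2 \<le> \<mu> E $ i $ i * \<mu> E $ j $ j" by (rule psd_entry_square_le[OF \<mu>_psd[OF assms]])
  also have "\<dots> \<le> (\<mu> E $ i $ i + \<mu> E $ j $ j)\<^sup>2"
    using psd_diagonal_nonneg[OF \<mu>_psd[OF assms]]
    by (simp add: power2_eq_square algebra_simps add_increasing2 add_nonneg_nonneg)
  finally show ?thesis
    using psd_diagonal_nonneg[OF \<mu>_psd[OF assms]] by (simp add: abs_le_square_iff[symmetric])
qed

lemmas \<mu>_jordan = jordan_decomposition[OF \<mu>_signed finite_signed_measure_add[OF \<mu>_signed \<mu>_signed]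
    \<mu>_dominated]

lemma \<mu>_integrable:
  fixes C :: real
  assumes f: "f \<in> borel_measurable psd0_space" and "\<And>\<xi>. \<xi> \<in> psd \<Longrightarrow> \<bar>f \<xi>\<bar> \<le> C"
  shows "integrable (jordan_pos psd0_space (\<lambda>E. \<mu> E $ i $ j)) f"
    "integrable (jordan_neg psd0_space (\<lambda>E. \<mu> E $ i $ j)) f"
proof -
  have *: "integrable N f" if N: "sets N = sets psd0_space" "finite_measure N" for N
  proof (rule finite_measure.integrable_const_bound[OF N(2), where B = C])
    show "AE \<xi> in N. norm (f \<xi>) \<le> C"
      using assms(2) sets_eq_imp_space_eq[OF N(1)] by (auto simp: space_psd0)
    show "f \<in> borel_measurable N" using f by (simp add: measurable_cong_sets[OF N(1) refl])
  qed
  show "integrable (jordan_pos psd0_space (\<lambda>E. \<mu> E $ i $ j)) f"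
    by (rule *[OF \<mu>_jordan(1,2)])
  show "integrable (jordan_neg psd0_space (\<lambda>E. \<mu> E $ i $ j)) f"
    by (rule *[OF \<mu>_jordan(3,4)])
qed

lemma matrix_integrable_jump:
  assumes "u \<in> psd"
  shows "matrix_integrable \<mu> (jump_integrand chi u)"
proof -
  obtain C where "\<forall>\<xi>\<in>psd. \<bar>jump_integrand chi u \<xi>\<bar> \<le> C"
    using jump_integrand_bound assms by blast
  thus ?thesis
    unfolding matrix_integrable_def signed_integrable_def by (auto intro!: \<mu>_integrable)
qed

text \<open>The left side integrates against one positive measure, the right side against the Jordan
  parts of all entries. After the density has moved into the integrand, the measure
  \<open>trace (x ** \<mu> E)\<close> is a finite linear combination of those parts.\<close>

lemma integral_jump_kernel:
  assumes x: "x \<in> psd"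
    and h: "h \<in> borel_measurable psd0_space"
    and bound: "\<And>\<xi>. \<xi> \<in> psd \<Longrightarrow> \<bar>h \<xi> / min ((norm \<xi>)\<^sup>2) 1\<bar> \<le> C"
  shows "(LINT \<xi>|jump_kernel \<mu> x. h \<xi>) = trace (matrix_integral \<mu> (\<lambda>\<xi>. h \<xi> / min ((norm \<xi>)\<^sup>2) 1) ** x)"
proof -
  let ?f = "\<lambda>\<xi>. h \<xi> / min ((norm \<xi>)\<^sup>2) 1"
  define P where "P = measure_of (space psd0_space) (sets psd0_space) (\<lambda>E. ennreal (trace (x ** \<mu> E)))"
  have signed: "finite_signed_measure psd0_space (\<lambda>E. trace (x ** \<mu> E))"
    unfolding trace_mult by (intro finite_signed_measure_sum finite_signed_measure_mult \<mu>_signed)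
  note P = measure_of_signed[OF signed trace_mult_psd_nonneg[OF x \<mu>_psd] refl, folded P_def]
  have meas: "measurable P borel = measurable psd0_space borel"
    by (rule measurable_cong_sets[OF P(1) refl])
  \<comment> \<open>The Boolean selects the positive or the negative part, and its sign goes into
    \<open>c\<close>; the indices of \<open>\<mu>\<close> are transposed because
    \<open>x $ i $ j\<close> meets \<open>\<mu> E $ j $ i\<close> in the trace.\<close>
  define J :: "'d \<times> 'd \<times> bool \<Rightarrow> (real^'d^'d) measure" where
    "J = (\<lambda>(i, j, s). if s then jordan_pos psd0_space (\<lambda>E. \<mu> E $ j $ i)
                      else jordan_neg psd0_space (\<lambda>E. \<mu> E $ j $ i))"
  define c where "c = (\<lambda>(i, j, s). if s then x $ i $ j else - x $ i $ j)"
  have sum_J: "(\<Sum>k\<in>UNIV. c k * g (J k)) = (\<Sum>i\<in>UNIV. \<Sum>j\<in>UNIV. x $ i $ j *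
      (g (jordan_pos psd0_space (\<lambda>E. \<mu> E $ j $ i)) - g (jordan_neg psd0_space (\<lambda>E. \<mu> E $ j $ i))))"
    for g :: "(real^'d^'d) measure \<Rightarrow> real"
    by (simp add: UNIV_Times_UNIV[symmetric] sum.cartesian_product' UNIV_bool c_def J_def
        right_diff_distrib del: UNIV_Times_UNIV)
  have "(LINT \<xi>|jump_kernel \<mu> x. h \<xi>) = (LINT \<xi>|P. (1 / min ((norm \<xi>)\<^sup>2) 1) *\<^sub>R h \<xi>)"
    unfolding jump_kernel_def P_def[symmetric] using h
    by (intro integral_density) (auto simp: meas)
  also have "\<dots> = (LINT \<xi>|P. ?f \<xi>)" by (simp add: mult.commute)
  also have "\<dots> = (\<Sum>k\<in>UNIV. c k * (LINT \<xi>|J k. ?f \<xi>))"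
  proof (rule integral_linear_combination[where C = C])
    show "finite (UNIV :: ('d \<times> 'd \<times> bool) set)" by simp
    show "finite_measure P" by (rule P(2))
    show "finite_measure (J k)" "sets (J k) = sets P" for k
      using \<mu>_jordan by (auto simp: J_def P(1) split: prod.split)
    show "measure P E = (\<Sum>k\<in>UNIV. c k * measure (J k) E)" if "E \<in> sets P" for E
      using that unfolding sum_J[of "\<lambda>N. measure N E"] by (simp add: P(1,3) \<mu>_jordan(5) trace_mult)
    show "?f \<in> borel_measurable P" using h by (simp add: meas)
    show "\<bar>?f \<xi>\<bar> \<le> C" if "\<xi> \<in> space P" for \<xi>
      using that sets_eq_imp_space_eq[OF P(1)] by (intro bound) (simp add: space_psd0)
  qed
  also have "\<dots> = trace (x ** matrix_integral \<mu> ?f)"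
    unfolding sum_J[of "\<lambda>N. LINT \<xi>|N. ?f \<xi>"]
    by (simp add: trace_mult matrix_integral_def signed_integral_def)
  finally show ?thesis by (simp add: trace_mult_commute)
qed

lemma integrable_m:
  assumes u: "u \<in> psd"
  shows "integrable m (\<lambda>\<xi>. exp (- trace (u ** \<xi>)) - 1)"
    and "\<xi> \<in> psd \<Longrightarrow> \<bar>exp (- trace (u ** \<xi>)) - 1\<bar> \<le> (1 + norm u) * min (norm \<xi>) 1"
    and "integrable m (\<lambda>\<xi>. min (norm \<xi>) 1)"
proof -
  show b: "\<bar>exp (- trace (u ** \<xi>)) - 1\<bar> \<le> (1 + norm u) * min (norm \<xi>) 1" if \<xi>: "\<xi> \<in> psd" for \<xi>
  proof -
    have y: "0 \<le> trace (u ** \<xi>)" by (rule trace_mult_psd_nonneg[OF u \<xi>])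
    have "\<bar>exp (- trace (u ** \<xi>)) - 1\<bar> \<le> min (trace (u ** \<xi>)) 1"
      using y abs_exp_minus_diff_le[OF y order_refl] by (auto simp: abs_le_iff)
    also have "\<dots> \<le> min (norm u * norm \<xi>) 1" using abs_trace_mult_le[of u \<xi>] by auto
    also have "\<dots> \<le> (1 + norm u) * min (norm \<xi>) 1"
    proof (cases "norm \<xi> \<le> 1")
      case True
      have "min (norm u * norm \<xi>) 1 \<le> norm u * norm \<xi>" by simp
      also have "\<dots> \<le> (1 + norm u) * norm \<xi>" by (simp add: algebra_simps)
      finally show ?thesis using True by simp
    next
      case False
      have "min (norm u * norm \<xi>) 1 \<le> 1" by simp
      also have "\<dots> \<le> 1 + norm u" by simp
      finally show ?thesis using False by simp
    qed
    finally show ?thesis .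
  qed
  show i: "integrable m (\<lambda>\<xi>. min (norm \<xi>) 1)"
    using m_finite by (intro integrableI_nonneg) auto
  show "integrable m (\<lambda>\<xi>. exp (- trace (u ** \<xi>)) - 1)"
    by (rule Bochner_Integration.integrable_bound[OF integrable_mult_right[OF i, of "1 + norm u"]])
       (auto simp: space_m intro!: AE_I2 order_trans[OF b])
qed

lemma continuous_on_F: "continuous_on psd F"
  unfolding continuous_on_sequentially
proof (intro allI ballI impI, elim conjE)
  fix v :: "nat \<Rightarrow> real^'d^'d" and u
  assume u: "u \<in> psd" and v: "\<forall>n. v n \<in> psd" and lim: "v \<longlonglongrightarrow> u"
  obtain L where L: "\<And>n. norm (v n) \<le> L"
    using Bseq_def convergent_imp_Bseq[of v] lim convergent_def by metis
  have "(\<lambda>n. LINT \<xi>|m. exp (- trace (v n ** \<xi>)) - 1) \<longlonglongrightarrow> (LINT \<xi>|m. exp (- trace (u ** \<xi>)) - 1)"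
  proof (rule integral_dominated_convergence[where w = "\<lambda>\<xi>. (1 + L) * min (norm \<xi>) 1"])
    show "integrable m (\<lambda>\<xi>. (1 + L) * min (norm \<xi>) 1)" using integrable_m(3)[OF u] by simp
    show "AE \<xi> in m. (\<lambda>n. exp (- trace (v n ** \<xi>)) - 1) \<longlonglongrightarrow> exp (- trace (u ** \<xi>)) - 1"
      by (intro AE_I2 tendsto_intros lim)
    show "AE \<xi> in m. norm (exp (- trace (v n ** \<xi>)) - 1) \<le> (1 + L) * min (norm \<xi>) 1" for n
    proof (intro AE_I2)
      fix \<xi> assume "\<xi> \<in> space m"
      hence "norm (exp (- trace (v n ** \<xi>)) - 1) \<le> (1 + norm (v n)) * min (norm \<xi>) 1"
        using integrable_m(2)[OF v[rule_format], of \<xi> n] by (simp add: space_m)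
      also have "\<dots> \<le> (1 + L) * min (norm \<xi>) 1" using L by (intro mult_right_mono) auto
      finally show "norm (exp (- trace (v n ** \<xi>)) - 1) \<le> (1 + L) * min (norm \<xi>) 1" .
    qed
  qed measurable
  thus "(F \<circ> v) \<longlonglongrightarrow> F u"
    unfolding riccati_F_def o_def by (intro tendsto_intros lim)
qed

lemma drift_transpose_linear: "bounded_linear (drift_transpose \<beta>)"
proof -
  have "linear (drift_transpose \<beta>)"
    by (rule linearI) (auto simp: drift_transpose_def vec_eq_iff trace_mult_simps)
  thus ?thesis by (rule linear_conv_bounded_linear[THEN iffD1])
qed

text \<open>A convergent sequence is bounded, so \<open>jump_integrand_bound\<close> gives a
  constant majorant, integrable against the finite Jordan parts. Points on the boundary of the cone
  are included.\<close>

lemma continuous_on_R: "continuous_on psd R"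
  unfolding continuous_on_sequentially
proof (intro allI ballI impI, elim conjE)
  fix v :: "nat \<Rightarrow> real^'d^'d" and u
  assume u: "u \<in> psd" and v: "\<forall>n. v n \<in> psd" and lim: "v \<longlonglongrightarrow> u"
  obtain L where L: "\<And>n. norm (v n) \<le> L"
    using Bseq_def convergent_imp_Bseq[of v] lim convergent_def by metis
  obtain C0 where C0: "\<And>u \<xi>. u \<in> psd \<Longrightarrow> \<xi> \<in> psd \<Longrightarrow> \<bar>jump_integrand chi u \<xi>\<bar> \<le> C0 * (1 + norm u)\<^sup>2"
    using jump_integrand_bound by blast
  have C: "\<bar>jump_integrand chi (v n) \<xi>\<bar> \<le> \<bar>C0\<bar> * (1 + L)\<^sup>2" if "\<xi> \<in> psd" for n \<xi>
  proof -
    have "\<bar>jump_integrand chi (v n) \<xi>\<bar> \<le> C0 * (1 + norm (v n))\<^sup>2" using C0 v that by blast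
    also have "\<dots> \<le> \<bar>C0\<bar> * (1 + L)\<^sup>2" using L[of n] by (intro mult_mono power_mono) auto
    finally show ?thesis .
  qed
  have *: "(\<lambda>n. LINT \<xi>|N. jump_integrand chi (v n) \<xi>) \<longlonglongrightarrow> (LINT \<xi>|N. jump_integrand chi u \<xi>)"
    if N: "sets N = sets psd0_space" "finite_measure N" for N
  proof (rule integral_dominated_convergence[where w = "\<lambda>\<xi>. \<bar>C0\<bar> * (1 + L)\<^sup>2"])
    interpret finite_measure N by fact
    show "jump_integrand chi u \<in> borel_measurable N"
      "jump_integrand chi (v n) \<in> borel_measurable N" for n
      unfolding measurable_cong_sets[OF N(1) refl] by measurable
    show "integrable N (\<lambda>\<xi>. \<bar>C0\<bar> * (1 + L)\<^sup>2)" by simp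
    show "AE \<xi> in N. (\<lambda>n. jump_integrand chi (v n) \<xi>) \<longlonglongrightarrow> jump_integrand chi u \<xi>"
    proof (intro AE_I2)
      fix \<xi> assume "\<xi> \<in> space N"
      hence "min ((norm \<xi>)\<^sup>2) 1 \<noteq> 0"
        using sets_eq_imp_space_eq[OF N(1)] by (auto simp: space_psd0 min_def)
      thus "(\<lambda>n. jump_integrand chi (v n) \<xi>) \<longlonglongrightarrow> jump_integrand chi u \<xi>"
        unfolding jump_integrand_def by (intro tendsto_intros lim)
    qed
    show "AE \<xi> in N. norm (jump_integrand chi (v n) \<xi>) \<le> \<bar>C0\<bar> * (1 + L)\<^sup>2" for n
      using C sets_eq_imp_space_eq[OF N(1)] by (auto simp: space_psd0)
  qed
  have "(\<lambda>n. matrix_integral \<mu> (jump_integrand chi (v n))) \<longlonglongrightarrow> matrix_integral \<mu> (jump_integrand chi u)"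
    unfolding matrix_integral_def signed_integral_def
    by (intro tendsto_vec_lambda tendsto_diff * \<mu>_jordan)
  moreover have "(\<lambda>n. drift_transpose \<beta> (v n)) \<longlonglongrightarrow> drift_transpose \<beta> u"
    by (rule bounded_linear.tendsto[OF drift_transpose_linear lim])
  moreover have "(\<lambda>n. v n ** \<alpha> ** v n) \<longlonglongrightarrow> u ** \<alpha> ** u"
    unfolding matrix_matrix_mult_def
    by (intro tendsto_vec_lambda tendsto_sum tendsto_mult tendsto_vec_nth tendsto_const lim)
  ultimately show "(R \<circ> v) \<longlonglongrightarrow> R u"
    unfolding riccati_R_def o_def by (intro tendsto_intros)
qed

lemma R_symmetric: assumes "u \<in> psd" shows "symmetric_matrix (R u)"
proof -
  have "symmetric_matrix (u ** \<alpha> ** u)"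
    using psd_symmetric[OF assms] psd_symmetric[OF alpha_psd]
    by (simp add: symmetric_matrix_def matrix_transpose_mul matrix_mul_assoc)
  moreover have "symmetric_matrix (drift_transpose \<beta> u)"
    using \<beta>_symmetric(2) by (simp add: symmetric_matrix_iff drift_transpose_def)
  moreover have "symmetric_matrix (matrix_integral \<mu> f)" for f
  proof -
    have "signed_integral psd0_space (\<lambda>E. \<mu> E $ i $ j) f = signed_integral psd0_space (\<lambda>E. \<mu> E $ j $ i) f" for i j
      using psd_symmetric[OF \<mu>_psd] by (intro signed_integral_cong) (auto simp: symmetric_matrix_iff)
    thus ?thesis by (simp add: symmetric_matrix_iff matrix_integral_def)
  qed
  ultimately show ?thesis unfolding riccati_R_def by (intro symmetric_matrix_intros)
qed

end

section \<open>The generator on exponential functions\<close>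

abbreviation (input) exp_trace :: "real^'d^'d \<Rightarrow> real^'d^'d \<Rightarrow> real" where
  "exp_trace u \<equiv> \<lambda>x. exp (- trace (u ** x))"

lemma has_derivative_exp_trace:
  "((\<lambda>x. c * exp_trace u x) has_derivative (\<lambda>h. - trace (u ** h) * (c * exp_trace u x))) (at x)"
proof -
  have "bounded_linear (\<lambda>x. trace (u ** x))"
    by (rule bounded_bilinear.bounded_linear_right[OF bounded_bilinear_trace_mult])
  note [derivative_intros] = bounded_linear.has_derivative[OF this]
  show ?thesis by (auto intro!: derivative_eq_intros)
qed

text \<open>The factor \<open>c\<close> lets the rule apply to its own result, as needed for
  iterated derivatives. The index is transposed because \<open>x $ i $ j\<close> is paired with
  \<open>u $ j $ i\<close>.\<close>

lemma partial_deriv_exp_trace: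
  "partial_deriv i j (\<lambda>x. c * exp_trace u x) = (\<lambda>x. - (u $ j $ i) * c * exp_trace u x)"
proof
  fix x
  have "trace (u ** axis i (axis j 1)) = u $ j $ i"
    by (simp add: trace_mult_eq_inner inner_axis transpose_def)
  thus "partial_deriv i j (\<lambda>x. c * exp_trace u x) x = - (u $ j $ i) * c * exp_trace u x"
    unfolding partial_deriv_def
    using frechet_derivative_at[OF has_derivative_exp_trace[of c u x], symmetric] by simp
qed

lemma iter_partial_deriv_exp_trace:
  "\<exists>c. iter_partial_deriv ijs (exp_trace u) = (\<lambda>x. c * exp_trace u x)"
proof (induction ijs)
  case Nil
  show ?case by (intro exI[of _ 1]) simp
next
  case (Cons ij ijs)
  then obtain c where c: "iter_partial_deriv ijs (exp_trace u) = (\<lambda>x. c * exp_trace u x)" ..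
  show ?case unfolding iter_partial_deriv.simps c partial_deriv_exp_trace by blast
qed

text \<open>The lower bound on \<open>u\<close> gives
  \<open>trace (u ** x) \<ge> c * norm x\<close>, so the exponential beats every power. A singular
  \<open>u\<close> would leave directions of the cone without decay.\<close>

lemma rapidly_decreasing_exp_trace:
  assumes "u - c *\<^sub>R mat 1 \<in> psd" "c > 0"
  shows "rapidly_decreasing_smooth (exp_trace u)"
  unfolding rapidly_decreasing_smooth_def
proof (intro allI conjI)
  fix ijs
  obtain a where a: "iter_partial_deriv ijs (exp_trace u) = (\<lambda>x. a * exp_trace u x)"
    using iter_partial_deriv_exp_trace by blast
  show "iter_partial_deriv ijs (exp_trace u) differentiable at x" for x
    unfolding a differentiable_def using has_derivative_exp_trace by blast
  fix k :: nat
  have "norm (norm x ^ k * iter_partial_deriv ijs (exp_trace u) x) \<le> \<bar>a\<bar> * (fact k / c ^ k)" if "x \<in> psd" for x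
  proof -
    have "c * norm x \<le> c * trace x" using norm_le_trace_psd[OF that] assms(2) by simp
    also have "\<dots> \<le> trace (u ** x)" by (rule trace_mult_lower[OF assms(1) that])
    finally have le: "c * norm x \<le> trace (u ** x)" .
    \<comment> \<open>The exponential dominates the single term of degree \<open>k\<close> of its
      series.\<close>
    have "(\<Sum>n\<in>{k}. (c * norm x) ^ n /\<^sub>R fact n) \<le> exp (c * norm x)"
      unfolding exp_def using assms(2) by (intro sum_le_suminf summable_exp_generic) auto
    hence "(c * norm x) ^ k / fact k \<le> exp (c * norm x)" by (simp add: field_simps)
    also have "\<dots> \<le> exp (trace (u ** x))" using le by simp
    finally have "norm x ^ k * exp (- trace (u ** x)) \<le> fact k / c ^ k"
      using assms(2) by (simp add: exp_minus power_mult_distrib field_simps)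
    hence "\<bar>a\<bar> * (norm x ^ k * exp (- trace (u ** x))) \<le> \<bar>a\<bar> * (fact k / c ^ k)"
      by (intro mult_left_mono) auto
    thus ?thesis by (simp add: a abs_mult ac_simps)
  qed
  thus "bounded ((\<lambda>x. norm x ^ k * iter_partial_deriv ijs (exp_trace u) x) ` psd)"
    unfolding bounded_iff by blast
qed

text \<open>The four terms of \<open>diffusion_coeff\<close> are relabellings of one another under
  exchanging \<open>i\<close> with \<open>j\<close> and \<open>k\<close> with \<open>l\<close>. The
  resulting \<open>4\<close>, halved by the generator, is the \<open>2\<close> in
  \<open>riccati_R\<close>.\<close>

lemma diffusion_exp_trace:
  fixes u \<alpha> x :: "real^'d^'d"
  assumes "symmetric_matrix u" "symmetric_matrix \<alpha>" "symmetric_matrix x"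
  shows "(\<Sum>i\<in>UNIV. \<Sum>j\<in>UNIV. \<Sum>k\<in>UNIV. \<Sum>l\<in>UNIV.
      diffusion_coeff \<alpha> i j k l x * (u $ j $ i * u $ l $ k)) = 4 * trace ((u ** \<alpha> ** u) ** x)"
proof -
  have s: "u $ i $ j = u $ j $ i" "\<alpha> $ i $ j = \<alpha> $ j $ i" "x $ i $ j = x $ j $ i" for i j
    using assms by (auto simp: symmetric_matrix_iff)
  define S where "S f = (\<Sum>i\<in>UNIV. \<Sum>j\<in>UNIV. \<Sum>k\<in>UNIV. \<Sum>l\<in>UNIV. f i j k l)"
    for f :: "'d \<Rightarrow> 'd \<Rightarrow> 'd \<Rightarrow> 'd \<Rightarrow> real"
  have swap_ij: "S f = S (\<lambda>i j k l. f j i k l)" for f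
    unfolding S_def by (rule sum.swap)
  have swap_kl: "S f = S (\<lambda>i j k l. f i j l k)" for f
    unfolding S_def by (rule sum.cong[OF refl], rule sum.cong[OF refl], rule sum.swap)
  let ?T = "S (\<lambda>i j k l. x $ i $ k * \<alpha> $ j $ l * (u $ j $ i * u $ l $ k))"
  have 2: "S (\<lambda>i j k l. x $ i $ l * \<alpha> $ j $ k * (u $ j $ i * u $ l $ k)) = ?T"
    by (subst swap_kl) (simp add: s)
  have 3: "S (\<lambda>i j k l. x $ j $ k * \<alpha> $ i $ l * (u $ j $ i * u $ l $ k)) = ?T"
    by (subst swap_ij) (simp add: s)
  have 4: "S (\<lambda>i j k l. x $ j $ l * \<alpha> $ i $ k * (u $ j $ i * u $ l $ k)) = ?T"
    by (subst swap_ij, subst swap_kl) (simp add: s)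
  have "S (\<lambda>i j k l. diffusion_coeff \<alpha> i j k l x * (u $ j $ i * u $ l $ k)) =
     ?T + S (\<lambda>i j k l. x $ i $ l * \<alpha> $ j $ k * (u $ j $ i * u $ l $ k))
     + S (\<lambda>i j k l. x $ j $ k * \<alpha> $ i $ l * (u $ j $ i * u $ l $ k))
     + S (\<lambda>i j k l. x $ j $ l * \<alpha> $ i $ k * (u $ j $ i * u $ l $ k))"
    by (simp add: S_def diffusion_coeff_def distrib_right sum.distrib)
  also have "\<dots> = 4 * ?T" unfolding 2 3 4 by simp
  also have "?T = trace ((u ** \<alpha> ** u) ** x)"
  proof -
    have "trace ((u ** \<alpha> ** u) ** x) =
        (\<Sum>i\<in>UNIV. \<Sum>k\<in>UNIV. \<Sum>l\<in>UNIV. \<Sum>j\<in>UNIV. u $ i $ j * \<alpha> $ j $ l * u $ l $ k * x $ k $ i)"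
      unfolding trace_mult by (simp add: matrix_matrix_mult_def sum_distrib_right)
    also have "\<dots> = (\<Sum>i\<in>UNIV. \<Sum>k\<in>UNIV. \<Sum>j\<in>UNIV. \<Sum>l\<in>UNIV. u $ i $ j * \<alpha> $ j $ l * u $ l $ k * x $ k $ i)"
      by (rule sum.cong[OF refl], rule sum.cong[OF refl], rule sum.swap)
    also have "\<dots> = (\<Sum>i\<in>UNIV. \<Sum>j\<in>UNIV. \<Sum>k\<in>UNIV. \<Sum>l\<in>UNIV. u $ i $ j * \<alpha> $ j $ l * u $ l $ k * x $ k $ i)"
      by (rule sum.cong[OF refl], rule sum.swap)
    also have "\<dots> = ?T"
    proof -
      have eq: "u $ i $ j * \<alpha> $ j $ l * u $ l $ k * x $ k $ i = x $ i $ k * \<alpha> $ j $ l * (u $ j $ i * u $ l $ k)"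
        for i j k l using s(1)[of i j] s(3)[of k i] by simp
      show ?thesis unfolding S_def eq ..
    qed
    finally show ?thesis ..
  qed
  finally show ?thesis unfolding S_def .
qed

context affine_parameters
begin

text \<open>Derivatives of the exponential are multiples of it, and its value at
  \<open>x + \<xi>\<close> factorizes, so it comes out of every term; what remains is affine in
  \<open>x\<close>. The computation is algebraic and valid on the whole cone.\<close>

lemma affine_operator_exp_trace:
  assumes u: "u \<in> psd" and x: "x \<in> psd"
  shows "affine_operator chi \<alpha> b \<beta> m \<mu> (exp_trace u) x = - exp_trace u x * (F u + trace (R u ** x))"
proof -
  let ?e = "exp_trace u x"
  have sym: "u $ i $ j = u $ j $ i" "x $ i $ j = x $ j $ i" for i j
    using psd_symmetric[OF u] psd_symmetric[OF x] by (auto simp: symmetric_matrix_iff)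
  have d1: "partial_deriv i j (exp_trace u) = (\<lambda>x. - (u $ j $ i) * exp_trace u x)" for i j
    using partial_deriv_exp_trace[of i j 1 u] by simp
  have d2: "partial_deriv i j (partial_deriv k l (exp_trace u)) x = u $ j $ i * u $ l $ k * ?e" for i j k l
    unfolding d1 partial_deriv_exp_trace by simp
  have diff: "(\<Sum>i\<in>UNIV. \<Sum>j\<in>UNIV. \<Sum>k\<in>UNIV. \<Sum>l\<in>UNIV.
              diffusion_coeff \<alpha> i j k l x * partial_deriv i j (partial_deriv k l (exp_trace u)) x)
       = 4 * trace ((u ** \<alpha> ** u) ** x) * ?e"
    unfolding d2 diffusion_exp_trace[OF psd_symmetric[OF u] psd_symmetric[OF alpha_psd] psd_symmetric[OF x], symmetric]
    by (simp add: sum_distrib_right sum_distrib_left ac_simps)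
  \<comment> \<open>\<open>drift_transpose\<close> is the adjoint of \<open>drift\<close> for the
    trace pairing; the symmetry of \<open>x\<close> absorbs a transposition.\<close>
  have "trace (drift \<beta> x ** u) = trace (drift_transpose \<beta> u ** x)"
  proof -
    have "trace (drift \<beta> x ** u) = (\<Sum>i\<in>UNIV. \<Sum>j\<in>UNIV. x $ i $ j * trace (\<beta> i j ** u))"
    proof -
      have l: "linear (\<lambda>y. trace (y ** u))" by (rule linearI) (auto simp: trace_mult_simps)
      show ?thesis unfolding drift_def by (simp add: linear_sum[OF l] trace_mult_simps)
    qed
    thus ?thesis by (simp add: trace_mult drift_transpose_def sym(2) mult.commute)
  qed
  hence tr: "trace ((b + drift \<beta> x) ** u) = trace (b ** u) + trace (drift_transpose \<beta> u ** x)"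
    by (simp add: trace_mult_add_left)
  have dr: "(\<Sum>i\<in>UNIV. \<Sum>j\<in>UNIV. (b $ i $ j + drift \<beta> x $ i $ j) * partial_deriv i j (exp_trace u) x)
      = - (trace (b ** u) + trace (drift_transpose \<beta> u ** x)) * ?e"
    unfolding d1 tr[symmetric] trace_mult[of "b + drift \<beta> x" u]
    by (simp add: sum_distrib_right sum_negf mult.assoc)
  have e_add: "exp_trace u (x + \<xi>) = ?e * exp_trace u \<xi>" for \<xi>
    by (simp add: trace_mult_simps exp_add[symmetric])
  have jm: "(LINT \<xi>|m. exp_trace u (x + \<xi>) - ?e) = ?e * (LINT \<xi>|m. exp_trace u \<xi> - 1)"
    unfolding e_add by (simp flip: integral_mult_right_zero add: algebra_simps)
  have grad: "gradient (exp_trace u) x = (- ?e) *\<^sub>R u"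
    by (simp add: gradient_def d1 vec_eq_iff sym(1))
  obtain C where C: "\<And>\<xi>. \<xi> \<in> psd \<Longrightarrow> \<bar>jump_integrand chi u \<xi>\<bar> \<le> C"
    using jump_integrand_bound u by blast
  have "(LINT \<xi>|jump_kernel \<mu> x. exp_trace u (x + \<xi>) - ?e - trace (chi \<xi> ** gradient (exp_trace u) x))
      = (LINT \<xi>|jump_kernel \<mu> x. ?e * (exp_trace u \<xi> - 1 + trace (chi \<xi> ** u)))"
    unfolding e_add grad trace_mult_scaleR_right by (simp add: algebra_simps)
  also have "\<dots> = ?e * (LINT \<xi>|jump_kernel \<mu> x. exp_trace u \<xi> - 1 + trace (chi \<xi> ** u))"
    by simp
  also have "(LINT \<xi>|jump_kernel \<mu> x. exp_trace u \<xi> - 1 + trace (chi \<xi> ** u))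
      = trace (matrix_integral \<mu> (jump_integrand chi u) ** x)"
    unfolding jump_integrand_def[abs_def]
    by (rule integral_jump_kernel[OF x, where C = C]) (use C in \<open>auto simp: jump_integrand_def\<close>)
  finally have jk: "(LINT \<xi>|jump_kernel \<mu> x. exp_trace u (x + \<xi>) - ?e - trace (chi \<xi> ** gradient (exp_trace u) x))
      = ?e * trace (matrix_integral \<mu> (jump_integrand chi u) ** x)" .
  have Rx: "trace (R u ** x) = - (2 * trace ((u ** \<alpha> ** u) ** x)) + trace (drift_transpose \<beta> u ** x)
      - trace (matrix_integral \<mu> (jump_integrand chi u) ** x)"
    unfolding riccati_R_def trace_mult_diff_left trace_mult_add_left trace_mult_minus_left
      trace_mult_scaleR_left ..
  have arith: "1 / 2 * (4 * t * e) + - (p + q) * e + e * v + e * w = - e * (p - v + (- (2 * t) + q - w))"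
    for t e p q v w :: real
    by (simp add: algebra_simps)
  show ?thesis
    unfolding affine_operator_def diff dr jm jk riccati_F_def Rx by (rule arith)
qed

end

section \<open>The flow of an affine semigroup\<close>

lemma trace_zero [simp]: "trace (0 :: real^'d^'d) = 0"
  by (simp add: trace_def)

text \<open>On a cone \<open>x\<close> may be scaled up, so that the constants become negligible and
  the linear parts must be ordered; self-duality turns this into the cone order.\<close>

lemma affine_le_imp_psd_order:
  assumes A: "symmetric_matrix A" and B: "symmetric_matrix B"
    and le: "\<And>x. x \<in> psd \<Longrightarrow> a + trace (A ** x) \<le> b + trace (B ** x)"
  shows "a \<le> b" "B - A \<in> psd"
proof -
  show "a \<le> b" using le[OF psd_zero] by simp
  have "trace (A ** x) \<le> trace (B ** x)" if x: "x \<in> psd" for x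
  proof (rule ccontr)
    let ?d = "trace (A ** x) - trace (B ** x)"
    assume "\<not> trace (A ** x) \<le> trace (B ** x)"
    hence d: "?d > 0" by simp
    \<comment> \<open>Scaled by this \<open>c\<close>, the supposed violation outweighs the
      constants by at least \<open>1\<close>.\<close>
    define c where "c = (\<bar>b - a\<bar> + 1) / ?d"
    have "c *\<^sub>R x \<in> psd" using d by (intro psd_scaleR x) (simp add: c_def)
    from le[OF this] have "c * ?d \<le> b - a" by (simp add: trace_mult_simps algebra_simps)
    moreover have "c * ?d = \<bar>b - a\<bar> + 1" using d by (simp add: c_def)
    ultimately show False by linarith
  qed
  hence "0 \<le> trace ((B - A) ** x)" if "x \<in> psd" for x
    using that by (simp add: trace_mult_simps)
  moreover have "symmetric_matrix (B - A)" by (intro symmetric_matrix_intros A B)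
  ultimately show "B - A \<in> psd" using psd_iff_trace_mult_nonneg by blast
qed

lemma affine_eq_imp_eq:
  assumes A: "symmetric_matrix A" and B: "symmetric_matrix B"
    and eq: "\<And>x. x \<in> psd \<Longrightarrow> a + trace (A ** x) = b + trace (B ** x)"
  shows "a = b" "A = B"
proof -
  show "a = b" using eq[OF psd_zero] by simp
  thus "A = B" using eq by (intro symmetric_eqI A B) auto
qed

text \<open>After a logarithm, \<open>x = 0\<close> isolates the scalar part, and subtracting it
  leaves the traces of the matrix part. This recovers limits of \<open>\<phi>\<close> and
  \<open>\<psi>\<close> from limits of integrals of exponentials.\<close>

lemma tendsto_of_exp_affine:
  fixes f :: "'a \<Rightarrow> real" and A :: "'a \<Rightarrow> real^'d^'d"
  assumes "eventually (\<lambda>s. symmetric_matrix (A s)) G" "symmetric_matrix L"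
    and lim: "\<And>x. x \<in> psd \<Longrightarrow> ((\<lambda>s. exp (- f s - trace (A s ** x))) \<longlongrightarrow> exp (- l - trace (L ** x))) G"
  shows "(f \<longlongrightarrow> l) G" "(A \<longlongrightarrow> L) G"
proof -
  have *: "((\<lambda>s. f s + trace (A s ** x)) \<longlongrightarrow> l + trace (L ** x)) G" if "x \<in> psd" for x
    using tendsto_minus[OF tendsto_ln[OF lim[OF that]]] by (simp add: add.commute)
  show f: "(f \<longlongrightarrow> l) G" using *[OF psd_zero] by simp
  show "(A \<longlongrightarrow> L) G"
  proof (rule tendsto_symmetricI[OF assms(1,2)])
    fix x :: "real^'d^'d" assume "x \<in> psd"
    from tendsto_diff[OF *[OF this] f] show "((\<lambda>s. trace (A s ** x)) \<longlongrightarrow> trace (L ** x)) G" by simp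
  qed
qed

lemma space_psd_space [simp]: "space psd_space = psd"
  by (simp add: psd_space_def space_restrict_space)

lemma borel_measurable_psd_spaceI:
  fixes f :: "real^'d^'d \<Rightarrow> 'b::topological_space"
  shows "continuous_on psd f \<Longrightarrow> f \<in> borel_measurable psd_space"
  unfolding psd_space_def by (rule borel_measurable_continuous_on_restrict)

lemma continuous_on_exp_trace: "continuous_on S (exp_trace u)"
  by (intro continuous_intros)

lemma exp_trace_measurable: "exp_trace u \<in> borel_measurable psd_space"
  by (intro borel_measurable_psd_spaceI continuous_on_exp_trace)

lemma exp_trace_le_1: "u \<in> psd \<Longrightarrow> x \<in> psd \<Longrightarrow> exp_trace u x \<le> 1"
  using trace_mult_psd_nonneg[of u x] by simp

locale affine_semigroup = affine_parameters chi \<alpha> b \<beta> m \<mu>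
  for chi :: "real^'d^'d \<Rightarrow> real^'d^'d" and \<alpha> b :: "real^'d^'d"
    and \<beta> :: "'d \<Rightarrow> 'd \<Rightarrow> real^'d^'d"
    and m :: "(real^'d^'d) measure" and \<mu> :: "(real^'d^'d) set \<Rightarrow> real^'d^'d" +
  fixes p :: "real \<Rightarrow> real^'d^'d \<Rightarrow> (real^'d^'d) measure"
    and \<phi> :: "real \<Rightarrow> real^'d^'d \<Rightarrow> real" and \<psi> :: "real \<Rightarrow> real^'d^'d \<Rightarrow> real^'d^'d"
  assumes transition: "transition_function p"
    and conservative: "conservative p"
    and stoch_cont: "stochastically_continuous p"
    and generator: "has_affine_generator p chi \<alpha> b \<beta> m \<mu>"
    and phi_nonneg: "0 \<le> t \<Longrightarrow> u \<in> psd \<Longrightarrow> 0 \<le> \<phi> t u"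
    and psi_psd: "0 \<le> t \<Longrightarrow> u \<in> psd \<Longrightarrow> \<psi> t u \<in> psd"
    and transform: "0 \<le> t \<Longrightarrow> u \<in> psd \<Longrightarrow> x \<in> psd \<Longrightarrow>
      (LINT \<xi>|p t x. exp_trace u \<xi>) = exp (- \<phi> t u - trace (\<psi> t u ** x))"
begin

section \<open>The exponents of the transform as a semiflow\<close>

lemma psi_symmetric: "0 \<le> t \<Longrightarrow> u \<in> psd \<Longrightarrow> symmetric_matrix (\<psi> t u)"
  by (rule psd_symmetric[OF psi_psd])

lemma
  assumes "0 \<le> t" "x \<in> psd"
  shows sets_p: "sets (p t x) = sets psd_space"
    and prob_space_p: "prob_space (p t x)"
    and space_p: "space (p t x) = psd"
proof -
  have "p t \<in> measurable psd_space (subprob_algebra psd_space)"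
    using transition assms by (simp add: transition_function_def)
  hence *: "p t x \<in> space (subprob_algebra psd_space)"
    by (rule measurable_space) (simp add: assms)
  thus s: "sets (p t x) = sets psd_space" by (simp add: space_subprob_algebra)
  show sp: "space (p t x) = psd" using sets_eq_imp_space_eq[OF s] by simp
  show "prob_space (p t x)"
    using conservative assms by (intro prob_spaceI) (simp add: sp conservative_def)
qed

lemma measurable_p:
  assumes "0 \<le> t" "x \<in> psd"
  shows "f \<in> borel_measurable (p t x) \<longleftrightarrow> f \<in> borel_measurable psd_space"
  by (simp add: measurable_cong_sets[OF sets_p[OF assms] refl])

lemma integrable_exp_trace:
  assumes "0 \<le> t" "x \<in> psd" "u \<in> psd"
  shows "integrable (p t x) (exp_trace u)"
proof -
  interpret prob_space "p t x" by (rule prob_space_p[OF assms(1,2)])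
  show ?thesis
    by (rule integrable_const_bound[where B = 1])
       (auto simp: measurable_p[OF assms(1,2)] exp_trace_measurable space_p[OF assms(1,2)]
         intro!: AE_I2 exp_trace_le_1 trace_mult_psd_nonneg assms)
qed

lemma phi_psi_0: "u \<in> psd \<Longrightarrow> \<phi> 0 u = 0" "u \<in> psd \<Longrightarrow> \<psi> 0 u = u"
proof -
  assume u: "u \<in> psd"
  have "\<phi> 0 u + trace (\<psi> 0 u ** x) = 0 + trace (u ** x)" if x: "x \<in> psd" for x
  proof -
    have "p 0 x = return psd_space x" using transition x by (simp add: transition_function_def)
    hence "exp (- \<phi> 0 u - trace (\<psi> 0 u ** x)) = exp_trace u x"
      using transform[of 0 u x] u x by (simp add: integral_return exp_trace_measurable)
    thus ?thesis by simp
  qed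
  from affine_eq_imp_eq[OF psi_symmetric psd_symmetric this] u show "\<phi> 0 u = 0" "\<psi> 0 u = u" by auto
qed

text \<open>Chapman-Kolmogorov: the inner integral over time \<open>t\<close> is again an
  exponential with argument \<open>\<psi> t u\<close>, and the exponents of an exponentially affine
  function on the cone are unique.\<close>

lemma flow:
  assumes "0 \<le> s" "0 \<le> t" "u \<in> psd"
  shows "\<phi> (s + t) u = \<phi> t u + \<phi> s (\<psi> t u)" "\<psi> (s + t) u = \<psi> s (\<psi> t u)"
proof -
  have "\<phi> (s + t) u + trace (\<psi> (s + t) u ** x) = (\<phi> t u + \<phi> s (\<psi> t u)) + trace (\<psi> s (\<psi> t u) ** x)"
    if x: "x \<in> psd" for x
  proof -
    have K: "p t \<in> measurable (p s x) (subprob_algebra psd_space)"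
      unfolding measurable_cong_sets[OF sets_p[OF assms(1) x] refl]
      using transition assms(2) by (simp add: transition_function_def)
    have "exp (- \<phi> (s + t) u - trace (\<psi> (s + t) u ** x)) = (LINT \<xi>|(p s x \<bind> p t). exp_trace u \<xi>)"
      using transform[of "s + t" u x] transition x assms by (simp add: transition_function_def)
    also have "\<dots> = (LINT y|p s x. LINT \<xi>|p t y. exp_trace u \<xi>)"
    proof (rule integral_bind[where K = psd_space and B = 1 and B' = 1])
      show "\<bar>exp_trace u y\<bar> \<le> 1" if "y \<in> space psd_space" for y
        using exp_trace_le_1[OF assms(3), of y] that by simp
      show "finite_measure (p s x)"
        using prob_space_p[OF assms(1) x] by (simp add: prob_space_def)
      show "AE y in p s x. emeasure (p t y) (space (p t y)) \<le> ennreal 1"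
      proof (rule AE_I2)
        fix y assume "y \<in> space (p s x)"
        hence "prob_space (p t y)" using assms x by (simp add: space_p prob_space_p)
        thus "emeasure (p t y) (space (p t y)) \<le> ennreal 1"
          by (simp add: prob_space.emeasure_space_1)
      qed
    qed (rule exp_trace_measurable K)+
    also have "\<dots> = (LINT y|p s x. exp (- \<phi> t u) * exp_trace (\<psi> t u) y)"
      using assms x
      by (intro Bochner_Integration.integral_cong) (auto simp: transform space_p exp_add[symmetric])
    also have "\<dots> = exp (- \<phi> t u) * exp (- \<phi> s (\<psi> t u) - trace (\<psi> s (\<psi> t u) ** x))"
      using assms x by (simp add: transform psi_psd)
    finally show ?thesis by (simp add: exp_add[symmetric])
  qed
  from affine_eq_imp_eq[OF _ _ this] assms
  show "\<phi> (s + t) u = \<phi> t u + \<phi> s (\<psi> t u)" "\<psi> (s + t) u = \<psi> s (\<psi> t u)"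
    by (auto simp: psi_symmetric psi_psd)
qed

lemma continuous_time:
  assumes t: "0 \<le> t" and u: "u \<in> psd"
  shows "((\<lambda>s. \<phi> s u) \<longlongrightarrow> \<phi> t u) (at t within {0..})" "((\<lambda>s. \<psi> s u) \<longlongrightarrow> \<psi> t u) (at t within {0..})"
proof -
  have ev: "eventually (\<lambda>s. 0 \<le> s) (at t within {0..})" by (simp add: eventually_at_filter)
  have sym: "eventually (\<lambda>s. symmetric_matrix (\<psi> s u)) (at t within {0..})"
    using ev by eventually_elim (rule psi_symmetric[OF _ u])
  have "((\<lambda>s. exp (- \<phi> s u - trace (\<psi> s u ** x))) \<longlongrightarrow> exp (- \<phi> t u - trace (\<psi> t u ** x))) (at t within {0..})"
    if x: "x \<in> psd" for x
  proof -
    have "bounded (exp_trace u ` psd)"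
      unfolding bounded_iff using exp_trace_le_1[OF u] by (intro exI[of _ 1]) auto
    hence "((\<lambda>s. LINT \<xi>|p s x. exp_trace u \<xi>) \<longlongrightarrow> (LINT \<xi>|p t x. exp_trace u \<xi>)) (at t within {0..})"
      using stoch_cont t x continuous_on_exp_trace unfolding stochastically_continuous_def by blast
    hence "((\<lambda>s. LINT \<xi>|p s x. exp_trace u \<xi>) \<longlongrightarrow> exp (- \<phi> t u - trace (\<psi> t u ** x))) (at t within {0..})"
      by (simp add: transform t u x)
    thus ?thesis
      by (rule Lim_transform_eventually) (use ev in eventually_elim, simp add: transform u x)
  qed
  note tendsto_of_exp_affine[OF sym psi_symmetric[OF t u] this]
  thus "((\<lambda>s. \<phi> s u) \<longlongrightarrow> \<phi> t u) (at t within {0..})" "((\<lambda>s. \<psi> s u) \<longlongrightarrow> \<psi> t u) (at t within {0..})"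
    by simp_all
qed

text \<open>Dominated convergence under \<open>p t x\<close>; it carries estimates from the interior
  of the cone to its boundary.\<close>

lemma continuous_argument:
  assumes t: "0 \<le> t" and u: "u \<in> psd" and v: "\<And>n::nat. v n \<in> psd" and lim: "v \<longlonglongrightarrow> u"
  shows "(\<lambda>n. \<phi> t (v n)) \<longlonglongrightarrow> \<phi> t u" "(\<lambda>n. \<psi> t (v n)) \<longlonglongrightarrow> \<psi> t u"
proof -
  have "(\<lambda>n. exp (- \<phi> t (v n) - trace (\<psi> t (v n) ** x))) \<longlonglongrightarrow> exp (- \<phi> t u - trace (\<psi> t u ** x))"
    if x: "x \<in> psd" for x
  proof -
    interpret prob_space "p t x" by (rule prob_space_p[OF t x])
    have "(\<lambda>n. LINT \<xi>|p t x. exp_trace (v n) \<xi>) \<longlonglongrightarrow> (LINT \<xi>|p t x. exp_trace u \<xi>)"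
    proof (rule integral_dominated_convergence[where w = "\<lambda>_. 1"])
      show "exp_trace u \<in> borel_measurable (p t x)" "exp_trace (v n) \<in> borel_measurable (p t x)" for n
        by (simp_all add: measurable_p[OF t x] exp_trace_measurable)
      show "integrable (p t x) (\<lambda>_. 1 :: real)" by simp
      show "AE \<xi> in p t x. (\<lambda>n. exp_trace (v n) \<xi>) \<longlonglongrightarrow> exp_trace u \<xi>"
        by (intro AE_I2 tendsto_intros lim)
      show "AE \<xi> in p t x. norm (exp_trace (v n) \<xi>) \<le> 1" for n
        by (rule AE_I2) (simp add: space_p[OF t x] trace_mult_psd_nonneg v)
    qed
    thus ?thesis by (simp add: transform t u x v)
  qed
  from tendsto_of_exp_affine[OF _ psi_symmetric[OF t u] this]
  show "(\<lambda>n. \<phi> t (v n)) \<longlonglongrightarrow> \<phi> t u" "(\<lambda>n. \<psi> t (v n)) \<longlonglongrightarrow> \<psi> t u"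
    by (simp_all add: psi_symmetric t v)
qed

text \<open>Divided by \<open>exp_trace u x\<close>, the generator limit is the derivative at
  \<open>0\<close> of \<open>exp (- g h)\<close>, where \<open>g\<close> is the increment of the
  exponent; a logarithm yields that of \<open>g\<close>, and \<open>x = 0\<close> separates
  \<open>F\<close> from \<open>R\<close>. The hypothesis on \<open>u\<close> makes the exponential
  admissible for the generator.\<close>

lemma right_derivative_0:
  assumes u: "u - c *\<^sub>R mat 1 \<in> psd" "c > 0"
  shows "((\<lambda>h. \<phi> h u / h) \<longlongrightarrow> F u) (at_right 0)" "((\<lambda>h. (\<psi> h u - u) /\<^sub>R h) \<longlongrightarrow> R u) (at_right 0)"
proof -
  have up: "u \<in> psd" using psd_of_lower_bound[OF u(1)] u(2) by simp
  have ev: "eventually (\<lambda>h::real. 0 < h) (at_right 0)" by (simp add: eventually_at_right_less)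
  have *: "((\<lambda>h. (\<phi> h u + trace ((\<psi> h u - u) ** x)) / h) \<longlongrightarrow> F u + trace (R u ** x)) (at_right 0)"
    if x: "x \<in> psd" for x
  proof -
    define g where "g h = \<phi> h u + trace ((\<psi> h u - u) ** x)" for h
    define D where "D = F u + trace (R u ** x)"
    have g0: "g 0 = 0" by (simp add: g_def phi_psi_0 up)
    have "((\<lambda>h. ((LINT \<xi>|p h x. exp_trace u \<xi>) - exp_trace u x) / h) \<longlongrightarrow> - exp_trace u x * D) (at_right 0)"
      unfolding D_def affine_operator_exp_trace[OF up x, symmetric]
      using generator[unfolded has_affine_generator_def, rule_format, OF rapidly_decreasing_exp_trace[OF u]] x
      by (rule tendsto_uniform_limitI)
    hence "((\<lambda>h. (1 / exp_trace u x) * (((LINT \<xi>|p h x. exp_trace u \<xi>) - exp_trace u x) / h))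
        \<longlongrightarrow> (1 / exp_trace u x) * (- exp_trace u x * D)) (at_right 0)"
      by (intro tendsto_intros)
    hence "((\<lambda>h. (1 / exp_trace u x) * (((LINT \<xi>|p h x. exp_trace u \<xi>) - exp_trace u x) / h))
        \<longlongrightarrow> - D) (at_right 0)"
      by simp
    hence "((\<lambda>h. (exp (- g h) - exp (- g 0)) / (h - 0)) \<longlongrightarrow> - D) (at_right 0)"
    proof (rule Lim_transform_eventually)
      show "eventually (\<lambda>h. (1 / exp_trace u x) * (((LINT \<xi>|p h x. exp_trace u \<xi>) - exp_trace u x) / h)
          = (exp (- g h) - exp (- g 0)) / (h - 0)) (at_right 0)"
        using ev
      proof eventually_elim
        case (elim h)
        have "exp (- \<phi> h u - trace (\<psi> h u ** x)) = exp_trace u x * exp (- g h)"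
          by (simp add: g_def trace_mult_simps exp_add[symmetric])
        thus ?case using elim by (simp add: transform up x g0 field_simps)
      qed
    qed
    \<comment> \<open>Read as a derivative within the open half-line, the limit becomes accessible
      to the chain rule with \<open>ln\<close>.\<close>
    hence "((\<lambda>h. exp (- g h)) has_real_derivative - D) (at 0 within {0<..})"
      by (simp add: has_field_derivative_iff)
    hence "((\<lambda>h. ln (exp (- g h))) has_real_derivative (1 / exp (- g 0)) * (- D)) (at 0 within {0<..})"
      by (intro DERIV_chain2[where f = ln] DERIV_ln_divide) auto
    hence "((\<lambda>h. - g h / h) \<longlongrightarrow> - D) (at_right 0)"
      by (simp add: has_field_derivative_iff g0)
    from tendsto_minus[OF this] have "((\<lambda>h. g h / h) \<longlongrightarrow> D) (at_right 0)" by simp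
    thus ?thesis by (simp only: g_def D_def)
  qed
  show phi: "((\<lambda>h. \<phi> h u / h) \<longlongrightarrow> F u) (at_right 0)" using *[OF psd_zero] by simp
  show "((\<lambda>h. (\<psi> h u - u) /\<^sub>R h) \<longlongrightarrow> R u) (at_right 0)"
  proof (rule tendsto_symmetricI)
    show "eventually (\<lambda>h. symmetric_matrix ((\<psi> h u - u) /\<^sub>R h)) (at_right 0)"
      using ev by eventually_elim (intro symmetric_matrix_intros psi_symmetric psd_symmetric up less_imp_le)
    show "symmetric_matrix (R u)" by (rule R_symmetric[OF up])
    fix x :: "real^'d^'d" assume "x \<in> psd"
    from tendsto_diff[OF *[OF this] phi]
    show "((\<lambda>h. trace (((\<psi> h u - u) /\<^sub>R h) ** x)) \<longlongrightarrow> trace (R u ** x)) (at_right 0)"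
      by (simp add: trace_mult_scaleR_left add_divide_distrib) (simp add: divide_inverse mult.commute)
  qed
qed

section \<open>Order properties of the flow\<close>

lemma monotone:
  assumes t: "0 \<le> t" and u: "u \<in> psd" and v: "v \<in> psd" and le: "v - u \<in> psd"
  shows "\<phi> t u \<le> \<phi> t v" "\<psi> t v - \<psi> t u \<in> psd"
proof -
  have "\<phi> t u + trace (\<psi> t u ** x) \<le> \<phi> t v + trace (\<psi> t v ** x)" if x: "x \<in> psd" for x
  proof -
    have "(LINT \<xi>|p t x. exp_trace v \<xi>) \<le> (LINT \<xi>|p t x. exp_trace u \<xi>)"
      by (intro integral_mono integrable_exp_trace t x u v)
         (simp add: space_p t x trace_mult_mono[OF le])
    thus ?thesis by (simp add: transform t u v x)
  qed
  note affine_le_imp_psd_order[OF psi_symmetric[OF t u] psi_symmetric[OF t v] this]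
  thus "\<phi> t u \<le> \<phi> t v" "\<psi> t v - \<psi> t u \<in> psd" by simp_all
qed

text \<open>Jensen for the power \<open>l\<close> gives
  \<open>(E f) powr l \<le> E (f powr l)\<close> with \<open>f powr l\<close> the exponential of
  \<open>l u\<close>; passing to exponents reverses the inequality. The scalar part of the
  conclusion is dropped.\<close>

lemma psi_subhomogeneous:
  assumes t: "0 \<le> t" and u: "u \<in> psd" and l: "1 \<le> l"
  shows "l *\<^sub>R \<psi> t u - \<psi> t (l *\<^sub>R u) \<in> psd"
proof -
  have lu: "l *\<^sub>R u \<in> psd" using l by (intro psd_scaleR u) simp
  have "\<phi> t (l *\<^sub>R u) + trace (\<psi> t (l *\<^sub>R u) ** x) \<le> l * \<phi> t u + trace ((l *\<^sub>R \<psi> t u) ** x)"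
    if x: "x \<in> psd" for x
  proof -
    interpret prob_space "p t x" by (rule prob_space_p[OF t x])
    have powr: "exp_trace u \<xi> powr l = exp_trace (l *\<^sub>R u) \<xi>" for \<xi>
      by (simp add: powr_def trace_mult_simps)
    have "expectation (exp_trace u) powr l \<le> expectation (\<lambda>\<xi>. exp_trace u \<xi> powr l)"
      by (rule jensens_inequality[where I = "{0<..}" and a = 0])
         (auto simp: powr integrable_exp_trace t x u lu intro!: powr_convex l)
    hence "exp (- \<phi> t u - trace (\<psi> t u ** x)) powr l \<le> exp (- \<phi> t (l *\<^sub>R u) - trace (\<psi> t (l *\<^sub>R u) ** x))"
      unfolding powr by (simp only: transform t u x lu)
    thus ?thesis by (simp add: powr_def trace_mult_simps algebra_simps)
  qed
  note affine_le_imp_psd_order(2)[OF psi_symmetric[OF t lu] symmetric_matrix_intros(3)[OF psi_symmetric[OF t u]] this]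
  thus ?thesis by simp
qed

text \<open>Reduces upper bounds at arbitrary points to the orbit of \<open>mat 1\<close>;
  \<open>psi_lower\<close> is the counterpart from below.\<close>

lemma psi_upper:
  assumes t: "0 \<le> t" and u: "u \<in> psd" "l *\<^sub>R mat 1 - u \<in> psd" and l: "1 \<le> l"
  shows "l *\<^sub>R \<psi> t (mat 1) - \<psi> t u \<in> psd"
proof -
  have "l *\<^sub>R mat 1 \<in> (psd :: (real^'d^'d) set)" using l by (intro psd_scaleR) auto
  from monotone(2)[OF t u(1) this u(2)] psi_subhomogeneous[OF t psd_mat_1 l]
  show ?thesis by (rule psd_order_trans)
qed

text \<open>Subhomogeneity is applied at the small matrix \<open>l mat 1\<close> with the factor
  \<open>1 / l \<ge> 1\<close>, which turns an upper bound into a lower one.\<close>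

lemma psi_lower:
  assumes t: "0 \<le> t" and u: "u - l *\<^sub>R mat 1 \<in> psd" and l: "0 < l" "l \<le> 1"
  shows "\<psi> t u - l *\<^sub>R \<psi> t (mat 1) \<in> psd"
proof -
  have lI: "l *\<^sub>R mat 1 \<in> (psd :: (real^'d^'d) set)" using l by (intro psd_scaleR) auto
  have up: "u \<in> psd" using psd_of_lower_bound[OF u] l by simp
  have "(1 / l) *\<^sub>R \<psi> t (l *\<^sub>R mat 1) - \<psi> t (mat 1) \<in> psd"
    using psi_subhomogeneous[OF t lI, of "1 / l"] l by simp
  from psd_scaleR[OF this, of l] l
  have "\<psi> t (l *\<^sub>R mat 1) - l *\<^sub>R \<psi> t (mat 1) \<in> psd" by (simp add: scaleR_diff_right)
  from psd_order_trans[OF this monotone(2)[OF t lI up u]] show ?thesis .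
qed

text \<open>Near time \<open>0\<close> the difference quotient at \<open>mat 1\<close> stays close
  to its limit, and the norm bound becomes a two-sided order bound. The linear rate \<open>C\<close>
  controls growth; for the lower side any fixed positive multiple would do.\<close>

lemma psi_identity_bounds:
  "\<exists>C\<ge>0. \<exists>h0>0. \<forall>h\<in>{0..h0}. (1 + C * h) *\<^sub>R mat 1 - \<psi> h (mat 1) \<in> psd \<and>
      \<psi> h (mat 1) - (1/2) *\<^sub>R mat 1 \<in> psd"
proof -
  have "((\<lambda>h. norm ((\<psi> h (mat 1) - mat 1) /\<^sub>R h)) \<longlongrightarrow> norm (R (mat 1))) (at_right 0)"
    by (intro tendsto_norm right_derivative_0(2)[of _ 1]) simp_all
  hence "eventually (\<lambda>h. norm ((\<psi> h (mat 1) - mat 1) /\<^sub>R h) < norm (R (mat 1)) + 1) (at_right 0)"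
    by (intro order_tendstoD) auto
  then obtain h1 where h1: "h1 > 0"
    "\<And>h. 0 < h \<Longrightarrow> h < h1 \<Longrightarrow> norm ((\<psi> h (mat 1) - mat 1) /\<^sub>R h) < norm (R (mat 1)) + 1"
    unfolding eventually_at_right_field by blast
  define C where "C = norm (R (mat 1)) + 1"
  have C: "C > 0" by (simp add: C_def add_nonneg_pos)
  \<comment> \<open>Half of \<open>h1\<close> stays strictly inside the range of the estimate;
    \<open>1 / (2 * C)\<close> keeps the deviation from \<open>mat 1\<close> below
    \<open>1/2\<close>.\<close>
  define h0 where "h0 = min (h1 / 2) (1 / (2 * C))"
  have h0: "h0 > 0" "h0 < h1" "C * h0 \<le> 1/2"
    using h1(1) C by (auto simp: h0_def min_def field_simps)
  have "(1 + C * h) *\<^sub>R mat 1 - \<psi> h (mat 1) \<in> psd \<and> \<psi> h (mat 1) - (1/2) *\<^sub>R mat 1 \<in> psd"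
    if h: "h \<in> {0..h0}" for h
  proof -
    let ?A = "\<psi> h (mat 1) - mat 1"
    have n: "norm ?A \<le> C * h"
    proof (cases "h = 0")
      case False
      hence "0 < h" "h < h1" using h h0 by auto
      with h1(2)[of h] show ?thesis unfolding norm_scaleR C_def[symmetric] by (simp add: field_simps)
    qed (simp add: phi_psi_0)
    also have "C * h \<le> 1/2" using h h0(3) C by (smt (verit) atLeastAtMost_iff mult_left_mono)
    finally have n2: "norm ?A \<le> 1/2" .
    have sym: "symmetric_matrix ?A" using h by (intro symmetric_matrix_intros psi_symmetric) auto
    have "(C * h) *\<^sub>R mat 1 - ?A = (1 + C * h) *\<^sub>R mat 1 - \<psi> h (mat 1)"
      by (simp add: scaleR_add_left algebra_simps)
    moreover have "(1/2) *\<^sub>R mat 1 + ?A = \<psi> h (mat 1) - (1/2) *\<^sub>R mat 1"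
    proof -
      have "(1/2) *\<^sub>R mat 1 + (1/2) *\<^sub>R mat 1 = (mat 1 :: real^'d^'d)" by (simp flip: scaleR_add_left)
      thus ?thesis by (simp add: algebra_simps)
    qed
    ultimately show ?thesis
      using norm_mat_diff_psd(1)[OF sym n] norm_mat_diff_psd(2)[OF sym n2] by (simp only:)
  qed
  thus ?thesis using C h0(1) less_imp_le by blast
qed

text \<open>Each step of length at most \<open>h0\<close> costs at most a factor \<open>1/2\<close>,
  and a bounded time needs finitely many steps. So orbits from the interior stay in the interior,
  where the right derivative is available.\<close>

lemma psi_positive_definite:
  "\<exists>\<delta>>0. \<delta> \<le> 1 \<and> (\<forall>t\<in>{0..T}. \<psi> t (mat 1) - \<delta> *\<^sub>R mat 1 \<in> psd)"
proof -
  obtain h0 where h0: "h0 > 0" "\<And>h. h \<in> {0..h0} \<Longrightarrow> \<psi> h (mat 1) - (1/2) *\<^sub>R mat 1 \<in> psd"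
    using psi_identity_bounds by blast
  have *: "\<forall>t\<in>{0..real n * h0}. \<psi> t (mat 1) - (1/2) ^ n *\<^sub>R mat 1 \<in> psd" for n
  proof (induction n)
    case 0
    show ?case by (simp add: phi_psi_0)
  next
    case (Suc n)
    show ?case
    proof
      fix t assume t: "t \<in> {0..real (Suc n) * h0}"
      \<comment> \<open>The last piece has length at most \<open>h0\<close>, and the remainder
        \<open>s\<close> falls under the induction hypothesis for every \<open>t\<close>.\<close>
      define h where "h = min t h0"
      define s where "s = t - h"
      have hs: "h \<in> {0..h0}" "s \<in> {0..real n * h0}" "t = h + s"
        using t h0(1) by (auto simp: h_def s_def min_def algebra_simps)
      have "\<psi> t (mat 1) = \<psi> h (\<psi> s (mat 1))" using flow(2)[of h s "mat 1"] hs by simp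
      moreover have "\<psi> h (\<psi> s (mat 1)) - (1/2) ^ n *\<^sub>R \<psi> h (mat 1) \<in> psd"
        using Suc hs by (intro psi_lower) (auto simp: power_le_one)
      moreover have "(1/2) ^ n *\<^sub>R (\<psi> h (mat 1) - (1/2) *\<^sub>R mat 1) \<in> psd"
        by (intro psd_scaleR h0 hs) simp
      hence "(1/2) ^ n *\<^sub>R \<psi> h (mat 1) - (1/2) ^ Suc n *\<^sub>R mat 1 \<in> psd"
        by (simp add: scaleR_diff_right mult.commute)
      ultimately show "\<psi> t (mat 1) - (1/2) ^ Suc n *\<^sub>R mat 1 \<in> psd"
        using psd_order_trans by metis
    qed
  qed
  obtain n where n: "T \<le> real n * h0"
    using reals_Archimedean3[OF h0(1), rule_format, of T] less_imp_le by blast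
  show ?thesis
  proof (intro exI conjI ballI)
    fix t assume "t \<in> {0..T}"
    thus "\<psi> t (mat 1) - (1/2) ^ n *\<^sub>R mat 1 \<in> psd" using *[of n] n by auto
  qed (simp_all add: power_le_one)
qed

section \<open>Increments of the flow\<close>

definition riccati :: "real^'d^'d \<Rightarrow> real \<times> (real^'d^'d)" where
  "riccati u = (F u, R u)"

lemma continuous_on_riccati: "continuous_on psd riccati"
  unfolding riccati_def[abs_def] by (intro continuous_on_Pair continuous_on_F continuous_on_R)

text \<open>By the flow property the increment after time \<open>t\<close> is that of a flow started
  at \<open>\<psi> t u\<close>, which is still positive definite, so the derivative at time
  \<open>0\<close> applies there.\<close>

lemma flow_right_derivative:
  assumes u: "u - c *\<^sub>R mat 1 \<in> psd" "c > 0" and t: "0 \<le> t"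
  shows "((\<lambda>h. ((\<phi> (t + h) u, \<psi> (t + h) u) - (\<phi> t u, \<psi> t u)) /\<^sub>R h) \<longlongrightarrow> riccati (\<psi> t u)) (at_right 0)"
proof -
  have up: "u \<in> psd" using psd_of_lower_bound[OF u(1)] u(2) by simp
  obtain \<delta> where \<delta>: "\<delta> > 0" "\<psi> t (mat 1) - \<delta> *\<^sub>R mat 1 \<in> psd"
    using psi_positive_definite[of t] t by auto
  \<comment> \<open>Capped at \<open>1\<close> because \<open>psi_lower\<close> asks for a factor at
    most \<open>1\<close>.\<close>
  define l where "l = min c 1"
  have l: "0 < l" "l \<le> 1" using u(2) by (auto simp: l_def)
  have "l \<le> c" by (simp add: l_def)
  note ul = psd_order_trans[OF psd_scaled[OF this] u(1)]
  have "l *\<^sub>R (\<psi> t (mat 1) - \<delta> *\<^sub>R mat 1) \<in> psd" by (rule psd_scaleR[OF \<delta>(2) less_imp_le[OF l(1)]])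
  hence "l *\<^sub>R \<psi> t (mat 1) - (l * \<delta>) *\<^sub>R mat 1 \<in> psd" by (simp add: scaleR_diff_right)
  note pd = psd_order_trans[OF this psi_lower[OF t ul l]]
  have "((\<lambda>h. (\<phi> h (\<psi> t u) / h, (\<psi> h (\<psi> t u) - \<psi> t u) /\<^sub>R h)) \<longlongrightarrow> riccati (\<psi> t u)) (at_right 0)"
    unfolding riccati_def using l \<delta>(1) by (intro tendsto_Pair right_derivative_0[OF pd]) auto
  thus ?thesis
    by (rule Lim_transform_eventually)
       (use eventually_at_right_less[of "0::real"] in eventually_elim,
        use flow[OF _ t up] in \<open>simp add: add.commute divide_inverse mult.commute\<close>)
qed

text \<open>The estimate is first obtained for positive definite \<open>u\<close>, where the flow is differentiable from
  the right, and extends to the boundary of the cone by continuity.\<close>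

lemma flow_increment:
  fixes L :: real
  assumes "\<epsilon> > 0"
  shows "\<exists>h1>0. \<forall>h\<in>{0..h1}. \<forall>u\<in>psd. L *\<^sub>R mat 1 - u \<in> psd \<longrightarrow>
    norm ((\<phi> h u, \<psi> h u - u) - h *\<^sub>R riccati u) \<le> \<epsilon> * h"
proof -
  obtain C h0 where C: "C \<ge> 0" "h0 > 0" "\<And>h. h \<in> {0..h0} \<Longrightarrow> (1 + C * h) *\<^sub>R mat 1 - \<psi> h (mat 1) \<in> psd"
    using psi_identity_bounds by blast
  \<comment> \<open>At least \<open>1\<close>, as \<open>psi_upper\<close> requires, and with room
    for perturbing \<open>u\<close> by at most \<open>mat 1\<close> at the end.\<close>
  define l where "l = \<bar>L\<bar> + 1"
  have l: "1 \<le> l" "L \<le> l" by (auto simp: l_def)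
  \<comment> \<open>A compact set containing all orbits considered up to time \<open>h0\<close>:
    they stay below \<open>l * (1 + C * h0)\<close> times \<open>mat 1\<close>, and the dimension
    converts this into a norm bound.\<close>
  define K :: "(real^'d^'d) set" where "K = {u \<in> psd. norm u \<le> l * (1 + C * h0) * CARD('d)}"
  have "K = psd \<inter> cball 0 (l * (1 + C * h0) * CARD('d))" by (auto simp: K_def)
  hence "compact K" using closed_Int_compact[OF closed_psd compact_cball] by simp
  moreover have cont: "continuous_on K riccati"
    by (rule continuous_on_subset[OF continuous_on_riccati]) (auto simp: K_def)
  ultimately have "uniformly_continuous_on K riccati" "bounded (riccati ` K)"
    by (auto intro: compact_uniformly_continuous compact_imp_bounded compact_continuous_image)
  then obtain M d where M: "\<And>u. u \<in> K \<Longrightarrow> norm (riccati u) \<le> M" and d: "d > 0"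
    "\<And>u v. u \<in> K \<Longrightarrow> v \<in> K \<Longrightarrow> dist v u < d \<Longrightarrow> dist (riccati v) (riccati u) < \<epsilon>"
    using assms unfolding uniformly_continuous_on_def bounded_iff by (metis image_eqI)
  \<comment> \<open>At speed at most \<open>M\<close> the flow moves by less than \<open>d\<close>
    within time \<open>h1\<close>, so the field along the orbit varies by less than
    \<open>\<epsilon>\<close>.\<close>
  define h1 where "h1 = min h0 (d / (2 * (\<bar>M\<bar> + 1)))"
  have h1: "h1 > 0" "h1 \<le> h0" "(\<bar>M\<bar> + 1) * h1 < d"
  proof -
    have "(\<bar>M\<bar> + 1) * h1 \<le> (\<bar>M\<bar> + 1) * (d / (2 * (\<bar>M\<bar> + 1)))"
      by (intro mult_left_mono) (auto simp: h1_def)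
    also have "\<dots> = d / 2" by (simp add: field_simps add_nonneg_eq_0_iff)
    finally show "(\<bar>M\<bar> + 1) * h1 < d" using d(1) by simp
  qed (use C(2) d(1) in \<open>auto simp: h1_def\<close>)
  have pd: "norm ((\<phi> h u, \<psi> h u - u) - h *\<^sub>R riccati u) \<le> \<epsilon> * h"
    if h: "h \<in> {0..h1}" and u: "u - c *\<^sub>R mat 1 \<in> psd" "c > 0" and ul: "l *\<^sub>R mat 1 - u \<in> psd" for h u c
  proof -
    have up: "u \<in> psd" using psd_of_lower_bound[OF u(1)] u(2) by simp
    have K: "\<psi> s u \<in> K" if s: "s \<in> {0..h0}" for s
    proof -
      have "l *\<^sub>R \<psi> s (mat 1) - \<psi> s u \<in> psd" using s by (intro psi_upper up ul l) auto
      moreover have "(l * (1 + C * h0)) *\<^sub>R mat 1 - l *\<^sub>R \<psi> s (mat 1) \<in> psd"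
      proof -
        have "l *\<^sub>R ((1 + C * s) *\<^sub>R mat 1 - \<psi> s (mat 1)) \<in> psd"
          using C(3)[OF s] l by (intro psd_scaleR) auto
        hence "(l * (1 + C * s)) *\<^sub>R mat 1 - l *\<^sub>R \<psi> s (mat 1) \<in> psd"
          by (simp add: scaleR_diff_right)
        moreover have "l * (1 + C * s) \<le> l * (1 + C * h0)"
          using l C(1) s by (intro mult_left_mono add_left_mono) auto
        from psd_scaled[OF this]
        have "(l * (1 + C * h0)) *\<^sub>R mat 1 - (l * (1 + C * s)) *\<^sub>R mat 1 \<in> (psd :: (real^'d^'d) set)" .
        ultimately show ?thesis by (rule psd_order_trans)
      qed
      ultimately have "(l * (1 + C * h0)) *\<^sub>R mat 1 - \<psi> s u \<in> psd" by (rule psd_order_trans)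
      thus ?thesis unfolding K_def using s up norm_le_of_psd_order psi_psd by auto
    qed
    let ?f = "\<lambda>s. (\<phi> s u, \<psi> s u)"
    have cont: "continuous_on {0..s} ?f" for s
    proof -
      have "continuous_on {0..} ?f"
        unfolding continuous_on_def using continuous_time[OF _ up] by (auto intro!: tendsto_Pair)
      thus ?thesis by (rule continuous_on_subset) auto
    qed
    have uK: "u \<in> K" using K[of 0] C(2) by (simp add: phi_psi_0 up)
    have near: "dist (riccati (\<psi> s u)) (riccati u) < \<epsilon>" if s: "0 \<le> s" "s < h" for s
    proof -
      have "norm (?f s - ?f 0) \<le> M * (s - 0)"
        using s h h1 by (intro norm_diff_le_right_derivative[OF _ cont flow_right_derivative[OF u]] M K) auto
      hence "norm (\<phi> s u, \<psi> s u - u) \<le> M * s" by (simp add: phi_psi_0 up)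
      with norm_snd_le[of "\<psi> s u - u" "\<phi> s u"] have "norm (\<psi> s u - u) \<le> M * s" by linarith
      also have "\<dots> \<le> (\<bar>M\<bar> + 1) * h1" using s h by (intro mult_mono) auto
      finally have "dist (\<psi> s u) u < d" using h1(3) by (simp add: dist_norm)
      thus ?thesis using s h h1 by (intro d uK K) auto
    qed
    \<comment> \<open>The mean value inequality is applied to the deviation from the straight line
      with slope \<open>riccati u\<close>, whose right derivative is small by
      \<open>near\<close>.\<close>
    have "norm ((?f h - h *\<^sub>R riccati u) - (?f 0 - 0 *\<^sub>R riccati u)) \<le> \<epsilon> * (h - 0)"
    proof (rule norm_diff_le_right_derivative[where f = "\<lambda>s. ?f s - s *\<^sub>R riccati u"
          and f' = "\<lambda>s. riccati (\<psi> s u) - riccati u"])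
      show "0 \<le> h" using h by simp
      show "continuous_on {0..h} (\<lambda>s. ?f s - s *\<^sub>R riccati u)" by (intro continuous_intros cont)
      fix s assume s: "0 \<le> s" "s < h"
      show "norm (riccati (\<psi> s u) - riccati u) \<le> \<epsilon>" using near[OF s] by (simp add: dist_norm)
      have "((\<lambda>k. (?f (s + k) - ?f s) /\<^sub>R k - riccati u) \<longlongrightarrow> riccati (\<psi> s u) - riccati u) (at_right 0)"
        by (intro tendsto_diff tendsto_const flow_right_derivative[OF u s(1)])
      thus "((\<lambda>k. ((?f (s + k) - (s + k) *\<^sub>R riccati u) - (?f s - s *\<^sub>R riccati u)) /\<^sub>R k)
          \<longlongrightarrow> riccati (\<psi> s u) - riccati u) (at_right 0)"
      proof (rule Lim_transform_eventually)
        show "eventually (\<lambda>k. (?f (s + k) - ?f s) /\<^sub>R k - riccati u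
            = ((?f (s + k) - (s + k) *\<^sub>R riccati u) - (?f s - s *\<^sub>R riccati u)) /\<^sub>R k) (at_right 0)"
          using eventually_at_right_less[of "0::real"]
        proof eventually_elim
          case (elim k)
          have "(?f (s + k) - (s + k) *\<^sub>R riccati u) - (?f s - s *\<^sub>R riccati u) = (?f (s + k) - ?f s) - k *\<^sub>R riccati u"
            unfolding scaleR_add_left by (simp only: algebra_simps)
          thus ?case using elim by (simp only: scaleR_diff_right) simp
        qed
      qed
    qed
    moreover have "(?f h - h *\<^sub>R riccati u) - (?f 0 - 0 *\<^sub>R riccati u) = (\<phi> h u, \<psi> h u - u) - h *\<^sub>R riccati u"
      by (simp add: phi_psi_0 up prod_eq_iff)
    ultimately show ?thesis by (simp only: diff_zero)
  qed
  show ?thesis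
  proof (intro exI[of _ h1] conjI ballI impI h1(1))
    fix h and u :: "real^'d^'d"
    assume h: "h \<in> {0..h1}" and u: "u \<in> psd" and uL: "L *\<^sub>R mat 1 - u \<in> psd"
    \<comment> \<open>The shifted matrices lie in the interior. The estimate has the same
      \<open>\<epsilon>\<close> and \<open>h1\<close> for all of them and both sides are continuous,
      so it holds at \<open>u\<close>.\<close>
    define v where "v n = u + (1 / real (Suc n)) *\<^sub>R mat 1" for n
    have vp: "v n \<in> psd" for n unfolding v_def by (intro psd_add u psd_scaleR) auto
    have v1: "v n - (1 / real (Suc n)) *\<^sub>R mat 1 \<in> psd" for n by (simp add: v_def u)
    have v2: "l *\<^sub>R mat 1 - v n \<in> psd" for n
    proof -
      have "1 / real (Suc n) \<le> 1" by simp
      hence "L + 1 / real (Suc n) \<le> l" unfolding l_def by linarith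
      from psd_scaled[OF this]
      have "l *\<^sub>R mat 1 - (L + 1 / real (Suc n)) *\<^sub>R mat 1 \<in> (psd :: (real^'d^'d) set)" .
      from psd_add[OF this uL] show ?thesis by (simp add: v_def scaleR_add_left diff_diff_add add.commute)
    qed
    have "v \<longlonglongrightarrow> u + 0 *\<^sub>R mat 1"
      unfolding v_def by (intro tendsto_intros LIMSEQ_Suc[OF lim_1_over_n])
    hence lim: "v \<longlonglongrightarrow> u" by simp
    have "(\<lambda>n. riccati (v n)) \<longlonglongrightarrow> riccati u"
      using continuous_on_riccati lim u vp unfolding continuous_on_sequentially o_def by blast
    hence "(\<lambda>n. norm ((\<phi> h (v n), \<psi> h (v n) - v n) - h *\<^sub>R riccati (v n)))
        \<longlonglongrightarrow> norm ((\<phi> h u, \<psi> h u - u) - h *\<^sub>R riccati u)"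
      using h by (intro tendsto_intros continuous_argument u vp lim) auto
    thus "norm ((\<phi> h u, \<psi> h u - u) - h *\<^sub>R riccati u) \<le> \<epsilon> * h"
      by (rule LIMSEQ_le_const2) (intro exI allI impI pd[OF h v1 _ v2]; simp)
  qed
qed

end

section \<open>Time discretization of the Feynman--Kac functional\<close>

context affine_semigroup
begin

text \<open>One step of length \<open>h\<close> multiplies by \<open>exp (- h * trace (B ** x))\<close> and then applies the
  transition operator of the semigroup.\<close>

primrec splitting :: "real^'d^'d \<Rightarrow> real \<Rightarrow> nat \<Rightarrow> real \<times> (real^'d^'d)" where
  "splitting B h 0 = (0, 0)"
| "splitting B h (Suc k) =
     (fst (splitting B h k) + \<phi> h (snd (splitting B h k) + h *\<^sub>R B),
      \<psi> h (snd (splitting B h k) + h *\<^sub>R B))"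

lemma splitting_psd:
  assumes "B \<in> psd" "0 \<le> h"
  shows "snd (splitting B h k) \<in> psd"
  by (induction k) (auto intro!: psi_psd psd_add psd_scaleR assms)

text \<open>A step multiplies the bound by at most
  \<open>(1 + h * c) * (1 + C * h) \<le> exp (A * h)\<close>: adding \<open>h B\<close> costs the
  first factor, the flow the second. The bound starts at \<open>1\<close> although the scheme starts
  at \<open>0\<close>, because \<open>psi_upper\<close> needs a multiple of at least
  \<open>1\<close>. The second conjunct covers the point at which the flow is evaluated.\<close>

lemma splitting_bound:
  assumes B: "B \<in> psd"
  shows "\<exists>A\<ge>0. \<exists>h0>0. \<forall>h\<in>{0..h0}. \<forall>k. exp (A * (real k * h)) *\<^sub>R mat 1 - snd (splitting B h k) \<in> psd \<and>
    exp (A * (real (Suc k) * h)) *\<^sub>R mat 1 - (snd (splitting B h k) + h *\<^sub>R B) \<in> psd"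
proof -
  obtain C h0 where C: "C \<ge> 0" "h0 > 0" "\<And>h. h \<in> {0..h0} \<Longrightarrow> (1 + C * h) *\<^sub>R mat 1 - \<psi> h (mat 1) \<in> psd"
    using psi_identity_bounds by blast
  define c where "c = norm B"
  have c: "0 \<le> c" "c *\<^sub>R mat 1 - B \<in> psd"
    using norm_mat_diff_psd(1)[OF psd_symmetric[OF B] order_refl] by (auto simp: c_def)
  define A where "A = c + C"
  have "exp (A * (real k * h)) *\<^sub>R mat 1 - snd (splitting B h k) \<in> psd \<and>
    exp (A * (real (Suc k) * h)) *\<^sub>R mat 1 - (snd (splitting B h k) + h *\<^sub>R B) \<in> psd"
    if h: "h \<in> {0..h0}" for h k
  proof -
    have h0: "0 \<le> h" using h by simp
    have upd: "(exp (A * (real k * h)) * (1 + h * c)) *\<^sub>R mat 1 - (snd (splitting B h k) + h *\<^sub>R B) \<in> psd"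
      if u: "exp (A * (real k * h)) *\<^sub>R mat 1 - snd (splitting B h k) \<in> psd" for k
    proof -
      let ?E = "exp (A * (real k * h))"
      have "1 \<le> ?E" using C(1) c(1) h0 by (simp add: A_def)
      hence "(h * c) * 1 \<le> (h * c) * ?E" using c(1) h0 by (intro mult_left_mono) auto
      hence "(?E * (1 + h * c)) *\<^sub>R mat 1 - (?E + h * c) *\<^sub>R mat 1 \<in> (psd :: (real^'d^'d) set)"
        by (intro psd_scaled) (simp add: algebra_simps)
      moreover have "(?E + h * c) *\<^sub>R mat 1 - (snd (splitting B h k) + h *\<^sub>R B) \<in> psd"
      proof -
        have "(?E *\<^sub>R mat 1 - snd (splitting B h k)) + h *\<^sub>R (c *\<^sub>R mat 1 - B) \<in> psd"
          by (intro psd_add u psd_scaleR c h0)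
        thus ?thesis by (simp add: scaleR_add_left scaleR_diff_right algebra_simps)
      qed
      ultimately show ?thesis by (rule psd_order_trans[rotated])
    qed
    have exp_step: "exp (A * (real k * h)) * (1 + h * c) * (1 + C * h) \<le> exp (A * (real (Suc k) * h))" for k
    proof -
      have "(1 + h * c) * (1 + C * h) \<le> exp (h * c) * exp (C * h)"
        using C(1) c(1) h0 exp_ge_add_one_self[of "h * c"] exp_ge_add_one_self[of "C * h"]
        by (intro mult_mono) auto
      hence "exp (A * (real k * h)) * ((1 + h * c) * (1 + C * h)) \<le> exp (A * (real k * h)) * (exp (h * c) * exp (C * h))"
        by (intro mult_left_mono) auto
      also have "\<dots> = exp (A * (real (Suc k) * h))"
        by (simp add: exp_add[symmetric] A_def algebra_simps)
      finally show ?thesis by (simp add: mult.assoc)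
    qed
    have step_le: "exp (A * (real k * h)) * (1 + h * c) \<le> exp (A * (real (Suc k) * h))" for k
    proof -
      have "exp (A * (real k * h)) * (1 + h * c) * 1 \<le> exp (A * (real k * h)) * (1 + h * c) * (1 + C * h)"
        using C(1) c(1) h0 by (intro mult_left_mono) auto
      thus ?thesis using exp_step[of k] by linarith
    qed
    have *: "exp (A * (real k * h)) *\<^sub>R mat 1 - snd (splitting B h k) \<in> psd" for k
    proof (induction k)
      case (Suc k)
      let ?l = "exp (A * (real k * h)) * (1 + h * c)"
      have l: "1 \<le> ?l"
      proof -
        have "1 * 1 \<le> ?l" using C(1) c(1) h0 by (intro mult_mono) (auto simp: A_def)
        thus ?thesis by simp
      qed
      have "?l *\<^sub>R \<psi> h (mat 1) - snd (splitting B h (Suc k)) \<in> psd"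
        using psi_upper[OF h0 _ upd[OF Suc] l] splitting_psd[OF B h0] by (simp add: psd_add psd_scaleR B h0)
      moreover have "?l *\<^sub>R ((1 + C * h) *\<^sub>R mat 1 - \<psi> h (mat 1)) \<in> psd"
        using l by (intro psd_scaleR C(3) h) simp
      hence "(?l * (1 + C * h)) *\<^sub>R mat 1 - ?l *\<^sub>R \<psi> h (mat 1) \<in> psd"
        by (simp add: scaleR_diff_right)
      ultimately have "(?l * (1 + C * h)) *\<^sub>R mat 1 - snd (splitting B h (Suc k)) \<in> psd"
        by (rule psd_order_trans)
      from psd_order_trans[OF this psd_scaled[OF exp_step]] show ?case .
    qed simp
    show ?thesis using *[of k] psd_order_trans[OF upd[OF *[of k]] psd_scaled[OF step_le]] by blast
  qed
  moreover have "A \<ge> 0" using C(1) c(1) by (simp add: A_def)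
  ultimately show ?thesis using C(2) by blast
qed

text \<open>The scalar component receives no \<open>a\<close>: the constant part of the rate factors
  out of the expectation and is restored at the end.\<close>

definition riccati_field :: "real^'d^'d \<Rightarrow> real^'d^'d \<Rightarrow> real \<times> (real^'d^'d)" where
  "riccati_field B u = riccati u + (0, B)"

lemma continuous_on_riccati_field: "continuous_on psd (riccati_field B)"
  unfolding riccati_field_def[abs_def] by (intro continuous_intros continuous_on_riccati)

text \<open>Consistency of the scheme with the Riccati field. Blocks of \<open>j\<close> steps are
  considered because the limit will be taken over time increments that do not shrink with the mesh.
  The Lipschitz bound of the first part keeps the field nearly constant along a block in the
  second.\<close>

lemma splitting_increment:
  assumes B: "B \<in> psd" and N: "0 \<le> N"
  shows "\<exists>M\<ge>0. \<exists>h2>0. (\<forall>h\<in>{0<..h2}. \<forall>k j. real (k + j) * h \<le> N \<longrightarrow>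
      norm (splitting B h (k + j) - splitting B h k) \<le> M * (real j * h))"
    and "\<epsilon> > 0 \<Longrightarrow> \<exists>\<delta>>0. \<exists>h2>0. \<forall>h\<in>{0<..h2}. \<forall>k j. real (k + j) * h \<le> N \<longrightarrow> real j * h < \<delta> \<longrightarrow>
      norm (splitting B h (k + j) - splitting B h k - (real j * h) *\<^sub>R riccati_field B (snd (splitting B h k)))
        \<le> \<epsilon> * (real j * h)"
proof -
  obtain A h0 where A: "A \<ge> 0" "h0 > 0"
    "\<And>h k. h \<in> {0..h0} \<Longrightarrow> exp (A * (real k * h)) *\<^sub>R mat 1 - snd (splitting B h k) \<in> psd"
    "\<And>h k. h \<in> {0..h0} \<Longrightarrow> exp (A * (real (Suc k) * h)) *\<^sub>R mat 1 - (snd (splitting B h k) + h *\<^sub>R B) \<in> psd"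
    using splitting_bound[OF B] by blast
  define L where "L = exp (A * N)"
  define K :: "(real^'d^'d) set" where "K = {u \<in> psd. norm u \<le> L * CARD('d)}"
  have uL: "L *\<^sub>R mat 1 - snd (splitting B h k) \<in> psd"
    if "h \<in> {0<..h0}" "real k * h \<le> N" for h k
    using psd_order_trans[OF A(3)[of h k] psd_scaled[of _ L]] that A(1) by (simp add: L_def mult_left_mono)
  have vL: "L *\<^sub>R mat 1 - (snd (splitting B h k) + h *\<^sub>R B) \<in> psd"
    if "h \<in> {0<..h0}" "real (Suc k) * h \<le> N" for h k
    using psd_order_trans[OF A(4)[of h k] psd_scaled[of _ L]] that A(1) by (simp add: L_def mult_left_mono)
  have psds: "snd (splitting B h k) \<in> psd" "snd (splitting B h k) + h *\<^sub>R B \<in> psd" if "h \<in> {0<..h0}" for h k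
    using that by (auto intro!: splitting_psd psd_add psd_scaleR B)
  have uK: "snd (splitting B h k) \<in> K" if "h \<in> {0<..h0}" "real k * h \<le> N" for h k
    unfolding K_def using norm_le_of_psd_order[OF psds(1)[OF that(1)] uL[OF that]] psds(1)[OF that(1)] by simp
  have vK: "snd (splitting B h k) + h *\<^sub>R B \<in> K" if "h \<in> {0<..h0}" "real (Suc k) * h \<le> N" for h k
    unfolding K_def using norm_le_of_psd_order[OF psds(2)[OF that(1)] vL[OF that]] psds(2)[OF that(1)] by simp
  have "K = psd \<inter> cball 0 (L * CARD('d))" by (auto simp: K_def)
  hence "compact K" using closed_Int_compact[OF closed_psd compact_cball] by simp
  moreover have cont: "continuous_on K (riccati_field B)"
    by (rule continuous_on_subset[OF continuous_on_riccati_field]) (auto simp: K_def)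
  ultimately have unif: "uniformly_continuous_on K (riccati_field B)" and "bounded (riccati_field B ` K)"
    by (auto intro: compact_uniformly_continuous compact_imp_bounded compact_continuous_image)
  then obtain M where M: "\<And>u. u \<in> K \<Longrightarrow> norm (riccati_field B u) \<le> M"
    unfolding bounded_iff by (metis image_eqI)
  \<comment> \<open>A single step: \<open>flow_increment\<close> at the shifted point
    \<open>v\<close>, then uniform continuity to replace the field at \<open>v\<close> by that at
    \<open>u\<close>.\<close>
  have step: "\<exists>h2>0. h2 \<le> h0 \<and> (\<forall>h\<in>{0<..h2}. \<forall>k. real (Suc k) * h \<le> N \<longrightarrow>
      norm (splitting B h (Suc k) - splitting B h k - h *\<^sub>R riccati_field B (snd (splitting B h k))) \<le> \<epsilon> * h)"
    if \<epsilon>: "\<epsilon> > 0" for \<epsilon>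
  proof -
    obtain h1 where h1: "h1 > 0" "\<And>h u. h \<in> {0..h1} \<Longrightarrow> u \<in> psd \<Longrightarrow> L *\<^sub>R mat 1 - u \<in> psd \<Longrightarrow>
        norm ((\<phi> h u, \<psi> h u - u) - h *\<^sub>R riccati u) \<le> \<epsilon> / 2 * h"
      using flow_increment[of "\<epsilon> / 2" L] \<epsilon> by auto
    obtain d where d: "d > 0" "\<And>u v. u \<in> K \<Longrightarrow> v \<in> K \<Longrightarrow> dist v u < d \<Longrightarrow> dist (riccati_field B v) (riccati_field B u) < \<epsilon> / 2"
      using unif \<epsilon> unfolding uniformly_continuous_on_def by (metis half_gt_zero)
    \<comment> \<open>For \<open>h \<le> h2\<close> the shift \<open>h B\<close> is shorter than
      \<open>d\<close>; the \<open>+ 1\<close> guards against \<open>B = 0\<close>.\<close>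
    define h2 where "h2 = min (min h0 h1) (d / (2 * (norm B + 1)))"
    have pos: "0 < norm B + 1" by (simp add: add_nonneg_pos)
    have h2: "h2 > 0" "h2 \<le> h0" "h2 \<le> h1" using A(2) h1(1) d(1) pos by (auto simp: h2_def)
    show ?thesis
    proof (intro exI[of _ h2] conjI h2 ballI allI impI)
      fix h k assume h: "h \<in> {0<..h2}" and k: "real (Suc k) * h \<le> N"
      define u where "u = snd (splitting B h k)"
      define v where "v = u + h *\<^sub>R B"
      have h': "h \<in> {0<..h0}" "h \<in> {0..h1}" using h h2 by auto
      have "real k * h \<le> N" using k h by (simp add: algebra_simps)
      hence K: "u \<in> K" "v \<in> K" using uK vK h' k by (auto simp: u_def v_def)
      have "norm (h *\<^sub>R B) \<le> h2 * (norm B + 1)" using h by (auto intro!: mult_mono)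
      also have "\<dots> \<le> d / (2 * (norm B + 1)) * (norm B + 1)" using pos by (intro mult_right_mono) (auto simp: h2_def)
      also have "\<dots> = d / 2" using pos by (simp add: field_simps)
      finally have "dist v u < d" using d(1) by (simp add: dist_norm v_def)
      hence 1: "norm (riccati_field B v - riccati_field B u) < \<epsilon> / 2" using d(2)[OF K] by (simp add: dist_norm)
      have 2: "norm ((\<phi> h v, \<psi> h v - v) - h *\<^sub>R riccati v) \<le> \<epsilon> / 2 * h"
        using psds(2) vL h' k by (intro h1) (auto simp: u_def v_def)
      have "splitting B h (Suc k) - splitting B h k - h *\<^sub>R riccati_field B u
          = ((\<phi> h v, \<psi> h v - v) - h *\<^sub>R riccati v) + h *\<^sub>R (riccati_field B v - riccati_field B u)"
        by (simp add: prod_eq_iff u_def[symmetric] v_def[symmetric] riccati_field_def algebra_simps)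
      also have "norm \<dots> \<le> \<epsilon> / 2 * h + h * (\<epsilon> / 2)"
        using 1 2 h by (intro norm_triangle_le add_mono) (auto intro!: mult_left_mono)
      finally show "norm (splitting B h (Suc k) - splitting B h k - h *\<^sub>R riccati_field B (snd (splitting B h k))) \<le> \<epsilon> * h"
        by (simp add: u_def)
    qed
  qed
  have M0: "0 \<le> \<bar>M\<bar> + 1" by simp
  \<comment> \<open>The crude tolerance \<open>1\<close> suffices here and produces the Lipschitz
    constant \<open>\<bar>M\<bar> + 1\<close>.\<close>
  obtain h2 where h2: "h2 > 0" "h2 \<le> h0" "\<And>h k. h \<in> {0<..h2} \<Longrightarrow> real (Suc k) * h \<le> N \<Longrightarrow>
      norm (splitting B h (Suc k) - splitting B h k - h *\<^sub>R riccati_field B (snd (splitting B h k))) \<le> 1 * h"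
    using step[of 1] by auto
  have lip: "norm (splitting B h (k + j) - splitting B h k) \<le> (\<bar>M\<bar> + 1) * (real j * h)"
    if h: "h \<in> {0<..h2}" and N: "real (k + j) * h \<le> N" for h k j
    using N
  proof (induction j)
    case (Suc j)
    have kj: "real (k + j) * h \<le> N" "real (Suc (k + j)) * h \<le> N" using Suc.prems h by (auto simp: algebra_simps)
    have "splitting B h (k + Suc j) - splitting B h k = (splitting B h (k + j) - splitting B h k)
       + h *\<^sub>R riccati_field B (snd (splitting B h (k + j)))
       + (splitting B h (Suc (k + j)) - splitting B h (k + j) - h *\<^sub>R riccati_field B (snd (splitting B h (k + j))))"
      by (simp del: splitting.simps)
    also have "norm \<dots> \<le> (\<bar>M\<bar> + 1) * (real j * h) + h * \<bar>M\<bar> + 1 * h"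
    proof (intro norm_triangle_le add_mono)
      show "norm (splitting B h (k + j) - splitting B h k) \<le> (\<bar>M\<bar> + 1) * (real j * h)" by (rule Suc.IH[OF kj(1)])
      show "norm (h *\<^sub>R riccati_field B (snd (splitting B h (k + j)))) \<le> h * \<bar>M\<bar>"
        using M[OF uK[of h "k + j"]] h h2(2) kj(1) by (auto intro!: mult_left_mono)
      show "norm (splitting B h (Suc (k + j)) - splitting B h (k + j) - h *\<^sub>R riccati_field B (snd (splitting B h (k + j)))) \<le> 1 * h"
        by (rule h2(3)[OF h kj(2)])
    qed
    also have "\<dots> = (\<bar>M\<bar> + 1) * (real (Suc j) * h)" by (simp add: algebra_simps)
    finally show ?case .
  qed simp
  show "\<exists>M\<ge>0. \<exists>h2>0. (\<forall>h\<in>{0<..h2}. \<forall>k j. real (k + j) * h \<le> N \<longrightarrow>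
      norm (splitting B h (k + j) - splitting B h k) \<le> M * (real j * h))"
    using M0 h2(1) lip by blast
  show "\<exists>\<delta>>0. \<exists>h2>0. \<forall>h\<in>{0<..h2}. \<forall>k j. real (k + j) * h \<le> N \<longrightarrow> real j * h < \<delta> \<longrightarrow>
      norm (splitting B h (k + j) - splitting B h k - (real j * h) *\<^sub>R riccati_field B (snd (splitting B h k)))
        \<le> \<epsilon> * (real j * h)" if \<epsilon>: "\<epsilon> > 0"
  proof -
    obtain h3 where h3: "h3 > 0" "\<And>h k. h \<in> {0<..h3} \<Longrightarrow> real (Suc k) * h \<le> N \<Longrightarrow>
      norm (splitting B h (Suc k) - splitting B h k - h *\<^sub>R riccati_field B (snd (splitting B h k))) \<le> \<epsilon> / 2 * h"
      using step[of "\<epsilon> / 2"] \<epsilon> by auto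
    obtain d where d: "d > 0" "\<And>u v. u \<in> K \<Longrightarrow> v \<in> K \<Longrightarrow> dist v u < d \<Longrightarrow> dist (riccati_field B v) (riccati_field B u) < \<epsilon> / 2"
      using unif \<epsilon> unfolding uniformly_continuous_on_def by (metis half_gt_zero)
    \<comment> \<open>During a block of duration below \<open>\<delta>\<close> the Lipschitz bound
      keeps the scheme within \<open>d\<close> of its start.\<close>
    define \<delta> where "\<delta> = d / (\<bar>M\<bar> + 1)"
    have pos: "0 < \<bar>M\<bar> + 1" by simp
    have \<delta>: "\<delta> > 0" using d(1) pos by (simp add: \<delta>_def)
    have main: "norm (splitting B h (k + j) - splitting B h k - (real j * h) *\<^sub>R riccati_field B (snd (splitting B h k)))
        \<le> \<epsilon> * (real j * h)"
      if h: "h \<in> {0<..min h2 h3}" and N: "real (k + j) * h \<le> N" and j: "real j * h < \<delta>" for h k j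
      using N j
    proof (induction j)
      case (Suc j)
      define u where "u = snd (splitting B h k)"
      define w where "w = snd (splitting B h (k + j))"
      have kj: "real (k + j) * h \<le> N" "real (Suc (k + j)) * h \<le> N" "real j * h < \<delta>" "real k * h \<le> N"
      proof -
        have mono: "real i * h \<le> real l * h" if "i \<le> l" for i l
          using h that by (intro mult_right_mono) auto
        show "real (k + j) * h \<le> N" "real (Suc (k + j)) * h \<le> N" "real k * h \<le> N"
          by (rule order_trans[OF mono Suc.prems(1)]; simp)+
        show "real j * h < \<delta>" by (rule le_less_trans[OF mono Suc.prems(2)]) simp
      qed
      have K: "u \<in> K" "w \<in> K" unfolding u_def w_def using h h2(2) kj by (auto intro!: uK)
      have "norm (w - u) \<le> norm (splitting B h (k + j) - splitting B h k)"
        using norm_snd_le[of "w - u" "fst (splitting B h (k + j)) - fst (splitting B h k)"]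
        by (simp add: w_def u_def minus_prod_def)
      also have "\<dots> \<le> (\<bar>M\<bar> + 1) * (real j * h)" using h kj by (intro lip) auto
      also have "\<dots> < (\<bar>M\<bar> + 1) * \<delta>" using kj(3) pos by (intro mult_strict_left_mono)
      also have "\<dots> = d" using pos by (simp add: \<delta>_def)
      finally have near: "norm (riccati_field B w - riccati_field B u) < \<epsilon> / 2" using d(2)[OF K] by (simp add: dist_norm)
      have "splitting B h (k + Suc j) - splitting B h k - (real (Suc j) * h) *\<^sub>R riccati_field B u
        = (splitting B h (k + j) - splitting B h k - (real j * h) *\<^sub>R riccati_field B u)
         + h *\<^sub>R (riccati_field B w - riccati_field B u)
         + (splitting B h (Suc (k + j)) - splitting B h (k + j) - h *\<^sub>R riccati_field B w)"
        by (simp add: algebra_simps del: splitting.simps)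
      also have "norm \<dots> \<le> \<epsilon> * (real j * h) + h * (\<epsilon> / 2) + \<epsilon> / 2 * h"
      proof (intro norm_triangle_le add_mono)
        show "norm (splitting B h (k + j) - splitting B h k - (real j * h) *\<^sub>R riccati_field B u) \<le> \<epsilon> * (real j * h)"
          unfolding u_def by (rule Suc.IH[OF kj(1,3)])
        show "norm (h *\<^sub>R (riccati_field B w - riccati_field B u)) \<le> h * (\<epsilon> / 2)" using near h by (auto intro!: mult_left_mono)
        show "norm (splitting B h (Suc (k + j)) - splitting B h (k + j) - h *\<^sub>R riccati_field B w) \<le> \<epsilon> / 2 * h"
          unfolding w_def using h by (intro h3(2) kj) auto
      qed
      also have "\<dots> = \<epsilon> * (real (Suc j) * h)" by (simp add: algebra_simps)
      finally show ?case by (simp only: u_def)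
    qed simp
    have "min h2 h3 > 0" using h2(1) h3(1) by simp
    thus ?thesis using \<delta> main by blast
  qed
qed

end

section \<open>Convergence of the discretization to a solution of the Riccati equations\<close>

text \<open>The mesh does not depend on the maturity, so one subsequence serves all of them. In
  exchange the grid misses a given time, by less than one step.\<close>

definition mesh :: "nat \<Rightarrow> real" where "mesh n = 1 / real (Suc n)"

definition steps :: "nat \<Rightarrow> real \<Rightarrow> nat" where "steps n t = nat \<lfloor>t / mesh n\<rfloor>"

lemma mesh_pos: "0 < mesh n"
  by (simp add: mesh_def)

lemma mesh_tendsto_0: "mesh \<longlonglongrightarrow> 0"
  unfolding mesh_def[abs_def] by (rule LIMSEQ_Suc[OF lim_1_over_n])

lemma steps_bounds:
  assumes "0 \<le> t"
  shows "real (steps n t) * mesh n \<le> t" "t - mesh n < real (steps n t) * mesh n"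
proof -
  have "0 \<le> t / mesh n" using assms mesh_pos[of n] by simp
  hence "real (steps n t) = real_of_int \<lfloor>t / mesh n\<rfloor>" by (simp add: steps_def)
  hence "real (steps n t) \<le> t / mesh n" "t / mesh n < real (steps n t) + 1" by linarith+
  thus "real (steps n t) * mesh n \<le> t" "t - mesh n < real (steps n t) * mesh n"
    using mesh_pos[of n] by (simp_all add: field_simps)
qed

lemma steps_mono: "s \<le> t \<Longrightarrow> steps n s \<le> steps n t"
  unfolding steps_def using mesh_pos[of n] by (intro nat_mono floor_mono divide_right_mono) auto

lemma steps_tendsto:
  assumes "0 \<le> t"
  shows "(\<lambda>n. real (steps n t) * mesh n) \<longlonglongrightarrow> t"
proof (rule tendsto_sandwich)
  show "(\<lambda>n. t - mesh n) \<longlonglongrightarrow> t" using tendsto_diff[OF tendsto_const mesh_tendsto_0, of t] by simp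
  show "\<forall>\<^sub>F n in sequentially. t - mesh n \<le> real (steps n t) * mesh n"
    by (intro always_eventually allI less_imp_le steps_bounds assms)
  show "\<forall>\<^sub>F n in sequentially. real (steps n t) * mesh n \<le> t"
    by (intro always_eventually allI steps_bounds assms)
qed (rule tendsto_const)

lemma eventually_mesh_le: "\<epsilon> > 0 \<Longrightarrow> eventually (\<lambda>n. mesh n \<in> {0<..\<epsilon>}) sequentially"
  using order_tendstoD(2)[OF mesh_tendsto_0, of \<epsilon>] mesh_pos by (auto elim!: eventually_mono)

text \<open>The hypothesis controls increments forward from \<open>s\<close> with slope
  \<open>V s\<close>. For the left derivative the increment is expanded at the earlier time and
  continuity of \<open>V\<close> moves the slope to \<open>t\<close>.\<close>

lemma has_vector_derivative_of_increment:
  fixes z V :: "real \<Rightarrow> 'a::real_normed_vector"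
  assumes inc: "\<And>\<epsilon> N. \<epsilon> > 0 \<Longrightarrow> 0 \<le> N \<Longrightarrow> \<exists>\<delta>>0. \<forall>s t. 0 \<le> s \<longrightarrow> s \<le> t \<longrightarrow> t \<le> N \<longrightarrow> t - s < \<delta> \<longrightarrow>
      norm (z t - z s - (t - s) *\<^sub>R V s) \<le> \<epsilon> * (t - s)"
    and V: "continuous_on {0..} V" and t: "0 \<le> t"
  shows "(z has_vector_derivative V t) (at t within {0..})"
  unfolding has_vector_derivative_def has_derivative_within_alt
proof (intro conjI allI impI bounded_linear_scaleR_left)
  fix e :: real assume e: "e > 0"
  obtain \<delta> where \<delta>: "\<delta> > 0" "\<And>s u. 0 \<le> s \<Longrightarrow> s \<le> u \<Longrightarrow> u \<le> t + 1 \<Longrightarrow> u - s < \<delta> \<Longrightarrow>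
      norm (z u - z s - (u - s) *\<^sub>R V s) \<le> e / 2 * (u - s)"
    using inc[of "e / 2" "t + 1"] e t by auto
  obtain d where d: "d > 0" "\<And>s. s \<in> {0..} \<Longrightarrow> dist s t < d \<Longrightarrow> dist (V s) (V t) < e / 2"
    using V t e unfolding continuous_on_iff by (metis atLeast_iff half_gt_zero)
  show "\<exists>d>0. \<forall>y\<in>{0..}. norm (y - t) < d \<longrightarrow> norm (z y - z t - (y - t) *\<^sub>R V t) \<le> e * norm (y - t)"
  proof (intro exI[of _ "min 1 (min \<delta> d)"] conjI ballI impI)
    fix y assume y: "y \<in> {0..}" "norm (y - t) < min 1 (min \<delta> d)"
    show "norm (z y - z t - (y - t) *\<^sub>R V t) \<le> e * norm (y - t)"
    proof (cases "t \<le> y")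
      case True
      have "norm (z y - z t - (y - t) *\<^sub>R V t) \<le> e / 2 * (y - t)" using True y t by (intro \<delta>) auto
      also have "\<dots> \<le> e * (y - t)" using True e by (intro mult_right_mono) auto
      finally show ?thesis using True by simp
    next
      case False
      have 1: "norm (z t - z y - (t - y) *\<^sub>R V y) \<le> e / 2 * (t - y)" using False y t by (intro \<delta>) auto
      have "dist (V y) (V t) < e / 2" using y by (intro d) (auto simp: dist_norm)
      hence 2: "norm ((t - y) *\<^sub>R (V y - V t)) \<le> (t - y) * (e / 2)"
        using False by (simp add: dist_norm)
      \<comment> \<open>Splits into the forward error started at \<open>y\<close> and the change of
        slope between \<open>y\<close> and \<open>t\<close>.\<close>
      have "z y - z t - (y - t) *\<^sub>R V t = - ((z t - z y - (t - y) *\<^sub>R V y) + (t - y) *\<^sub>R (V y - V t))"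
        by (simp add: algebra_simps)
      also have "norm \<dots> \<le> e / 2 * (t - y) + (t - y) * (e / 2)"
        unfolding norm_minus_cancel using 1 2 by (intro norm_triangle_le add_mono)
      also have "\<dots> = e * norm (y - t)" using False by (simp add: algebra_simps)
      finally show ?thesis .
    qed
  qed (use \<delta> d in auto)
qed

text \<open>A diagonal argument for uniformly bounded functions, applied after dividing the values
  at each point by a bound for that point.\<close>

lemma pointwise_convergent_subsequence:
  fixes f :: "nat \<Rightarrow> 'a \<Rightarrow> 'b::{real_normed_vector,heine_borel}"
  assumes "countable S" and bdd: "\<And>x. x \<in> S \<Longrightarrow> Bseq (\<lambda>n. f n x)"
  obtains r :: "nat \<Rightarrow> nat" where "strict_mono r" "\<And>x. x \<in> S \<Longrightarrow> convergent (\<lambda>n. f (r n) x)"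
proof -
  have "\<forall>x\<in>S. \<exists>K>0. \<forall>n. norm (f n x) \<le> K" using bdd unfolding Bseq_def by blast
  then obtain K where K: "\<And>x. x \<in> S \<Longrightarrow> K x > 0" "\<And>x n. x \<in> S \<Longrightarrow> norm (f n x) \<le> K x" by metis
  have "norm (f n x /\<^sub>R K x) \<le> 1" if "x \<in> S" for n x
    using K(1)[OF that] K(2)[OF that, of n] by (simp add: field_simps)
  then obtain r where r: "strict_mono (r :: nat \<Rightarrow> nat)" "\<And>x. x \<in> S \<Longrightarrow> \<exists>l. (\<lambda>n. f (r n) x /\<^sub>R K x) \<longlonglongrightarrow> l"
    using function_convergent_subsequence[OF assms(1), of "\<lambda>n x. f n x /\<^sub>R K x" 1] by metis
  have "convergent (\<lambda>n. f (r n) x)" if x: "x \<in> S" for x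
  proof -
    obtain l where "(\<lambda>n. f (r n) x /\<^sub>R K x) \<longlonglongrightarrow> l" using r(2)[OF x] by blast
    hence "(\<lambda>n. K x *\<^sub>R (f (r n) x /\<^sub>R K x)) \<longlonglongrightarrow> K x *\<^sub>R l" by (intro tendsto_intros)
    thus ?thesis using K(1)[OF x] by (auto simp: convergent_def)
  qed
  thus ?thesis using r(1) that by blast
qed

context affine_semigroup
begin

definition splitting_at :: "real^'d^'d \<Rightarrow> nat \<Rightarrow> real \<Rightarrow> real \<times> (real^'d^'d)" where
  "splitting_at B n t = splitting B (mesh n) (steps n t)"

text \<open>The approximations are step functions in time, so equicontinuity holds only up to the
  extra \<open>mesh n\<close> from rounding the two times to the grid.\<close>

lemma splitting_at_lipschitz:
  assumes B: "B \<in> psd" and N: "0 \<le> N"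
  shows "\<exists>M\<ge>0. \<forall>\<^sub>F n in sequentially. \<forall>s t. 0 \<le> s \<longrightarrow> s \<le> t \<longrightarrow> t \<le> N \<longrightarrow>
      norm (splitting_at B n t - splitting_at B n s) \<le> M * (t - s + mesh n)"
proof -
  obtain M h2 where M: "M \<ge> 0" "h2 > 0" "\<And>h k j. h \<in> {0<..h2} \<Longrightarrow> real (k + j) * h \<le> N \<Longrightarrow>
      norm (splitting B h (k + j) - splitting B h k) \<le> M * (real j * h)"
    using splitting_increment(1)[OF B N] by blast
  have "\<forall>\<^sub>F n in sequentially. \<forall>s t. 0 \<le> s \<longrightarrow> s \<le> t \<longrightarrow> t \<le> N \<longrightarrow>
      norm (splitting_at B n t - splitting_at B n s) \<le> M * (t - s + mesh n)"
    using eventually_mesh_le[OF M(2)]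
  proof eventually_elim
    case (elim n)
    show ?case
    proof (intro allI impI)
      fix s t assume st: "0 \<le> s" "s \<le> t" "t \<le> N"
      define k where "k = steps n s"
      define j where "j = steps n t - k"
      have kj: "k + j = steps n t" using steps_mono[OF st(2), of n] by (simp add: k_def j_def)
      have t0: "0 \<le> t" using st by simp
      have "norm (splitting_at B n t - splitting_at B n s) \<le> M * (real j * mesh n)"
        unfolding splitting_at_def k_def[symmetric] kj[symmetric]
        using steps_bounds(1)[OF t0, of n] st(3) by (intro M(3) elim) (simp add: kj)
      also have "real j * mesh n = real (steps n t) * mesh n - real (steps n s) * mesh n"
        using kj by (simp add: k_def[symmetric] left_diff_distrib[symmetric])
      also have "\<dots> \<le> t - s + mesh n"
        using steps_bounds(1)[OF t0, of n] steps_bounds(2)[OF st(1), of n] by linarith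
      finally show "norm (splitting_at B n t - splitting_at B n s) \<le> M * (t - s + mesh n)"
        using M(1) by (simp add: mult_left_mono)
    qed
  qed
  thus ?thesis using M(1) by blast
qed

text \<open>Diagonal selection on the nonnegative rationals; the asymptotic Lipschitz bound then
  transfers the Cauchy property from a nearby rational to every time.\<close>

lemma splitting_at_subsequence:
  assumes B: "B \<in> psd"
  obtains r :: "nat \<Rightarrow> nat" where "strict_mono r"
    "\<And>t. 0 \<le> t \<Longrightarrow> convergent (\<lambda>n. splitting_at B (r n) t)"
proof -
  have steps0: "splitting_at B n 0 = 0" for n by (simp add: splitting_at_def steps_def zero_prod_def)
  have bdd: "Bseq (\<lambda>n. splitting_at B n t)" if t: "0 \<le> t" for t
  proof -
    obtain M where M: "M \<ge> 0" "\<forall>\<^sub>F n in sequentially. \<forall>s t'. 0 \<le> s \<longrightarrow> s \<le> t' \<longrightarrow> t' \<le> t \<longrightarrow>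
      norm (splitting_at B n t' - splitting_at B n s) \<le> M * (t' - s + mesh n)"
      using splitting_at_lipschitz[OF B t] by blast
    have "\<forall>\<^sub>F n in sequentially. norm (splitting_at B n t) \<le> M * (t + 1)"
      using M(2)
    proof eventually_elim
      case (elim n)
      hence "norm (splitting_at B n t - splitting_at B n 0) \<le> M * (t - 0 + mesh n)" using t by blast
      also have "\<dots> \<le> M * (t + 1)" using M(1) by (intro mult_left_mono) (auto simp: mesh_def)
      finally show ?case by (simp add: steps0)
    qed
    thus ?thesis by (rule BfunI)
  qed
  obtain r where r: "strict_mono (r :: nat \<Rightarrow> nat)"
    "\<And>q. q \<in> \<rat> \<inter> {0..} \<Longrightarrow> convergent (\<lambda>n. splitting_at B (r n) q)"
    using pointwise_convergent_subsequence[of "\<rat> \<inter> {0..}" "splitting_at B"] bdd countable_rat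
    by (metis IntE atLeast_iff countable_Int1)
  have "Cauchy (\<lambda>n. splitting_at B (r n) t)" if t: "0 \<le> t" for t
  proof (rule metric_CauchyI)
    fix e :: real assume e: "e > 0"
    obtain M where M: "M \<ge> 0" "\<forall>\<^sub>F n in sequentially. \<forall>s t'. 0 \<le> s \<longrightarrow> s \<le> t' \<longrightarrow> t' \<le> t + 1 \<longrightarrow>
      norm (splitting_at B n t' - splitting_at B n s) \<le> M * (t' - s + mesh n)"
      using splitting_at_lipschitz[OF B, of "t + 1"] t by auto
    \<comment> \<open>With rational distance and mesh both at most \<open>\<eta>\<close>, the
      Lipschitz bound gives at most \<open>e / 4\<close>; the cap \<open>1\<close> keeps the
      rational within the horizon \<open>t + 1\<close>.\<close>
    define \<eta> where "\<eta> = min 1 (e / (8 * (M + 1)))"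
    have \<eta>: "\<eta> > 0" "\<eta> \<le> 1" using e M(1) by (auto simp: \<eta>_def)
    have "M * \<eta> \<le> M * (e / (8 * (M + 1)))" using M(1) by (intro mult_left_mono) (auto simp: \<eta>_def)
    also have "\<dots> \<le> e / 8" using M(1) e by (simp add: field_simps)
    finally have M\<eta>: "M * \<eta> \<le> e / 8" .
    obtain q where q: "q \<in> \<rat>" "t < q" "q < t + \<eta>" using Rats_dense_in_real[of t "t + \<eta>"] \<eta> by auto
    have "Cauchy (\<lambda>n. splitting_at B (r n) q)" using r(2)[of q] q t by (auto intro: convergent_Cauchy)
    then obtain n1 where n1: "\<And>i j. i \<ge> n1 \<Longrightarrow> j \<ge> n1 \<Longrightarrow> dist (splitting_at B (r i) q) (splitting_at B (r j) q) < e / 4"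
      using metric_CauchyD[of _ "e / 4"] e by (metis divide_pos_pos zero_less_numeral)
    obtain n2 where n2: "\<And>n. n \<ge> n2 \<Longrightarrow> norm (splitting_at B n q - splitting_at B n t) \<le> M * (q - t + mesh n)"
    proof -
      have "\<forall>\<^sub>F n in sequentially. norm (splitting_at B n q - splitting_at B n t) \<le> M * (q - t + mesh n)"
        using M(2) by eventually_elim (use q \<eta> t in auto)
      thus ?thesis using that unfolding eventually_sequentially by blast
    qed
    obtain n3 where n3: "\<And>n. n \<ge> n3 \<Longrightarrow> mesh n \<le> \<eta>"
      using eventually_mesh_le[OF \<eta>(1)] unfolding eventually_sequentially by auto
    have close: "dist (splitting_at B (r n) t) (splitting_at B (r n) q) \<le> e / 4" if n: "n \<ge> max n2 n3" for n
    proof -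
      have rn: "r n \<ge> n2" "r n \<ge> n3" using seq_suble[OF r(1), of n] n by auto
      have "dist (splitting_at B (r n) t) (splitting_at B (r n) q) \<le> M * (q - t + mesh (r n))"
        using n2[OF rn(1)] by (simp add: dist_norm norm_minus_commute)
      also have "\<dots> \<le> M * (\<eta> + \<eta>)" using M(1) q n3[OF rn(2)] by (intro mult_left_mono) auto
      also have "\<dots> \<le> e / 4" using M\<eta> by (simp add: distrib_left)
      finally show ?thesis .
    qed
    show "\<exists>n0. \<forall>i\<ge>n0. \<forall>j\<ge>n0. dist (splitting_at B (r i) t) (splitting_at B (r j) t) < e"
    proof (intro exI allI impI)
      fix i j assume ij: "i \<ge> max n1 (max n2 n3)" "j \<ge> max n1 (max n2 n3)"
      have "dist (splitting_at B (r i) t) (splitting_at B (r j) t)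
         \<le> dist (splitting_at B (r i) t) (splitting_at B (r i) q) + dist (splitting_at B (r i) q) (splitting_at B (r j) q)
           + dist (splitting_at B (r j) t) (splitting_at B (r j) q)"
        using dist_triangle[of "splitting_at B (r i) t" "splitting_at B (r j) t" "splitting_at B (r i) q"]
          dist_triangle[of "splitting_at B (r i) q" "splitting_at B (r j) t" "splitting_at B (r j) q"]
          dist_commute[of "splitting_at B (r j) q" "splitting_at B (r j) t"] by linarith
      also have "\<dots> < e / 4 + e / 4 + e / 4 + e / 4"
        using close[of i] close[of j] n1[of i j] ij e by auto
      finally show "dist (splitting_at B (r i) t) (splitting_at B (r j) t) < e" by simp
    qed
  qed
  hence "convergent (\<lambda>n. splitting_at B (r n) t)" if "0 \<le> t" for t
    using that Cauchy_convergent_iff by blast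
  thus ?thesis using r(1) that by blast
qed

text \<open>The number of grid steps between \<open>s\<close> and \<open>t\<close> times the mesh
  tends to \<open>t - s\<close>, so strictness in \<open>t - s < \<delta>\<close> makes the blocks
  eventually admissible. The field converges because limits stay in the closed cone, where it is
  continuous.\<close>

lemma splitting_limit_increment:
  assumes B: "B \<in> psd" and r: "strict_mono r"
    and lim: "\<And>t. 0 \<le> t \<Longrightarrow> (\<lambda>n. splitting_at B (r n) t) \<longlonglongrightarrow> z t"
    and \<epsilon>: "\<epsilon> > 0" and N: "0 \<le> N"
  shows "\<exists>\<delta>>0. \<forall>s t. 0 \<le> s \<longrightarrow> s \<le> t \<longrightarrow> t \<le> N \<longrightarrow> t - s < \<delta> \<longrightarrow>
    norm (z t - z s - (t - s) *\<^sub>R riccati_field B (snd (z s))) \<le> \<epsilon> * (t - s)"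
proof -
  obtain \<delta> h2 where d: "\<delta> > 0" "h2 > 0" "\<And>h k j. h \<in> {0<..h2} \<Longrightarrow> real (k + j) * h \<le> N \<Longrightarrow> real j * h < \<delta> \<Longrightarrow>
      norm (splitting B h (k + j) - splitting B h k - (real j * h) *\<^sub>R riccati_field B (snd (splitting B h k)))
        \<le> \<epsilon> * (real j * h)"
    using splitting_increment(2)[OF B N \<epsilon>] by blast
  show ?thesis
  proof (intro exI[of _ \<delta>] conjI d allI impI)
    fix s t assume st: "0 \<le> s" "s \<le> t" "t \<le> N" "t - s < \<delta>"
    have t0: "0 \<le> t" using st by simp
    let ?D = "\<lambda>n. real (steps (r n) t) * mesh (r n) - real (steps (r n) s) * mesh (r n)"
    have D: "?D \<longlonglongrightarrow> t - s"
      using LIMSEQ_subseq_LIMSEQ[OF steps_tendsto[OF t0] r] LIMSEQ_subseq_LIMSEQ[OF steps_tendsto[OF st(1)] r]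
      unfolding o_def by (intro tendsto_diff)
    have psd: "snd (splitting_at B (r n) s) \<in> psd" for n
      unfolding splitting_at_def by (intro splitting_psd B less_imp_le mesh_pos)
    have lim_s: "(\<lambda>n. snd (splitting_at B (r n) s)) \<longlonglongrightarrow> snd (z s)" by (intro tendsto_snd lim st)
    have "snd (z s) \<in> psd" using closed_sequentially[OF closed_psd _ lim_s] psd by blast
    hence "(\<lambda>n. riccati_field B (snd (splitting_at B (r n) s))) \<longlonglongrightarrow> riccati_field B (snd (z s))"
      by (rule continuous_on_tendsto_compose[OF continuous_on_riccati_field lim_s]) (simp add: psd)
    hence "(\<lambda>n. norm (splitting_at B (r n) t - splitting_at B (r n) s - ?D n *\<^sub>R riccati_field B (snd (splitting_at B (r n) s))))
       \<longlonglongrightarrow> norm (z t - z s - (t - s) *\<^sub>R riccati_field B (snd (z s)))"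
      by (intro tendsto_norm tendsto_diff tendsto_scaleR lim D t0 st) 
    moreover have "(\<lambda>n. \<epsilon> * ?D n) \<longlonglongrightarrow> \<epsilon> * (t - s)" by (intro tendsto_mult tendsto_const D)
    moreover have "\<forall>\<^sub>F n in sequentially. norm (splitting_at B (r n) t - splitting_at B (r n) s
        - ?D n *\<^sub>R riccati_field B (snd (splitting_at B (r n) s))) \<le> \<epsilon> * ?D n"
    proof -
      have "\<forall>\<^sub>F n in sequentially. ?D n < \<delta>" by (rule order_tendstoD(2)[OF D st(4)])
      moreover have "\<forall>\<^sub>F n in sequentially. mesh (r n) \<in> {0<..h2}"
        by (rule eventually_subseq[OF r eventually_mesh_le[OF d(2)]])
      ultimately show ?thesis
      proof eventually_elim
        case (elim n)
        define k where "k = steps (r n) s"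
        define j where "j = steps (r n) t - k"
        have kj: "k + j = steps (r n) t" using steps_mono[OF st(2), of "r n"] by (simp add: k_def j_def)
        have D: "?D n = real j * mesh (r n)"
          using kj by (simp add: k_def[symmetric] left_diff_distrib[symmetric])
        have "real (k + j) * mesh (r n) \<le> N"
          using steps_bounds(1)[OF t0, of "r n"] st(3) by (simp only: kj)
        from d(3)[OF elim(2) this] elim(1) D show ?case
          unfolding D splitting_at_def k_def[symmetric] kj by simp
      qed
    qed
    ultimately show "norm (z t - z s - (t - s) *\<^sub>R riccati_field B (snd (z s))) \<le> \<epsilon> * (t - s)"
      by - (rule tendsto_le[OF sequentially_bot])
  qed
qed

text \<open>The subsequence \<open>r\<close> is delivered together with \<open>z\<close>: as
  solutions may fail to be unique, the price has to be computed as a limit along that very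
  subsequence.\<close>

theorem riccati_solution:
  assumes B: "B \<in> psd"
  obtains z r where "strict_mono r" "z 0 = 0" "\<And>t. 0 \<le> t \<Longrightarrow> snd (z t) \<in> psd"
    "\<And>t. 0 \<le> t \<Longrightarrow> (\<lambda>n. splitting_at B (r n) t) \<longlonglongrightarrow> z t"
    "\<And>t. 0 \<le> t \<Longrightarrow> (z has_vector_derivative riccati_field B (snd (z t))) (at t within {0..})"
proof -
  obtain r where r: "strict_mono (r :: nat \<Rightarrow> nat)"
    "\<And>t. 0 \<le> t \<Longrightarrow> convergent (\<lambda>n. splitting_at B (r n) t)"
    using splitting_at_subsequence[OF B] by blast
  define z where "z t = lim (\<lambda>n. splitting_at B (r n) t)" for t
  have lim: "(\<lambda>n. splitting_at B (r n) t) \<longlonglongrightarrow> z t" if "0 \<le> t" for t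
    unfolding z_def using r(2)[OF that] by (simp add: convergent_LIMSEQ_iff)
  have z0: "z 0 = 0"
    using LIMSEQ_unique[OF lim[of 0]] by (simp add: splitting_at_def steps_def zero_prod_def)
  have psd: "snd (z t) \<in> psd" if t: "0 \<le> t" for t
  proof -
    have "snd (splitting_at B (r n) t) \<in> psd" for n
      unfolding splitting_at_def by (intro splitting_psd B less_imp_le mesh_pos)
    thus ?thesis using closed_sequentially[OF closed_psd _ tendsto_snd[OF lim[OF t]]] by blast
  qed
  note inc = splitting_limit_increment[OF B r(1) lim]
  \<comment> \<open>The rounding term vanishes in the limit, so \<open>z\<close> is locally
    Lipschitz; the differentiation lemma needs the field to be continuous along
    \<open>z\<close>.\<close>
  have cont: "continuous_on {0..} z"
    unfolding continuous_on_sequentially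
  proof (intro allI ballI impI, elim conjE)
    fix x :: "nat \<Rightarrow> real" and t assume t: "t \<in> {0..}" and x: "\<forall>n. x n \<in> {0..}" "x \<longlonglongrightarrow> t"
    have t0: "0 \<le> t" using t by simp
    obtain M where M: "M \<ge> 0" "\<forall>\<^sub>F n in sequentially. \<forall>s t'. 0 \<le> s \<longrightarrow> s \<le> t' \<longrightarrow> t' \<le> t + 1 \<longrightarrow>
      norm (splitting_at B n t' - splitting_at B n s) \<le> M * (t' - s + mesh n)"
      using splitting_at_lipschitz[OF B, of "t + 1"] t0 by auto
    have lip: "norm (z v - z u) \<le> M * (v - u)" if uv: "0 \<le> u" "u \<le> v" "v \<le> t + 1" for u v
    proof (rule tendsto_le[OF sequentially_bot])
      have v0: "0 \<le> v" using uv by simp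
      show "(\<lambda>n. norm (splitting_at B (r n) v - splitting_at B (r n) u)) \<longlonglongrightarrow> norm (z v - z u)"
        by (intro tendsto_intros lim uv v0)
      have "(\<lambda>n. M * (v - u + mesh (r n))) \<longlonglongrightarrow> M * (v - u + 0)"
        using LIMSEQ_subseq_LIMSEQ[OF mesh_tendsto_0 r(1)] unfolding o_def by (intro tendsto_intros)
      thus "(\<lambda>n. M * (v - u + mesh (r n))) \<longlonglongrightarrow> M * (v - u)" by simp
      show "\<forall>\<^sub>F n in sequentially. norm (splitting_at B (r n) v - splitting_at B (r n) u) \<le> M * (v - u + mesh (r n))"
        using eventually_subseq[OF r(1) M(2)] by eventually_elim (use uv in auto)
    qed
    have lip': "dist (z v) (z t) \<le> M * \<bar>v - t\<bar>" if "0 \<le> v" "v \<le> t + 1" for v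
      using lip[of v t] lip[of t v] that t0 by (cases "v \<le> t") (auto simp: dist_norm norm_minus_commute)
    have "(\<lambda>n. dist (z (x n)) (z t)) \<longlonglongrightarrow> 0"
    proof (rule tendsto_sandwich[OF _ _ tendsto_const])
      have "(\<lambda>n. M * \<bar>x n - t\<bar>) \<longlonglongrightarrow> M * \<bar>t - t\<bar>" by (intro tendsto_intros x)
      thus "(\<lambda>n. M * \<bar>x n - t\<bar>) \<longlonglongrightarrow> 0" by simp
      have "\<forall>\<^sub>F n in sequentially. x n < t + 1" by (rule order_tendstoD(2)[OF x(2)]) simp
      thus "\<forall>\<^sub>F n in sequentially. dist (z (x n)) (z t) \<le> M * \<bar>x n - t\<bar>"
        by eventually_elim (use x(1) in \<open>auto intro!: lip'\<close>)
    qed simp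
    thus "(z \<circ> x) \<longlonglongrightarrow> z t" unfolding o_def by (rule tendsto_dist_iff[THEN iffD2])
  qed
  have "continuous_on {0..} (\<lambda>t. riccati_field B (snd (z t)))"
    using psd by (intro continuous_on_compose2[OF continuous_on_riccati_field] continuous_intros cont) auto
  from has_vector_derivative_of_increment[of z "\<lambda>t. riccati_field B (snd (z t))", OF inc this]
  have "(z has_vector_derivative riccati_field B (snd (z t))) (at t within {0..})" if "0 \<le> t" for t
    using that by blast
  thus ?thesis using that r(1) z0 psd lim by blast
qed

end

section \<open>The affine process under the pricing measure\<close>

locale affine_process_semigroup = affine_semigroup chi \<alpha> b \<beta> m \<mu> p \<phi> \<psi>
  for chi :: "real^'d^'d \<Rightarrow> real^'d^'d" and \<alpha> b :: "real^'d^'d"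
    and \<beta> :: "'d \<Rightarrow> 'd \<Rightarrow> real^'d^'d"
    and m :: "(real^'d^'d) measure" and \<mu> :: "(real^'d^'d) set \<Rightarrow> real^'d^'d"
    and p :: "real \<Rightarrow> real^'d^'d \<Rightarrow> (real^'d^'d) measure"
    and \<phi> :: "real \<Rightarrow> real^'d^'d \<Rightarrow> real" and \<psi> :: "real \<Rightarrow> real^'d^'d \<Rightarrow> real^'d^'d" +
  fixes Q :: "'w measure" and \<F> :: "real \<Rightarrow> 'w measure" and X :: "real \<Rightarrow> 'w \<Rightarrow> real^'d^'d"
  assumes prob: "prob_space Q"
    and usual: "usual_conditions Q \<F>"
    and markov: "markov_process Q \<F> p X"
    and joint: "jointly_measurable Q X"
begin

sublocale prob_space Q by (rule prob)

section \<open>Measurability and integrability for the process\<close>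

lemma subalgebra_filtration: "0 \<le> t \<Longrightarrow> subalgebra Q (\<F> t)"
  using usual by (simp add: usual_conditions_def)

lemma filtration_mono: "0 \<le> s \<Longrightarrow> s \<le> t \<Longrightarrow> subalgebra (\<F> t) (\<F> s)"
proof -
  assume st: "0 \<le> s" "s \<le> t"
  have "sets (\<F> s) \<subseteq> sets (\<F> t)" using usual st unfolding usual_conditions_def by blast
  thus ?thesis
    using subalgebra_filtration[of s] subalgebra_filtration[of t] st by (simp add: subalgebra_def)
qed

lemma X_measurable_filtration: "0 \<le> t \<Longrightarrow> X t \<in> measurable (\<F> t) psd_space"
  using markov by (simp add: markov_process_def)

lemma X_measurable_psd: "0 \<le> t \<Longrightarrow> X t \<in> measurable Q psd_space"
  using measurable_from_subalg[OF subalgebra_filtration X_measurable_filtration] by blast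

lemma X_psd: "0 \<le> t \<Longrightarrow> \<omega> \<in> space Q \<Longrightarrow> X t \<omega> \<in> psd"
  using measurable_space[OF X_measurable_psd, of t \<omega>] by simp

lemma psd_space_id: "(\<lambda>x. x) \<in> borel_measurable psd_space"
  by (rule borel_measurable_psd_spaceI) (rule continuous_on_id)

lemma X_measurable_filtration_borel: "0 \<le> t \<Longrightarrow> X t \<in> borel_measurable (\<F> t)"
  using measurable_compose[OF X_measurable_filtration psd_space_id] by simp

lemma X_measurable_filtration_le: "0 \<le> s \<Longrightarrow> s \<le> t \<Longrightarrow> X s \<in> borel_measurable (\<F> t)"
  using measurable_from_subalg[OF filtration_mono X_measurable_filtration_borel] by blast

lemma X_measurable: "0 \<le> t \<Longrightarrow> X t \<in> borel_measurable Q"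
  using measurable_compose[OF X_measurable_psd psd_space_id] by simp

lemma trace_X_measurable: "0 \<le> t \<Longrightarrow> (\<lambda>\<omega>. trace (X t \<omega>)) \<in> borel_measurable Q"
  using borel_measurable_trace_mult[OF borel_measurable_const X_measurable, of t "mat 1"] by simp

lemma integrable_bounded:
  fixes f :: "'w \<Rightarrow> real"
  assumes "f \<in> borel_measurable Q" "\<And>\<omega>. \<omega> \<in> space Q \<Longrightarrow> \<bar>f \<omega>\<bar> \<le> C"
  shows "integrable Q f"
  by (rule integrable_const_bound[where B = C]) (auto intro!: AE_I2 assms(2) assms(1))

lemma integrable_indicator_bounded:
  fixes f :: "'w \<Rightarrow> real"
  assumes "A \<in> events" "f \<in> borel_measurable Q" "\<And>\<omega>. \<omega> \<in> space Q \<Longrightarrow> \<bar>f \<omega>\<bar> \<le> C"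
  shows "integrable Q (\<lambda>\<omega>. indicator A \<omega> * f \<omega>)"
  using integrable_mult_indicator[OF assms(1) integrable_bounded[OF assms(2,3)]] by simp

text \<open>The weight \<open>G\<close> will carry an indicator of the past together with discount
  factors already accumulated, so that the Markov property can be applied one step at a
  time.\<close>

lemma expectation_markov:
  assumes s: "0 \<le> s" and t: "0 \<le> t" and u: "u \<in> psd" and G: "G \<in> borel_measurable (\<F> s)"
    and bound: "\<And>\<omega>. \<omega> \<in> space Q \<Longrightarrow> \<bar>G \<omega>\<bar> \<le> C"
  shows "expectation (\<lambda>\<omega>. G \<omega> * exp_trace u (X (s + t) \<omega>))
    = expectation (\<lambda>\<omega>. G \<omega> * exp (- \<phi> t u - trace (\<psi> t u ** X s \<omega>)))"
proof -
  interpret S: finite_measure_subalgebra Q "\<F> s"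
    by unfold_locales (rule subalgebra_filtration[OF s])
  have st: "0 \<le> s + t" using s t by simp
  have GQ: "G \<in> borel_measurable Q" by (rule measurable_from_subalg[OF subalgebra_filtration[OF s] G])
  have e1: "(\<lambda>\<omega>. exp_trace u (X (s + t) \<omega>)) \<in> borel_measurable Q"
    using X_measurable[OF st] by measurable
  have "expectation (\<lambda>\<omega>. G \<omega> * exp_trace u (X (s + t) \<omega>))
      = expectation (\<lambda>\<omega>. G \<omega> * real_cond_exp Q (\<F> s) (\<lambda>\<omega>. exp_trace u (X (s + t) \<omega>)) \<omega>)"
  proof (rule S.real_cond_exp_intg(2)[symmetric, OF _ G e1])
    show "integrable Q (\<lambda>\<omega>. G \<omega> * exp_trace u (X (s + t) \<omega>))"
    proof (rule integrable_bounded[where C = C])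
      fix \<omega> assume \<omega>: "\<omega> \<in> space Q"
      have "\<bar>G \<omega> * exp_trace u (X (s + t) \<omega>)\<bar> \<le> \<bar>G \<omega>\<bar> * 1"
        unfolding abs_mult using exp_trace_le_1[OF u X_psd[OF st \<omega>]] by (intro mult_left_mono) auto
      thus "\<bar>G \<omega> * exp_trace u (X (s + t) \<omega>)\<bar> \<le> C" using bound[OF \<omega>] by simp
    qed (use GQ e1 in measurable)
  qed
  also have "\<dots> = expectation (\<lambda>\<omega>. G \<omega> * exp (- \<phi> t u - trace (\<psi> t u ** X s \<omega>)))"
  proof (rule integral_cong_AE)
    have bd: "bounded (exp_trace u ` psd)"
      unfolding bounded_iff using exp_trace_le_1[OF u] by (intro exI[of _ 1]) auto
    have mk: "\<forall>s t. 0 \<le> s \<longrightarrow> s \<le> t \<longrightarrow> (\<forall>f. f \<in> borel_measurable psd_space \<longrightarrow> bounded (f ` psd) \<longrightarrow>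
        (AE \<omega> in Q. real_cond_exp Q (\<F> s) (\<lambda>\<omega>. f (X t \<omega>)) \<omega> = (LINT \<xi>|p (t - s) (X s \<omega>). f \<xi>)))"
      using markov unfolding markov_process_def by (elim conjE)
    have "AE \<omega> in Q. real_cond_exp Q (\<F> s) (\<lambda>\<omega>. exp_trace u (X (s + t) \<omega>)) \<omega>
        = (LINT \<xi>|p (s + t - s) (X s \<omega>). exp_trace u \<xi>)"
      by (rule mk[rule_format, OF s _ exp_trace_measurable bd]) (simp add: t)
    hence "AE \<omega> in Q. real_cond_exp Q (\<F> s) (\<lambda>\<omega>. exp_trace u (X (s + t) \<omega>)) \<omega>
        = (LINT \<xi>|p t (X s \<omega>). exp_trace u \<xi>)" by simp
    moreover have "AE \<omega> in Q. (LINT \<xi>|p t (X s \<omega>). exp_trace u \<xi>) = exp (- \<phi> t u - trace (\<psi> t u ** X s \<omega>))"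
      by (intro AE_I2 transform t u X_psd s)
    ultimately show "AE \<omega> in Q. G \<omega> * real_cond_exp Q (\<F> s) (\<lambda>\<omega>. exp_trace u (X (s + t) \<omega>)) \<omega>
        = G \<omega> * exp (- \<phi> t u - trace (\<psi> t u ** X s \<omega>))"
      by eventually_elim simp
    show "(\<lambda>\<omega>. G \<omega> * real_cond_exp Q (\<F> s) (\<lambda>\<omega>. exp_trace u (X (s + t) \<omega>)) \<omega>) \<in> borel_measurable Q"
      using GQ borel_measurable_cond_exp2 by measurable
    show "(\<lambda>\<omega>. G \<omega> * exp (- \<phi> t u - trace (\<psi> t u ** X s \<omega>))) \<in> borel_measurable Q"
      using GQ X_measurable[OF s] by measurable
  qed
  finally show ?thesis .
qed

text \<open>The earliest discount factor is absorbed into \<open>G\<close>, the induction hypothesis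
  is used from \<open>t + h\<close> on, and the Markov property leads back to \<open>t\<close>.
  Hence \<open>t\<close> and \<open>G\<close> are generalized, and the sum is over right
  endpoints.\<close>

lemma expectation_splitting:
  assumes B: "B \<in> psd" and h: "0 < h" and t: "0 \<le> t" and G: "G \<in> borel_measurable (\<F> t)"
    and bound: "\<And>\<omega>. \<omega> \<in> space Q \<Longrightarrow> \<bar>G \<omega>\<bar> \<le> C"
  shows "expectation (\<lambda>\<omega>. G \<omega> * exp (- (h * (\<Sum>j<k. trace (B ** X (t + real (Suc j) * h) \<omega>)))))
    = expectation (\<lambda>\<omega>. G \<omega> * exp (- fst (splitting B h k) - trace (snd (splitting B h k) ** X t \<omega>)))"
  using t G bound
proof (induction k arbitrary: t G)
  case (Suc k)
  let ?u = "snd (splitting B h k)"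
  have th: "0 \<le> t + h" using Suc.prems(1) h by simp
  have up: "?u \<in> psd" "?u + h *\<^sub>R B \<in> psd" using B h by (auto intro!: psd_add psd_scaleR splitting_psd)
  \<comment> \<open>Measurable at time \<open>t + h\<close>; after the induction hypothesis its
    discount factor shifts the exponent by \<open>h B\<close>, which reproduces the recursion of
    \<open>splitting\<close>.\<close>
  define G' where "G' \<omega> = G \<omega> * exp (- (h * trace (B ** X (t + h) \<omega>)))" for \<omega>
  have G': "G' \<in> borel_measurable (\<F> (t + h))"
  proof -
    have "G \<in> borel_measurable (\<F> (t + h))"
      by (rule measurable_from_subalg[OF filtration_mono Suc.prems(2)]) (use h Suc.prems(1) in auto)
    thus ?thesis unfolding G'_def[abs_def] using X_measurable_filtration_borel[OF th] by measurable
  qed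
  have G'_bound: "\<bar>G' \<omega>\<bar> \<le> C" if \<omega>: "\<omega> \<in> space Q" for \<omega>
  proof -
    have "\<bar>G' \<omega>\<bar> \<le> \<bar>G \<omega>\<bar> * 1"
      unfolding G'_def abs_mult using trace_mult_psd_nonneg[OF B X_psd[OF th \<omega>]] h
      by (intro mult_left_mono) auto
    thus ?thesis using Suc.prems(3)[OF \<omega>] by simp
  qed
  have "expectation (\<lambda>\<omega>. G \<omega> * exp (- (h * (\<Sum>j<Suc k. trace (B ** X (t + real (Suc j) * h) \<omega>)))))
      = expectation (\<lambda>\<omega>. G' \<omega> * exp (- (h * (\<Sum>j<k. trace (B ** X ((t + h) + real (Suc j) * h) \<omega>)))))"
  proof (rule Bochner_Integration.integral_cong[OF refl])
    fix \<omega>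
    have "(\<Sum>j<Suc k. trace (B ** X (t + real (Suc j) * h) \<omega>))
        = trace (B ** X (t + h) \<omega>) + (\<Sum>j<k. trace (B ** X ((t + h) + real (Suc j) * h) \<omega>))"
      unfolding sum.lessThan_Suc_shift by (simp add: algebra_simps)
    thus "G \<omega> * exp (- (h * (\<Sum>j<Suc k. trace (B ** X (t + real (Suc j) * h) \<omega>))))
        = G' \<omega> * exp (- (h * (\<Sum>j<k. trace (B ** X ((t + h) + real (Suc j) * h) \<omega>))))"
      by (simp add: G'_def distrib_left exp_add[symmetric])
  qed
  also have "\<dots> = expectation (\<lambda>\<omega>. G' \<omega> * exp (- fst (splitting B h k) - trace (?u ** X (t + h) \<omega>)))"
    by (rule Suc.IH[OF th G' G'_bound])
  also have "\<dots> = expectation (\<lambda>\<omega>. (G \<omega> * exp (- fst (splitting B h k))) * exp_trace (?u + h *\<^sub>R B) (X (t + h) \<omega>))"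
    unfolding G'_def by (intro Bochner_Integration.integral_cong refl)
      (simp add: trace_mult_simps exp_add[symmetric])
  also have "\<dots> = expectation (\<lambda>\<omega>. (G \<omega> * exp (- fst (splitting B h k))) *
      exp (- \<phi> h (?u + h *\<^sub>R B) - trace (\<psi> h (?u + h *\<^sub>R B) ** X t \<omega>)))"
  proof (rule expectation_markov[OF Suc.prems(1) less_imp_le[OF h] up(2)])
    show "(\<lambda>\<omega>. G \<omega> * exp (- fst (splitting B h k))) \<in> borel_measurable (\<F> t)"
      using Suc.prems(2) by measurable
    show "\<bar>G \<omega> * exp (- fst (splitting B h k))\<bar> \<le> C * exp (- fst (splitting B h k))" if "\<omega> \<in> space Q" for \<omega>
      unfolding abs_mult using Suc.prems(3)[OF that] by simp
  qed
  also have "\<dots> = expectation (\<lambda>\<omega>. G \<omega> * exp (- fst (splitting B h (Suc k)) - trace (snd (splitting B h (Suc k)) ** X t \<omega>)))"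
    by (intro Bochner_Integration.integral_cong refl) (simp add: exp_add[symmetric])
  finally show ?case .
qed simp

text \<open>Doob's maximal inequality for the martingale \<open>E[1 - exp (- \<epsilon> * trace (X T)) | \<F> s]\<close>, which by
  the affine property is bounded below where \<open>trace (X s)\<close> is large.\<close>

lemma compact_containment:
  assumes T: "0 \<le> T" and \<eta>: "\<eta> > 0"
  shows "\<exists>K>0. \<forall>S. finite S \<longrightarrow> S \<subseteq> {0..T} \<longrightarrow> prob {\<omega> \<in> space Q. \<exists>s\<in>S. K < trace (X s \<omega>)} \<le> \<eta>"
proof -
  obtain \<delta> where \<delta>: "\<delta> > 0" "\<And>t. t \<in> {0..T} \<Longrightarrow> \<psi> t (mat 1) - \<delta> *\<^sub>R mat 1 \<in> psd"
    using psi_positive_definite by blast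
  \<comment> \<open>Here \<open>mesh\<close> is merely a sequence tending to \<open>0\<close>. It
    selects an \<open>\<epsilon> \<le> 1\<close> for which the terminal value of the martingale has
    mean below \<open>\<eta> / 2\<close>.\<close>
  have "(\<lambda>n. expectation (\<lambda>\<omega>. 1 - exp (- (mesh n * trace (X T \<omega>))))) \<longlonglongrightarrow> expectation (\<lambda>\<omega>. 0)"
  proof (rule integral_dominated_convergence[where w = "\<lambda>_. 1"])
    show "(\<lambda>\<omega>. 1 - exp (- (mesh n * trace (X T \<omega>)))) \<in> borel_measurable Q" for n
      using trace_X_measurable[OF T] by measurable
    show "AE \<omega> in Q. (\<lambda>n. 1 - exp (- (mesh n * trace (X T \<omega>)))) \<longlonglongrightarrow> 0"
    proof (rule AE_I2)
      fix \<omega>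
      have "(\<lambda>n. 1 - exp (- (mesh n * trace (X T \<omega>)))) \<longlonglongrightarrow> 1 - exp (- (0 * trace (X T \<omega>)))"
        by (intro tendsto_intros mesh_tendsto_0)
      thus "(\<lambda>n. 1 - exp (- (mesh n * trace (X T \<omega>)))) \<longlonglongrightarrow> 0" by simp
    qed
    show "AE \<omega> in Q. norm (1 - exp (- (mesh n * trace (X T \<omega>)))) \<le> 1" for n
      by (rule AE_I2) (use trace_psd_nonneg[OF X_psd[OF T]] mesh_pos[of n] in \<open>auto simp: abs_le_iff\<close>)
  qed auto
  hence "\<forall>\<^sub>F n in sequentially. expectation (\<lambda>\<omega>. 1 - exp (- (mesh n * trace (X T \<omega>)))) < \<eta> / 2"
    using \<eta> by (intro order_tendstoD(2)) auto
  then obtain n where n: "expectation (\<lambda>\<omega>. 1 - exp (- (mesh n * trace (X T \<omega>)))) < \<eta> / 2"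
    by (auto dest: eventually_happens)
  define \<epsilon> where "\<epsilon> = mesh n"
  have \<epsilon>: "0 < \<epsilon>" "\<epsilon> \<le> 1" by (auto simp: \<epsilon>_def mesh_pos) (simp add: mesh_def)
  define u :: "real^'d^'d" where "u = \<epsilon> *\<^sub>R mat 1"
  have up: "u \<in> psd" using \<epsilon> by (auto simp: u_def intro!: psd_scaleR)
  have e_u: "exp_trace u x = exp (- (\<epsilon> * trace x))" for x by (simp add: u_def trace_mat_mult)
  \<comment> \<open>Above this level the bound
    \<open>\<psi> (T - s) u \<ge> \<epsilon> \<delta> mat 1\<close> makes the exponent at least
    \<open>ln 2\<close>, so the conditional mean of \<open>Z\<close> is at least \<open>1/2\<close>.
    This is the factor \<open>2\<close> in \<open>large\<close>, matched by the
    \<open>\<eta> / 2\<close> above.\<close>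
  define K where "K = ln 2 / (\<epsilon> * \<delta>)"
  have K: "K > 0" using \<epsilon> \<delta> by (simp add: K_def)
  define Z where "Z \<omega> = 1 - exp_trace u (X T \<omega>)" for \<omega>
  have Z: "Z \<in> borel_measurable Q" "\<And>\<omega>. \<omega> \<in> space Q \<Longrightarrow> 0 \<le> Z \<omega>" "\<And>\<omega>. \<omega> \<in> space Q \<Longrightarrow> Z \<omega> \<le> 1" "expectation Z < \<eta> / 2"
  proof -
    show "Z \<in> borel_measurable Q" unfolding Z_def[abs_def] using X_measurable[OF T] by measurable
    show "0 \<le> Z \<omega>" "Z \<omega> \<le> 1" if "\<omega> \<in> space Q" for \<omega>
      using exp_trace_le_1[OF up X_psd[OF T that]] by (auto simp: Z_def)
    show "expectation Z < \<eta> / 2" using n by (simp add: Z_def[abs_def] e_u \<epsilon>_def)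
  qed
  have large: "1 \<le> 2 * (1 - exp (- \<phi> (T - s) u - trace (\<psi> (T - s) u ** X s \<omega>)))"
    if s: "s \<in> {0..T}" and \<omega>: "\<omega> \<in> space Q" and big: "K < trace (X s \<omega>)" for s \<omega>
  proof -
    have Ts: "T - s \<in> {0..T}" using s by auto
    have "\<psi> (T - s) u - \<epsilon> *\<^sub>R \<psi> (T - s) (mat 1) \<in> psd"
      using Ts \<epsilon> by (intro psi_lower) (auto simp: u_def)
    moreover have "\<epsilon> *\<^sub>R (\<psi> (T - s) (mat 1) - \<delta> *\<^sub>R mat 1) \<in> psd" using \<epsilon> by (intro psd_scaleR \<delta> Ts) auto
    hence "\<epsilon> *\<^sub>R \<psi> (T - s) (mat 1) - (\<epsilon> * \<delta>) *\<^sub>R mat 1 \<in> psd" by (simp add: scaleR_diff_right)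
    ultimately have "\<psi> (T - s) u - (\<epsilon> * \<delta>) *\<^sub>R mat 1 \<in> psd" by (rule psd_order_trans[rotated])
    hence "\<epsilon> * \<delta> * trace (X s \<omega>) \<le> trace (\<psi> (T - s) u ** X s \<omega>)"
      using s by (intro trace_mult_lower X_psd \<omega>) auto
    moreover have "ln 2 \<le> \<epsilon> * \<delta> * trace (X s \<omega>)" using big \<epsilon> \<delta> by (simp add: K_def field_simps)
    moreover have "0 \<le> \<phi> (T - s) u" using Ts by (intro phi_nonneg up) auto
    ultimately have "exp (- \<phi> (T - s) u - trace (\<psi> (T - s) u ** X s \<omega>)) \<le> exp (- ln 2)" by simp
    thus ?thesis by (simp add: exp_minus)
  qed
  have "prob {\<omega> \<in> space Q. \<exists>s\<in>S. K < trace (X s \<omega>)} \<le> \<eta>" if S: "finite S" "S \<subseteq> {0..T}" for S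
  proof -
    \<comment> \<open>First passage above \<open>K\<close> among the times in \<open>S\<close>:
      these events are disjoint, known at time \<open>s\<close>, and cover the event to be
      estimated.\<close>
    define A where "A s = {\<omega> \<in> space Q. K < trace (X s \<omega>) \<and> (\<forall>r\<in>{r\<in>S. r < s}. trace (X r \<omega>) \<le> K)}" for s
    have A_filt: "A s \<in> sets (\<F> s)" if "s \<in> S" for s
    proof -
      have s0: "0 \<le> s" using that S by auto
      have sp: "space Q = space (\<F> s)" using subalgebra_filtration[OF s0] by (simp add: subalgebra_def)
      have tm: "(\<lambda>\<omega>. trace (X r \<omega>)) \<in> borel_measurable (\<F> s)" if "0 \<le> r" "r \<le> s" for r
        using borel_measurable_trace_mult[OF borel_measurable_const X_measurable_filtration_le[OF that], of "mat 1"] by simp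
      have 1: "{\<omega> \<in> space (\<F> s). K < trace (X s \<omega>)} \<in> sets (\<F> s)" using tm[OF s0 order_refl] by measurable
      have 2: "{\<omega> \<in> space (\<F> s). \<forall>r\<in>{r\<in>S. r < s}. trace (X r \<omega>) \<le> K} \<in> sets (\<F> s)"
      proof (rule sets.sets_Collect_finite_All)
        fix r assume "r \<in> {r\<in>S. r < s}"
        hence "0 \<le> r" "r \<le> s" using S by auto
        from tm[OF this] show "{\<omega> \<in> space (\<F> s). trace (X r \<omega>) \<le> K} \<in> sets (\<F> s)" by measurable
      qed (use S in auto)
      from sets.Int[OF 1 2] show ?thesis by (simp add: A_def sp Collect_conj_eq[symmetric] conj_ac)
    qed
    have A_Q: "A s \<in> events" if "s \<in> S" for s
    proof -
      have "0 \<le> s" using that S by auto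
      thus ?thesis using A_filt[OF that] subalgebra_filtration[of s] by (auto simp: subalgebra_def)
    qed
    have disj: "disjoint_family_on A S"
      unfolding disjoint_family_on_def
    proof (intro ballI impI)
      fix s t assume "s \<in> S" "t \<in> S" "s \<noteq> t"
      thus "A s \<inter> A t = {}" by (cases "s < t") (fastforce simp: A_def)+
    qed
    have prob_A: "prob (A s) \<le> 2 * expectation (\<lambda>\<omega>. indicator (A s) \<omega> * Z \<omega>)" if s: "s \<in> S" for s
    proof -
      have s0: "0 \<le> s" "0 \<le> T - s" "s \<in> {0..T}" using s S by auto
      have iA: "(indicator (A s) :: 'w \<Rightarrow> real) \<in> borel_measurable (\<F> s)" using A_filt[OF s] by simp
      have m: "expectation (\<lambda>\<omega>. indicator (A s) \<omega> * exp_trace u (X (s + (T - s)) \<omega>))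
        = expectation (\<lambda>\<omega>. indicator (A s) \<omega> * exp (- \<phi> (T - s) u - trace (\<psi> (T - s) u ** X s \<omega>)))"
        by (rule expectation_markov[OF s0(1,2) up iA, where C = 1]) (simp add: indicator_def)
      let ?M = "\<lambda>\<omega>. exp (- \<phi> (T - s) u - trace (\<psi> (T - s) u ** X s \<omega>))"
      have M1: "?M \<omega> \<le> 1" if "\<omega> \<in> space Q" for \<omega>
        using phi_nonneg[OF s0(2) up] trace_mult_psd_nonneg[OF psi_psd[OF s0(2) up] X_psd[OF s0(1) that]] by simp
      have iQ: "(indicator (A s) :: 'w \<Rightarrow> real) \<in> borel_measurable Q" using A_Q[OF s] by simp
      have int: "integrable Q (\<lambda>\<omega>. indicator (A s) \<omega> * ?M \<omega>)" "integrable Q (\<lambda>\<omega>. indicator (A s) \<omega> * exp_trace u (X T \<omega>))"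
        "integrable Q (indicator (A s) :: 'w \<Rightarrow> real)"
      proof -
        have "?M \<in> borel_measurable Q" "(\<lambda>\<omega>. exp_trace u (X T \<omega>)) \<in> borel_measurable Q"
          using X_measurable[OF s0(1)] X_measurable[OF T] by measurable
        thus "integrable Q (\<lambda>\<omega>. indicator (A s) \<omega> * ?M \<omega>)" "integrable Q (\<lambda>\<omega>. indicator (A s) \<omega> * exp_trace u (X T \<omega>))"
          using M1 exp_trace_le_1[OF up X_psd[OF T]]
          by (auto intro!: integrable_indicator_bounded[where C = 1] A_Q s)
        show "integrable Q (indicator (A s) :: 'w \<Rightarrow> real)"
          using iQ by (rule integrable_bounded[where C = 1]) (simp add: indicator_def)
      qed
      have "prob (A s) = expectation (indicator (A s))"
        using A_Q[OF s] sets.sets_into_space[OF A_Q[OF s]] by (simp add: Int_absorb2)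
      also have "\<dots> \<le> expectation (\<lambda>\<omega>. 2 * (indicator (A s) \<omega> - indicator (A s) \<omega> * ?M \<omega>))"
      proof (intro integral_mono)
        show "indicator (A s) \<omega> \<le> 2 * (indicator (A s) \<omega> - indicator (A s) \<omega> * ?M \<omega>)" if "\<omega> \<in> space Q" for \<omega>
          using large[OF s0(3) that] by (auto simp: indicator_def A_def)
      qed (use int in auto)
      also have "\<dots> = 2 * (expectation (indicator (A s)) - expectation (\<lambda>\<omega>. indicator (A s) \<omega> * ?M \<omega>))"
        using int by simp
      also have "\<dots> = 2 * (expectation (indicator (A s)) - expectation (\<lambda>\<omega>. indicator (A s) \<omega> * exp_trace u (X T \<omega>)))"
        using m by simp
      also have "\<dots> = 2 * expectation (\<lambda>\<omega>. indicator (A s) \<omega> - indicator (A s) \<omega> * exp_trace u (X T \<omega>))"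
        using int by simp
      also have "\<dots> = 2 * expectation (\<lambda>\<omega>. indicator (A s) \<omega> * Z \<omega>)" by (simp add: Z_def right_diff_distrib)
      finally show ?thesis .
    qed
    have intZ: "integrable Q (\<lambda>\<omega>. indicator E \<omega> * Z \<omega>)" if "E \<in> events" for E
      using that Z by (intro integrable_indicator_bounded[where C = 1]) auto
    have "{\<omega> \<in> space Q. \<exists>s\<in>S. K < trace (X s \<omega>)} \<subseteq> (\<Union>s\<in>S. A s)"
    proof
      fix \<omega> assume \<omega>: "\<omega> \<in> {\<omega> \<in> space Q. \<exists>s\<in>S. K < trace (X s \<omega>)}"
      let ?D = "{s\<in>S. K < trace (X s \<omega>)}"
      have D: "finite ?D" "?D \<noteq> {}" using S \<omega> by auto
      from Min_in[OF D] Min_le[OF D(1)] \<omega> have "\<omega> \<in> A (Min ?D)" "Min ?D \<in> S"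
        unfolding A_def by (auto simp: not_less[symmetric])
      thus "\<omega> \<in> (\<Union>s\<in>S. A s)" by blast
    qed
    hence "prob {\<omega> \<in> space Q. \<exists>s\<in>S. K < trace (X s \<omega>)} \<le> prob (\<Union>s\<in>S. A s)"
      using S A_Q by (intro finite_measure_mono) auto
    also have "\<dots> = (\<Sum>s\<in>S. prob (A s))"
      using S A_Q disj by (intro finite_measure_finite_Union) auto
    also have "\<dots> \<le> (\<Sum>s\<in>S. 2 * expectation (\<lambda>\<omega>. indicator (A s) \<omega> * Z \<omega>))"
      by (intro sum_mono prob_A)
    also have "\<dots> = 2 * expectation (\<lambda>\<omega>. \<Sum>s\<in>S. indicator (A s) \<omega> * Z \<omega>)"
      using intZ A_Q by (simp add: sum_distrib_left)
    also have "\<dots> \<le> 2 * expectation Z"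
    proof (intro mult_left_mono integral_mono)
      show "integrable Q (\<lambda>\<omega>. \<Sum>s\<in>S. indicator (A s) \<omega> * Z \<omega>)" using intZ A_Q by auto
      show "integrable Q Z" using Z by (intro integrable_bounded[where C = 1]) auto
      fix \<omega> assume \<omega>: "\<omega> \<in> space Q"
      have "(\<Sum>s\<in>S. indicator (A s) \<omega> * Z \<omega>) = indicator (\<Union>s\<in>S. A s) \<omega> * Z \<omega>"
        by (simp only: indicator_UN_disjoint[OF S(1) disj] sum_distrib_right)
      also have "\<dots> \<le> Z \<omega>" using Z(2)[OF \<omega>] by (simp add: indicator_def)
      finally show "(\<Sum>s\<in>S. indicator (A s) \<omega> * Z \<omega>) \<le> Z \<omega>" .
    qed simp
    also have "\<dots> \<le> \<eta>" using Z(4) by simp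
    finally show ?thesis .
  qed
  thus ?thesis using K by blast
qed

end

text \<open>On values at most \<open>K\<close> the inverse of \<open>exp (- x)\<close> is Lipschitz
  with constant \<open>exp K\<close>. This converts mean continuity of exponentials into that of
  truncated rates.\<close>

lemma abs_min_diff_le_exp:
  fixes x y K :: real
  assumes "0 \<le> x" "0 \<le> y" "0 \<le> K"
  shows "\<bar>min x K - min y K\<bar> \<le> exp K * \<bar>exp (- x) - exp (- y)\<bar>"
proof -
  have *: "min y K - min x K \<le> exp K * (exp (- x) - exp (- y))" if "x \<le> y" for x y :: real
  proof -
    have "min y K - min x K \<le> exp (min y K) * (exp (- min x K) - exp (- min y K))"
    proof -
      have "exp (min y K) * (exp (- min x K) - exp (- min y K)) = exp (min y K - min x K) - 1"
        by (simp add: right_diff_distrib exp_add[symmetric])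
      moreover have "1 + (min y K - min x K) \<le> exp (min y K - min x K)" by (rule exp_ge_add_one_self)
      ultimately show ?thesis by linarith
    qed
    also have "\<dots> \<le> exp K * (exp (- x) - exp (- y))"
    proof (intro mult_mono)
      show "exp (- min x K) - exp (- min y K) \<le> exp (- x) - exp (- y)"
        using that by (auto simp: min_def)
    qed (use that in \<open>auto simp: min_def\<close>)
    finally show ?thesis .
  qed
  show ?thesis
  proof (cases "x \<le> y")
    case True
    have "exp (- y) \<le> exp (- x)" "min x K \<le> min y K" using True by auto
    hence "\<bar>min x K - min y K\<bar> = min y K - min x K" "\<bar>exp (- x) - exp (- y)\<bar> = exp (- x) - exp (- y)"
      by linarith+
    thus ?thesis using *[OF True] by (simp only:)
  next
    case False
    hence "y \<le> x" by simp
    have "exp (- x) \<le> exp (- y)" "min y K \<le> min x K" using False by auto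
    hence "\<bar>min x K - min y K\<bar> = min x K - min y K" "\<bar>exp (- x) - exp (- y)\<bar> = exp (- y) - exp (- x)"
      by linarith+
    thus ?thesis using *[OF \<open>y \<le> x\<close>] by (simp only:)
  qed
qed

context affine_process_semigroup
begin

text \<open>Where \<open>trace (X s)\<close> is at most \<open>K\<close>, the exponents differ by at
  most \<open>\<phi> h v + norm (\<psi> h v - v) * K\<close>, small with \<open>h\<close>; the
  remaining event is rare by containment. Both estimates are uniform in \<open>s\<close>.\<close>

lemma semigroup_mean_continuity:
  assumes v: "v \<in> psd" and T: "0 \<le> T" and \<eta>: "\<eta> > 0"
  shows "\<exists>d>0. \<forall>h s. 0 \<le> h \<longrightarrow> h < d \<longrightarrow> s \<in> {0..T} \<longrightarrow>
    expectation (\<lambda>\<omega>. \<bar>exp (- \<phi> h v - trace (\<psi> h v ** X s \<omega>)) - exp_trace v (X s \<omega>)\<bar>) \<le> \<eta>"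
proof -
  obtain K where K: "K > 0" "\<And>S. finite S \<Longrightarrow> S \<subseteq> {0..T} \<Longrightarrow> prob {\<omega> \<in> space Q. \<exists>s\<in>S. K < trace (X s \<omega>)} \<le> \<eta> / 2"
    using compact_containment[OF T, of "\<eta> / 2"] \<eta> by auto
  have "((\<lambda>h. \<phi> h v + norm (\<psi> h v - v) * K) \<longlongrightarrow> \<phi> 0 v + norm (\<psi> 0 v - v) * K) (at 0 within {0..})"
    by (intro tendsto_intros continuous_time v order_refl)
  hence "((\<lambda>h. \<phi> h v + norm (\<psi> h v - v) * K) \<longlongrightarrow> 0) (at 0 within {0..})" by (simp add: phi_psi_0 v)
  hence "\<forall>\<^sub>F h in at 0 within {0..}. \<phi> h v + norm (\<psi> h v - v) * K < \<eta> / 2"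
    using \<eta> by (intro order_tendstoD(2)) auto
  then obtain d where d: "d > 0" "\<And>h. h \<in> {0..} \<Longrightarrow> h \<noteq> 0 \<Longrightarrow> dist h 0 < d \<Longrightarrow> \<phi> h v + norm (\<psi> h v - v) * K < \<eta> / 2"
    unfolding eventually_at by blast
  have small: "\<phi> h v + norm (\<psi> h v - v) * K \<le> \<eta> / 2" if "0 \<le> h" "h < d" for h
    using d(2)[of h] that \<eta> by (cases "h = 0") (auto simp: phi_psi_0 v)
  have "expectation (\<lambda>\<omega>. \<bar>exp (- \<phi> h v - trace (\<psi> h v ** X s \<omega>)) - exp_trace v (X s \<omega>)\<bar>) \<le> \<eta>"
    if h: "0 \<le> h" "h < d" and s: "s \<in> {0..T}" for h s
  proof -
    have s0: "0 \<le> s" using s by simp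
    let ?D = "\<lambda>\<omega>. \<bar>exp (- \<phi> h v - trace (\<psi> h v ** X s \<omega>)) - exp_trace v (X s \<omega>)\<bar>"
    define A where "A = {\<omega> \<in> space Q. K < trace (X s \<omega>)}"
    have [measurable]: "X s \<in> borel_measurable Q" by (rule X_measurable[OF s0])
    have A: "A \<in> events" unfolding A_def using trace_X_measurable[OF s0] by measurable
    have le1: "?D \<omega> \<le> 1" if \<omega>: "\<omega> \<in> space Q" for \<omega>
    proof -
      have "exp (- \<phi> h v - trace (\<psi> h v ** X s \<omega>)) \<le> 1"
        using phi_nonneg[OF h(1) v] trace_mult_psd_nonneg[OF psi_psd[OF h(1) v] X_psd[OF s0 \<omega>]] by simp
      moreover have "exp_trace v (X s \<omega>) \<le> 1" by (rule exp_trace_le_1[OF v X_psd[OF s0 \<omega>]])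
      moreover have "0 < exp (- \<phi> h v - trace (\<psi> h v ** X s \<omega>))" "0 < exp_trace v (X s \<omega>)" by simp_all
      ultimately show ?thesis by linarith
    qed
    have "expectation ?D \<le> expectation (\<lambda>\<omega>. \<eta> / 2 + indicator A \<omega>)"
    proof (rule integral_mono)
      show "integrable Q ?D" by (rule integrable_bounded[where C = 1]) (use le1 in \<open>auto\<close>)
      show "integrable Q (\<lambda>\<omega>. \<eta> / 2 + indicator A \<omega>)"
        by (rule Bochner_Integration.integrable_add[OF integrable_const integrable_real_indicator[OF A]])
           (simp add: emeasure_eq_measure)
      fix \<omega> assume \<omega>: "\<omega> \<in> space Q"
      show "?D \<omega> \<le> \<eta> / 2 + indicator A \<omega>"
      proof (cases "\<omega> \<in> A")
        case True
        thus ?thesis using le1[OF \<omega>] \<eta> by simp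
      next
        case False
        hence tr: "trace (X s \<omega>) \<le> K" using \<omega> by (simp add: A_def)
        have x: "X s \<omega> \<in> psd" by (rule X_psd[OF s0 \<omega>])
        have "?D \<omega> = \<bar>exp (- (\<phi> h v + trace (\<psi> h v ** X s \<omega>))) - exp (- trace (v ** X s \<omega>))\<bar>" by simp
        also have "\<dots> \<le> \<bar>(\<phi> h v + trace (\<psi> h v ** X s \<omega>)) - trace (v ** X s \<omega>)\<bar>"
          by (intro abs_exp_minus_diff_le add_nonneg_nonneg phi_nonneg trace_mult_psd_nonneg psi_psd h v x)
        also have "\<dots> = \<bar>\<phi> h v + trace ((\<psi> h v - v) ** X s \<omega>)\<bar>" by (simp add: trace_mult_simps)
        also have "\<dots> \<le> \<phi> h v + norm (\<psi> h v - v) * norm (X s \<omega>)"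
          using abs_trace_mult_le[of "\<psi> h v - v" "X s \<omega>"] phi_nonneg[OF h(1) v] by linarith
        also have "\<dots> \<le> \<phi> h v + norm (\<psi> h v - v) * K"
          using norm_le_trace_psd[OF x] tr by (intro add_left_mono mult_left_mono) auto
        also have "\<dots> \<le> \<eta> / 2" by (rule small[OF h])
        finally show ?thesis using False by simp
      qed
    qed
    also have "\<dots> = \<eta> / 2 + prob A"
      using A sets.sets_into_space[OF A]
      by (subst Bochner_Integration.integral_add)
         (auto simp: prob_space Int_absorb2 emeasure_eq_measure intro!: integrable_real_indicator)
    also have "\<dots> \<le> \<eta>" using K(2)[of "{s}"] s by (simp add: A_def)
    finally show ?thesis .
  qed
  thus ?thesis using d(1) by blast
qed

text \<open>Expanding the squared difference, the Markov property turns the cross term and the later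
  square into expectations at time \<open>s\<close>; the square of the exponential for
  \<open>B\<close> is that for \<open>2 B\<close>. What remains is
  \<open>semigroup_mean_continuity\<close> for \<open>B\<close> and for \<open>2 B\<close>.\<close>

lemma exp_trace_mean_continuity:
  assumes B: "B \<in> psd" and T: "0 \<le> T" and \<eta>: "\<eta> > 0"
  shows "\<exists>d>0. \<forall>s u. 0 \<le> s \<longrightarrow> s \<le> u \<longrightarrow> u \<le> T \<longrightarrow> u - s < d \<longrightarrow>
    expectation (\<lambda>\<omega>. \<bar>exp_trace B (X s \<omega>) - exp_trace B (X u \<omega>)\<bar>) \<le> \<eta>"
proof -
  \<comment> \<open>The mean square error is at most three times \<open>\<eta>2\<close>: once from
    \<open>2 B\<close>, twice from \<open>B\<close>.\<close>
  define \<eta>2 where "\<eta>2 = \<eta>\<^sup>2 / 3"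
  have \<eta>2: "\<eta>2 > 0" using \<eta> by (simp add: \<eta>2_def)
  have B2: "2 *\<^sub>R B \<in> psd" by (intro psd_scaleR B) simp
  obtain d1 where d1: "d1 > 0" "\<And>h s. 0 \<le> h \<Longrightarrow> h < d1 \<Longrightarrow> s \<in> {0..T} \<Longrightarrow>
    expectation (\<lambda>\<omega>. \<bar>exp (- \<phi> h B - trace (\<psi> h B ** X s \<omega>)) - exp_trace B (X s \<omega>)\<bar>) \<le> \<eta>2"
    using semigroup_mean_continuity[OF B T \<eta>2] by blast
  obtain d2 where d2: "d2 > 0" "\<And>h s. 0 \<le> h \<Longrightarrow> h < d2 \<Longrightarrow> s \<in> {0..T} \<Longrightarrow>
    expectation (\<lambda>\<omega>. \<bar>exp (- \<phi> h (2 *\<^sub>R B) - trace (\<psi> h (2 *\<^sub>R B) ** X s \<omega>)) - exp_trace (2 *\<^sub>R B) (X s \<omega>)\<bar>) \<le> \<eta>2"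
    using semigroup_mean_continuity[OF B2 T \<eta>2] by blast
  show ?thesis
  proof (intro exI[of _ "min d1 d2"] conjI allI impI)
    fix s u assume su: "0 \<le> s" "s \<le> u" "u \<le> T" "u - s < min d1 d2"
    define h where "h = u - s"
    have h: "0 \<le> h" "h < d1" "h < d2" "s + h = u" using su by (auto simp: h_def)
    have s: "s \<in> {0..T}" "0 \<le> u" using su by auto
    let ?f = "\<lambda>\<omega>. exp_trace B (X s \<omega>)" and ?g = "\<lambda>\<omega>. exp_trace B (X u \<omega>)"
    let ?Pf = "\<lambda>\<omega>. exp (- \<phi> h B - trace (\<psi> h B ** X s \<omega>))"
    let ?Pg = "\<lambda>\<omega>. exp (- \<phi> h (2 *\<^sub>R B) - trace (\<psi> h (2 *\<^sub>R B) ** X s \<omega>))"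
    have [measurable]: "X s \<in> borel_measurable Q" "X u \<in> borel_measurable Q"
      using X_measurable su(1) s(2) by auto
    have le1: "?f \<omega> \<le> 1" "?g \<omega> \<le> 1" "?Pf \<omega> \<le> 1" "?Pg \<omega> \<le> 1" if \<omega>: "\<omega> \<in> space Q" for \<omega>
      using exp_trace_le_1[OF B X_psd[OF su(1) \<omega>]] exp_trace_le_1[OF B X_psd[OF s(2) \<omega>]]
        phi_nonneg[OF h(1) B] trace_mult_psd_nonneg[OF psi_psd[OF h(1) B] X_psd[OF su(1) \<omega>]]
        phi_nonneg[OF h(1) B2] trace_mult_psd_nonneg[OF psi_psd[OF h(1) B2] X_psd[OF su(1) \<omega>]]
      by simp_all
    have int: "integrable Q f" if "f \<in> borel_measurable Q" "\<And>\<omega>. \<omega> \<in> space Q \<Longrightarrow> 0 \<le> f \<omega> \<and> f \<omega> \<le> 1" for f :: "'w \<Rightarrow> real"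
      using that(1) by (rule integrable_bounded[where C = 1]) (use that(2) in force)
    have sq: "exp_trace (2 *\<^sub>R B) x = (exp_trace B x)\<^sup>2" for x
      by (simp add: trace_mult_simps power2_eq_square exp_add[symmetric])
    have i: "integrable Q (\<lambda>\<omega>. (?f \<omega>)\<^sup>2)" "integrable Q (\<lambda>\<omega>. (?g \<omega>)\<^sup>2)" "integrable Q (\<lambda>\<omega>. ?f \<omega> * ?g \<omega>)"
      "integrable Q ?Pg" "integrable Q (\<lambda>\<omega>. ?f \<omega> * ?Pf \<omega>)" "integrable Q ?Pf" "integrable Q ?f" "integrable Q ?g"
      using le1 by (auto intro!: int mult_le_one power_le_one simp del: exp_le_one_iff)
    have e1: "expectation (\<lambda>\<omega>. (?g \<omega>)\<^sup>2) = expectation ?Pg"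
      using expectation_markov[OF su(1) h(1) B2, of "\<lambda>_. 1" 1] by (simp add: sq h(4))
    have e2: "expectation (\<lambda>\<omega>. ?f \<omega> * ?g \<omega>) = expectation (\<lambda>\<omega>. ?f \<omega> * ?Pf \<omega>)"
    proof -
      have "?f \<in> borel_measurable (\<F> s)" using X_measurable_filtration_borel[OF su(1)] by measurable
      from expectation_markov[OF su(1) h(1) B this, of 1] le1(1) show ?thesis by (simp add: h(4))
    qed
    have "expectation (\<lambda>\<omega>. (?f \<omega> - ?g \<omega>)\<^sup>2) = expectation (\<lambda>\<omega>. (?g \<omega>)\<^sup>2) - 2 * expectation (\<lambda>\<omega>. ?f \<omega> * ?g \<omega>) + expectation (\<lambda>\<omega>. (?f \<omega>)\<^sup>2)"
    proof -
      have "expectation (\<lambda>\<omega>. (?f \<omega> - ?g \<omega>)\<^sup>2) = expectation (\<lambda>\<omega>. (?g \<omega>)\<^sup>2 - 2 * (?f \<omega> * ?g \<omega>) + (?f \<omega>)\<^sup>2)"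
        by (simp add: power2_diff algebra_simps)
      also have "\<dots> = expectation (\<lambda>\<omega>. (?g \<omega>)\<^sup>2) - 2 * expectation (\<lambda>\<omega>. ?f \<omega> * ?g \<omega>) + expectation (\<lambda>\<omega>. (?f \<omega>)\<^sup>2)"
        using i by (subst Bochner_Integration.integral_add Bochner_Integration.integral_diff
            integral_mult_right_zero; auto)+
      finally show ?thesis .
    qed
    also have "\<dots> = expectation (\<lambda>\<omega>. (?Pg \<omega> - exp_trace (2 *\<^sub>R B) (X s \<omega>)) - 2 * (?f \<omega> * (?Pf \<omega> - ?f \<omega>)))"
    proof -
      have eq: "(?Pg \<omega> - exp_trace (2 *\<^sub>R B) (X s \<omega>)) - 2 * (?f \<omega> * (?Pf \<omega> - ?f \<omega>))
          = (?Pg \<omega> - 2 * (?f \<omega> * ?Pf \<omega>)) + (?f \<omega>)\<^sup>2" for \<omega>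
        unfolding sq by (simp only: power2_eq_square algebra_simps)
      show ?thesis unfolding eq e1 e2
        using i by (subst Bochner_Integration.integral_add Bochner_Integration.integral_diff
            integral_mult_right_zero; auto)+
    qed
    also have "\<dots> \<le> expectation (\<lambda>\<omega>. \<bar>?Pg \<omega> - exp_trace (2 *\<^sub>R B) (X s \<omega>)\<bar> + 2 * \<bar>?Pf \<omega> - ?f \<omega>\<bar>)"
    proof (rule integral_mono)
      fix \<omega> assume \<omega>: "\<omega> \<in> space Q"
      have "\<bar>?f \<omega> * (?Pf \<omega> - ?f \<omega>)\<bar> \<le> 1 * \<bar>?Pf \<omega> - ?f \<omega>\<bar>"
        unfolding abs_mult using le1(1)[OF \<omega>] by (intro mult_right_mono) auto
      thus "(?Pg \<omega> - exp_trace (2 *\<^sub>R B) (X s \<omega>)) - 2 * (?f \<omega> * (?Pf \<omega> - ?f \<omega>))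
         \<le> \<bar>?Pg \<omega> - exp_trace (2 *\<^sub>R B) (X s \<omega>)\<bar> + 2 * \<bar>?Pf \<omega> - ?f \<omega>\<bar>" by linarith
    next
      show "integrable Q (\<lambda>\<omega>. \<bar>?Pg \<omega> - exp_trace (2 *\<^sub>R B) (X s \<omega>)\<bar> + 2 * \<bar>?Pf \<omega> - ?f \<omega>\<bar>)"
        unfolding sq using i by auto
      have "integrable Q (\<lambda>\<omega>. ?f \<omega> * ?Pf \<omega> - (?f \<omega>)\<^sup>2)" using i by auto
      thus "integrable Q (\<lambda>\<omega>. (?Pg \<omega> - exp_trace (2 *\<^sub>R B) (X s \<omega>)) - 2 * (?f \<omega> * (?Pf \<omega> - ?f \<omega>)))"
        unfolding sq using i by (auto simp: right_diff_distrib power2_eq_square)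
    qed
    also have "\<dots> = expectation (\<lambda>\<omega>. \<bar>?Pg \<omega> - exp_trace (2 *\<^sub>R B) (X s \<omega>)\<bar>) + 2 * expectation (\<lambda>\<omega>. \<bar>?Pf \<omega> - ?f \<omega>\<bar>)"
      unfolding sq using i by simp
    also have "\<dots> \<le> \<eta>2 + 2 * \<eta>2"
      using d1(2)[OF h(1,2) s(1)] d2(2)[OF h(1,3) s(1)] by simp
    finally have L2: "expectation (\<lambda>\<omega>. (?f \<omega> - ?g \<omega>)\<^sup>2) \<le> \<eta>\<^sup>2" by (simp add: \<eta>2_def)
    have sqi: "integrable Q (\<lambda>\<omega>. (?f \<omega> - ?g \<omega>)\<^sup>2)"
      unfolding power2_diff mult.assoc
      by (intro Bochner_Integration.integrable_add Bochner_Integration.integrable_diff integrable_mult_right i)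
    \<comment> \<open>From mean square to mean by
      \<open>2 * \<bar>x\<bar> \<le> \<eta> + x^2 / \<eta>\<close>.\<close>
    have "expectation (\<lambda>\<omega>. \<bar>?f \<omega> - ?g \<omega>\<bar>) \<le> expectation (\<lambda>\<omega>. (\<eta> + (?f \<omega> - ?g \<omega>)\<^sup>2 / \<eta>) / 2)"
    proof (rule integral_mono)
      fix \<omega>
      have "0 \<le> (\<bar>?f \<omega> - ?g \<omega>\<bar> - \<eta>)\<^sup>2" by simp
      hence "2 * \<bar>?f \<omega> - ?g \<omega>\<bar> * \<eta> \<le> \<eta>\<^sup>2 + (?f \<omega> - ?g \<omega>)\<^sup>2" by (simp add: power2_diff)
      thus "\<bar>?f \<omega> - ?g \<omega>\<bar> \<le> (\<eta> + (?f \<omega> - ?g \<omega>)\<^sup>2 / \<eta>) / 2"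
        using \<eta> by (simp add: field_simps power2_eq_square)
    qed (use i sqi in auto)
    also have "\<dots> = (\<eta> + expectation (\<lambda>\<omega>. (?f \<omega> - ?g \<omega>)\<^sup>2) / \<eta>) / 2" using sqi by (simp add: prob_space)
    also have "\<dots> \<le> (\<eta> + \<eta>\<^sup>2 / \<eta>) / 2" using L2 \<eta> by (intro divide_right_mono add_left_mono) auto
    also have "\<dots> = \<eta>" using \<eta> by (simp add: power2_eq_square)
    finally show "expectation (\<lambda>\<omega>. \<bar>?f \<omega> - ?g \<omega>\<bar>) \<le> \<eta>" .
  qed (use d1 d2 in auto)
qed

text \<open>The truncation at \<open>0\<close> only serves to make the rate jointly measurable on the whole line.\<close>

definition rate :: "real^'d^'d \<Rightarrow> real \<Rightarrow> 'w \<Rightarrow> real" where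
  "rate B u \<omega> = trace (B ** X (max 0 u) \<omega>)"

section \<open>The rate along paths and its truncated time integral\<close>

lemma rate_nonneg: "B \<in> psd \<Longrightarrow> \<omega> \<in> space Q \<Longrightarrow> 0 \<le> rate B u \<omega>"
  unfolding rate_def by (intro trace_mult_psd_nonneg X_psd) auto

lemma rate_measurable_pair: "(\<lambda>(\<omega>, u). rate B u \<omega>) \<in> borel_measurable (Q \<Otimes>\<^sub>M lborel)"
proof -
  have 1: "(\<lambda>(\<omega>, u). (max 0 u, \<omega>)) \<in> measurable (Q \<Otimes>\<^sub>M lborel) (restrict_space borel {0::real..} \<Otimes>\<^sub>M Q)"
    unfolding case_prod_beta by (intro measurable_Pair measurable_restrict_space2) auto
  have 2: "(\<lambda>(t, \<omega>). X t \<omega>) \<in> measurable (restrict_space borel {0..} \<Otimes>\<^sub>M Q) psd_space"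
    using joint by (simp add: jointly_measurable_def)
  have "(\<lambda>q. X (max 0 (snd q)) (fst q)) \<in> borel_measurable (Q \<Otimes>\<^sub>M lborel)"
    using measurable_compose[OF measurable_compose[OF 1 2] psd_space_id] by (simp add: case_prod_beta)
  thus ?thesis unfolding rate_def case_prod_beta by measurable
qed

lemma rate_measurable [measurable]: "rate B u \<in> borel_measurable Q"
  using X_measurable[of "max 0 u"] unfolding rate_def[abs_def] by measurable

lemma rate_path_measurable:
  assumes "\<omega> \<in> space Q"
  shows "(\<lambda>u. rate B u \<omega>) \<in> borel_measurable lborel"
  using measurable_compose[OF measurable_Pair1'[OF assms] rate_measurable_pair[of B]] by simp

lemma path_integral_measurable:
  assumes "(\<lambda>q. f (snd q) (rate B (snd q) (fst q))) \<in> borel_measurable (Q \<Otimes>\<^sub>M lborel)"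
  shows "(\<lambda>\<omega>. LINT u|lborel. f u (rate B u \<omega>) :: real) \<in> borel_measurable Q"
  using lborel.borel_measurable_lebesgue_integral[of "\<lambda>\<omega> u. f u (rate B u \<omega>)" Q] assms
  by (simp add: case_prod_beta)

text \<open>Half-open intervals concatenate without overlap, and their right endpoints are the
  sampling points of the Riemann sums. Truncation makes the path integral exist for every
  scenario.\<close>

definition rate_integral :: "real^'d^'d \<Rightarrow> real \<Rightarrow> real \<Rightarrow> real \<Rightarrow> 'w \<Rightarrow> real" where
  "rate_integral B K s t \<omega> = (LINT u:{s<..t}|lborel. min (rate B u \<omega>) K)"

lemma rate_integral_measurable [measurable]: "rate_integral B K s t \<in> borel_measurable Q"
  unfolding rate_integral_def[abs_def] set_lebesgue_integral_def
  by (rule path_integral_measurable) (use rate_measurable_pair[of B] in \<open>unfold case_prod_beta, measurable\<close>)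

lemma set_integral_rate_measurable:
  "(\<lambda>\<omega>. LINT u:{s<..t}|lborel. rate B u \<omega>) \<in> borel_measurable Q"
  unfolding set_lebesgue_integral_def
  by (rule path_integral_measurable) (use rate_measurable_pair[of B] in \<open>unfold case_prod_beta, measurable\<close>)

lemma set_integrable_truncated_rate:
  assumes "B \<in> psd" "\<omega> \<in> space Q" "0 \<le> K"
  shows "set_integrable lborel {s<..t} (\<lambda>u. min (rate B u \<omega>) K)"
proof -
  have "set_integrable lborel {s<..t} (\<lambda>u. K)"
    unfolding set_integrable_def by (cases "s \<le> t") auto
  moreover have "set_borel_measurable lborel {s<..t} (\<lambda>u. min (rate B u \<omega>) K)"
    unfolding set_borel_measurable_def using rate_path_measurable[OF assms(2), of B] by measurable
  ultimately show ?thesis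
    by (rule set_integrable_bound) (use assms rate_nonneg[OF assms(1,2)] in auto)
qed

lemma rate_integral_bounds:
  assumes "B \<in> psd" "\<omega> \<in> space Q" "0 \<le> K" "s \<le> t"
  shows "0 \<le> rate_integral B K s t \<omega>" "rate_integral B K s t \<omega> \<le> K * (t - s)"
proof -
  have *: "set_lebesgue_integral lborel {s<..t} (\<lambda>_. K) = K * (t - s)"
    using assms(4) by (simp add: set_integral_const)
  show "0 \<le> rate_integral B K s t \<omega>"
    unfolding rate_integral_def set_lebesgue_integral_def
    using rate_nonneg[OF assms(1,2)] assms(3) by (intro Bochner_Integration.integral_nonneg) auto
  have "rate_integral B K s t \<omega> \<le> set_lebesgue_integral lborel {s<..t} (\<lambda>_. K)"
    unfolding rate_integral_def
    by (intro set_integral_mono set_integrable_truncated_rate assms(1-3))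
       (use assms(4) in \<open>auto simp: set_integrable_def\<close>)
  thus "rate_integral B K s t \<omega> \<le> K * (t - s)" using * by simp
qed

lemma rate_integral_add:
  assumes "B \<in> psd" "\<omega> \<in> space Q" "0 \<le> K" "s \<le> t" "t \<le> v"
  shows "rate_integral B K s v \<omega> = rate_integral B K s t \<omega> + rate_integral B K t v \<omega>"
proof -
  have "{s<..v} = {s<..t} \<union> {t<..v}" "{s<..t} \<inter> {t<..v} = {}" using assms(4,5) by auto
  thus ?thesis
    unfolding rate_integral_def
    by (simp add: set_integral_Un set_integrable_truncated_rate assms(1-3))
qed

text \<open>Fubini turns the mean error on one interval into an integral over \<open>u\<close> of
  mean differences from the right endpoint.\<close>

lemma rate_integral_interval_error:
  assumes B: "B \<in> psd" and s: "0 \<le> s" and h: "0 \<le> h" and K: "0 \<le> K"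
    and \<eta>: "\<And>u. s \<le> u \<Longrightarrow> u \<le> s + h \<Longrightarrow>
      expectation (\<lambda>\<omega>. \<bar>min (rate B u \<omega>) K - min (rate B (s + h) \<omega>) K\<bar>) \<le> \<eta>"
  shows "expectation (\<lambda>\<omega>. \<bar>rate_integral B K s (s + h) \<omega> - h * min (rate B (s + h) \<omega>) K\<bar>) \<le> h * \<eta>"
proof -
  interpret QL: pair_sigma_finite Q lborel by unfold_locales
  let ?v = "\<lambda>\<omega>. min (rate B (s + h) \<omega>) K"
  define g where "g \<omega> u = indicator {s<..s + h} u * \<bar>min (rate B u \<omega>) K - ?v \<omega>\<bar>" for \<omega> u
  have g_le: "0 \<le> g \<omega> u" "g \<omega> u \<le> K * indicator {s<..s + h} u" if "\<omega> \<in> space Q" for \<omega> u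
    using rate_nonneg[OF B that, of u] rate_nonneg[OF B that, of "s + h"] K
    by (auto simp: g_def indicator_def abs_le_iff min_def)
  have gm: "case_prod g \<in> borel_measurable (Q \<Otimes>\<^sub>M lborel)"
    unfolding g_def case_prod_beta using rate_measurable_pair[of B] unfolding case_prod_beta by measurable
  have gi: "integrable (Q \<Otimes>\<^sub>M lborel) (case_prod g)"
  proof (rule Bochner_Integration.integrable_bound[OF _ gm])
    have "emeasure (Q \<Otimes>\<^sub>M lborel) (space Q \<times> {s<..s + h}) < \<infinity>"
      using h by (simp add: lborel.emeasure_pair_measure_Times emeasure_space_1 ennreal_mult_less_top)
    hence "integrable (Q \<Otimes>\<^sub>M lborel) (indicator (space Q \<times> {s<..s + h}) :: 'w \<times> real \<Rightarrow> real)"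
      by (intro integrable_real_indicator) auto
    thus "integrable (Q \<Otimes>\<^sub>M lborel) (\<lambda>q. K * indicator (space Q \<times> {s<..s + h}) q :: real)" by simp
    show "AE q in Q \<Otimes>\<^sub>M lborel. norm (case_prod g q) \<le> norm (K * indicator (space Q \<times> {s<..s + h}) q :: real)"
    proof (rule AE_I2)
      fix q :: "'w \<times> real" assume "q \<in> space (Q \<Otimes>\<^sub>M lborel)"
      hence "fst q \<in> space Q" by (auto simp: space_pair_measure)
      thus "norm (case_prod g q) \<le> norm (K * indicator (space Q \<times> {s<..s + h}) q :: real)"
        using g_le[of "fst q" "snd q"] K by (auto simp: case_prod_beta indicator_def mem_Times_iff split: if_splits)
    qed
  qed
  have pw: "\<bar>rate_integral B K s (s + h) \<omega> - h * ?v \<omega>\<bar> \<le> (LINT u|lborel. g \<omega> u)" if \<omega>: "\<omega> \<in> space Q" for \<omega>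
  proof -
    have c: "set_integrable lborel {s<..s + h} (\<lambda>_. ?v \<omega>)" using h by (auto simp: set_integrable_def)
    have "(LINT u:{s<..s + h}|lborel. min (rate B u \<omega>) K - ?v \<omega>) = rate_integral B K s (s + h) \<omega> - h * ?v \<omega>"
      unfolding rate_integral_def using h
      by (subst set_integral_diff(2)[OF set_integrable_truncated_rate[OF B \<omega> K] c]) (simp add: set_integral_const)
    moreover have "\<bar>LINT u:{s<..s + h}|lborel. min (rate B u \<omega>) K - ?v \<omega>\<bar>
        \<le> (LINT u|lborel. \<bar>indicator {s<..s + h} u *\<^sub>R (min (rate B u \<omega>) K - ?v \<omega>)\<bar>)"
      unfolding set_lebesgue_integral_def by (rule integral_abs_bound)
    ultimately show ?thesis by (simp add: g_def abs_mult)
  qed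
  have "expectation (\<lambda>\<omega>. \<bar>rate_integral B K s (s + h) \<omega> - h * ?v \<omega>\<bar>) \<le> expectation (\<lambda>\<omega>. LINT u|lborel. g \<omega> u)"
  proof (rule integral_mono)
    show "integrable Q (\<lambda>\<omega>. LINT u|lborel. g \<omega> u)" using QL.integrable_fst'[OF gi] by simp
    show "integrable Q (\<lambda>\<omega>. \<bar>rate_integral B K s (s + h) \<omega> - h * ?v \<omega>\<bar>)"
    proof (rule integrable_bounded[where C = "K * h"])
      fix \<omega> assume \<omega>: "\<omega> \<in> space Q"
      have "0 \<le> h * ?v \<omega>" "h * ?v \<omega> \<le> h * K"
        using rate_nonneg[OF B \<omega>, of "s + h"] h K by (auto intro!: mult_nonneg_nonneg mult_left_mono)
      thus "\<bar>\<bar>rate_integral B K s (s + h) \<omega> - h * ?v \<omega>\<bar>\<bar> \<le> K * h"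
        using rate_integral_bounds[OF B \<omega> K, of s "s + h"] h by (simp add: mult.commute abs_le_iff)
    qed measurable
  qed (rule pw)
  also have "\<dots> = (LINT u|lborel. expectation (\<lambda>\<omega>. g \<omega> u))" by (rule QL.Fubini_integral[OF gi, symmetric])
  also have "\<dots> \<le> (LINT u|lborel. indicator {s<..s + h} u * \<eta>)"
  proof (rule integral_mono)
    show "integrable lborel (\<lambda>u. expectation (\<lambda>\<omega>. g \<omega> u))" using QL.integrable_snd[OF gi] by simp
    show "integrable lborel (\<lambda>u. indicator {s<..s + h} u * \<eta>)" using h by simp
    show "expectation (\<lambda>\<omega>. g \<omega> u) \<le> indicator {s<..s + h} u * \<eta>" for u
      using \<eta>[of u] by (auto simp: g_def indicator_def)
  qed
  also have "\<dots> = h * \<eta>" using h by simp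
  finally show ?thesis .
qed


lemma truncated_rate_bounds:
  assumes "B \<in> psd" "\<omega> \<in> space Q" "0 \<le> K"
  shows "0 \<le> min (rate B u \<omega>) K" "min (rate B u \<omega>) K \<le> K"
  using rate_nonneg[OF assms(1,2), of u] assms(3) by auto

text \<open>The exponentials need no moments of \<open>X\<close>; truncation at \<open>K\<close> is
  what makes them sufficient, at the cost of the factor \<open>exp K\<close>.\<close>

lemma truncated_rate_mean_continuity:
  assumes B: "B \<in> psd" and T: "0 \<le> T" and K: "0 \<le> K" and \<eta>: "\<eta> > 0"
  shows "\<exists>d>0. \<forall>s u. 0 \<le> s \<longrightarrow> s \<le> u \<longrightarrow> u \<le> T \<longrightarrow> u - s < d \<longrightarrow>
    expectation (\<lambda>\<omega>. \<bar>min (rate B s \<omega>) K - min (rate B u \<omega>) K\<bar>) \<le> \<eta>"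
proof -
  obtain d where d: "d > 0" "\<And>s u. 0 \<le> s \<Longrightarrow> s \<le> u \<Longrightarrow> u \<le> T \<Longrightarrow> u - s < d \<Longrightarrow>
    expectation (\<lambda>\<omega>. \<bar>exp_trace B (X s \<omega>) - exp_trace B (X u \<omega>)\<bar>) \<le> \<eta> / exp K"
    using exp_trace_mean_continuity[OF B T, of "\<eta> / exp K"] \<eta> by auto
  have "expectation (\<lambda>\<omega>. \<bar>min (rate B s \<omega>) K - min (rate B u \<omega>) K\<bar>) \<le> \<eta>"
    if su: "0 \<le> s" "s \<le> u" "u \<le> T" "u - s < d" for s u
  proof -
    have u0: "0 \<le> u" using su by simp
    have eq: "rate B s \<omega> = trace (B ** X s \<omega>)" "rate B u \<omega> = trace (B ** X u \<omega>)" for \<omega>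
      using su(1) u0 by (simp_all add: rate_def)
    have m: "(\<lambda>\<omega>. \<bar>exp_trace B (X s \<omega>) - exp_trace B (X u \<omega>)\<bar>) \<in> borel_measurable Q"
      using X_measurable[OF su(1)] X_measurable[OF u0] by measurable
    have "expectation (\<lambda>\<omega>. \<bar>min (rate B s \<omega>) K - min (rate B u \<omega>) K\<bar>)
        \<le> expectation (\<lambda>\<omega>. exp K * \<bar>exp_trace B (X s \<omega>) - exp_trace B (X u \<omega>)\<bar>)"
    proof (rule integral_mono)
      have "integrable Q (\<lambda>\<omega>. \<bar>exp_trace B (X s \<omega>) - exp_trace B (X u \<omega>)\<bar>)"
      proof (rule integrable_bounded[OF m, of 1])
        fix \<omega> assume \<omega>: "\<omega> \<in> space Q"
        have "0 < exp_trace B (X s \<omega>)" "0 < exp_trace B (X u \<omega>)" by simp_all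
        thus "\<bar>\<bar>exp_trace B (X s \<omega>) - exp_trace B (X u \<omega>)\<bar>\<bar> \<le> 1"
          using exp_trace_le_1[OF B X_psd[OF su(1) \<omega>]] exp_trace_le_1[OF B X_psd[OF u0 \<omega>]] by linarith
      qed
      thus "integrable Q (\<lambda>\<omega>. exp K * \<bar>exp_trace B (X s \<omega>) - exp_trace B (X u \<omega>)\<bar>)" by simp
      show "integrable Q (\<lambda>\<omega>. \<bar>min (rate B s \<omega>) K - min (rate B u \<omega>) K\<bar>)"
      proof (rule integrable_bounded[where C = K])
        fix \<omega> assume "\<omega> \<in> space Q"
        from truncated_rate_bounds[OF B this K, of s] truncated_rate_bounds[OF B this K, of u]
        show "\<bar>\<bar>min (rate B s \<omega>) K - min (rate B u \<omega>) K\<bar>\<bar> \<le> K" by linarith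
      qed measurable
      fix \<omega> assume \<omega>: "\<omega> \<in> space Q"
      show "\<bar>min (rate B s \<omega>) K - min (rate B u \<omega>) K\<bar> \<le> exp K * \<bar>exp_trace B (X s \<omega>) - exp_trace B (X u \<omega>)\<bar>"
        using abs_min_diff_le_exp[OF rate_nonneg[OF B \<omega>] rate_nonneg[OF B \<omega>] K, of s u] unfolding eq .
    qed
    also have "\<dots> = exp K * expectation (\<lambda>\<omega>. \<bar>exp_trace B (X s \<omega>) - exp_trace B (X u \<omega>)\<bar>)" by simp
    also have "\<dots> \<le> exp K * (\<eta> / exp K)" by (intro mult_left_mono d(2) su) simp
    finally show ?thesis by simp
  qed
  thus ?thesis using d(1) by blast
qed

section \<open>Riemann sums of the truncated rate\<close>

definition riemann_sum :: "real^'d^'d \<Rightarrow> real \<Rightarrow> real \<Rightarrow> real \<Rightarrow> nat \<Rightarrow> 'w \<Rightarrow> real" where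
  "riemann_sum B K h t k \<omega> = h * (\<Sum>j<k. min (rate B (t + real (Suc j) * h) \<omega>) K)"

lemma riemann_sum_measurable [measurable]: "riemann_sum B K h t k \<in> borel_measurable Q"
  unfolding riemann_sum_def[abs_def] by measurable

lemma riemann_sum_bounds:
  assumes "B \<in> psd" "\<omega> \<in> space Q" "0 \<le> K" "0 \<le> h"
  shows "0 \<le> riemann_sum B K h t k \<omega>" "riemann_sum B K h t k \<omega> \<le> K * (real k * h)"
proof -
  note tb = truncated_rate_bounds[OF assms(1-3)]
  show "0 \<le> riemann_sum B K h t k \<omega>"
    unfolding riemann_sum_def by (intro mult_nonneg_nonneg sum_nonneg tb assms(4))
  have "(\<Sum>j<k. min (rate B (t + real (Suc j) * h) \<omega>) K) \<le> real k * K"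
    using sum_bounded_above[of "{..<k}" "\<lambda>j. min (rate B (t + real (Suc j) * h) \<omega>) K" K] tb(2) by simp
  from mult_left_mono[OF this assms(4)] show "riemann_sum B K h t k \<omega> \<le> K * (real k * h)"
    by (simp add: riemann_sum_def ac_simps)
qed

lemma riemann_sum_error:
  assumes B: "B \<in> psd" and t: "0 \<le> t" and h: "0 \<le> h" and K: "0 \<le> K"
    and \<eta>: "\<And>s u. 0 \<le> s \<Longrightarrow> s \<le> u \<Longrightarrow> u \<le> t + real k * h \<Longrightarrow> u - s \<le> h \<Longrightarrow>
      expectation (\<lambda>\<omega>. \<bar>min (rate B s \<omega>) K - min (rate B u \<omega>) K\<bar>) \<le> \<eta>"
  shows "expectation (\<lambda>\<omega>. \<bar>rate_integral B K t (t + real k * h) \<omega> - riemann_sum B K h t k \<omega>\<bar>) \<le> real k * h * \<eta>"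
  using \<eta>
proof (induction k)
  case 0
  have "rate_integral B K t t \<omega> = 0" for \<omega> by (simp add: rate_integral_def set_lebesgue_integral_def)
  thus ?case by (simp add: riemann_sum_def)
next
  case (Suc k)
  let ?s = "t + real k * h"
  have s0: "0 \<le> ?s" using t h by simp
  have sh: "t + real (Suc k) * h = ?s + h" by (simp add: algebra_simps)
  let ?D = "\<lambda>\<omega>. \<bar>rate_integral B K t ?s \<omega> - riemann_sum B K h t k \<omega>\<bar>"
  let ?E = "\<lambda>\<omega>. \<bar>rate_integral B K ?s (?s + h) \<omega> - h * min (rate B (?s + h) \<omega>) K\<bar>"
  have D: "integrable Q ?D"
  proof (rule integrable_bounded[where C = "K * (real k * h)"])
    fix \<omega> assume \<omega>: "\<omega> \<in> space Q"
    show "\<bar>?D \<omega>\<bar> \<le> K * (real k * h)"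
      using rate_integral_bounds[OF B \<omega> K, of t ?s] riemann_sum_bounds[OF B \<omega> K h, of t k] h by (simp add: abs_le_iff)
  qed measurable
  have hb: "0 \<le> h * min (rate B u \<omega>) K" "h * min (rate B u \<omega>) K \<le> K * h" if "\<omega> \<in> space Q" for \<omega> u
    using truncated_rate_bounds[OF B that K, of u] h mult_left_mono[of "min (rate B u \<omega>) K" K h]
    by (auto intro!: mult_nonneg_nonneg simp: mult.commute)
  have E: "integrable Q ?E"
  proof (rule integrable_bounded[where C = "K * h"])
    fix \<omega> assume \<omega>: "\<omega> \<in> space Q"
    show "\<bar>?E \<omega>\<bar> \<le> K * h"
      using rate_integral_bounds[OF B \<omega> K, of ?s "?s + h"] hb[OF \<omega>, of "?s + h"] h by (simp add: abs_le_iff)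
  qed measurable
  have "expectation (\<lambda>\<omega>. \<bar>rate_integral B K t (?s + h) \<omega> - riemann_sum B K h t (Suc k) \<omega>\<bar>)
      \<le> expectation (\<lambda>\<omega>. ?D \<omega> + ?E \<omega>)"
  proof (rule integral_mono)
    show "integrable Q (\<lambda>\<omega>. ?D \<omega> + ?E \<omega>)" using D E by simp
    have eq: "rate_integral B K t (?s + h) \<omega> - riemann_sum B K h t (Suc k) \<omega>
        = (rate_integral B K t ?s \<omega> - riemann_sum B K h t k \<omega>)
          + (rate_integral B K ?s (?s + h) \<omega> - h * min (rate B (?s + h) \<omega>) K)" if \<omega>: "\<omega> \<in> space Q" for \<omega>
    proof -
      have "rate_integral B K t (?s + h) \<omega> = rate_integral B K t ?s \<omega> + rate_integral B K ?s (?s + h) \<omega>"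
        using h by (intro rate_integral_add[OF B \<omega> K]) auto
      moreover have "riemann_sum B K h t (Suc k) \<omega> = riemann_sum B K h t k \<omega> + h * min (rate B (?s + h) \<omega>) K"
        unfolding riemann_sum_def sh[symmetric] by (simp add: distrib_left del: of_nat_Suc)
      ultimately show ?thesis by simp
    qed
    show le: "\<bar>rate_integral B K t (?s + h) \<omega> - riemann_sum B K h t (Suc k) \<omega>\<bar> \<le> ?D \<omega> + ?E \<omega>"
      if "\<omega> \<in> space Q" for \<omega> unfolding eq[OF that] by (rule abs_triangle_ineq)
    show "integrable Q (\<lambda>\<omega>. \<bar>rate_integral B K t (?s + h) \<omega> - riemann_sum B K h t (Suc k) \<omega>\<bar>)"
    proof (rule Bochner_Integration.integrable_bound[OF Bochner_Integration.integrable_add[OF D E]])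
      show "AE \<omega> in Q. norm \<bar>rate_integral B K t (?s + h) \<omega> - riemann_sum B K h t (Suc k) \<omega>\<bar> \<le> norm (?D \<omega> + ?E \<omega>)"
      proof (rule AE_I2)
        fix \<omega> assume "\<omega> \<in> space Q"
        from le[OF this] show "norm \<bar>rate_integral B K t (?s + h) \<omega> - riemann_sum B K h t (Suc k) \<omega>\<bar> \<le> norm (?D \<omega> + ?E \<omega>)"
          by simp
      qed
    qed measurable
  qed
  also have "\<dots> = expectation ?D + expectation ?E" using D E by simp
  also have "\<dots> \<le> real k * h * \<eta> + h * \<eta>"
  proof (rule add_mono)
    show "expectation ?D \<le> real k * h * \<eta>"
      using h by (intro Suc.IH Suc.prems) (auto simp: algebra_simps)
    show "expectation ?E \<le> h * \<eta>"
      using s0 by (intro rate_integral_interval_error[OF B s0 h K] Suc.prems) (auto simp: algebra_simps)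
  qed
  also have "\<dots> = real (Suc k) * h * \<eta>" by (simp add: algebra_simps)
  finally show ?case unfolding sh .
qed

lemma integrable_riemann_diff:
  assumes B: "B \<in> psd" and K: "0 \<le> K" and h: "0 \<le> h" and st: "s \<le> u"
  shows "integrable Q (\<lambda>\<omega>. \<bar>riemann_sum B K h t k \<omega> - rate_integral B K s u \<omega>\<bar>)"
proof (rule integrable_bounded[where C = "K * (real k * h) + K * (u - s)"])
  fix \<omega> assume \<omega>: "\<omega> \<in> space Q"
  show "\<bar>\<bar>riemann_sum B K h t k \<omega> - rate_integral B K s u \<omega>\<bar>\<bar> \<le> K * (real k * h) + K * (u - s)"
    using rate_integral_bounds[OF B \<omega> K st] riemann_sum_bounds[OF B \<omega> K h, of t k] by (simp add: abs_le_iff)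
qed measurable

text \<open>Two errors: mean continuity over the complete steps, and at most
  \<open>K * mesh n\<close> from the incomplete step at the end.\<close>

lemma riemann_sum_tendsto:
  assumes B: "B \<in> psd" and t: "0 \<le> t" and \<tau>: "0 \<le> \<tau>" and K: "0 \<le> K"
  shows "(\<lambda>n. expectation (\<lambda>\<omega>. \<bar>riemann_sum B K (mesh n) t (steps n \<tau>) \<omega> - rate_integral B K t (t + \<tau>) \<omega>\<bar>)) \<longlonglongrightarrow> 0"
proof (rule LIMSEQ_I)
  fix e :: real assume e: "e > 0"
  \<comment> \<open>The error over complete steps is at most
    \<open>\<tau> * \<eta> \<le> e / 2\<close>; the \<open>+ 1\<close> covers
    \<open>\<tau> = 0\<close>.\<close>
  define \<eta> where "\<eta> = e / (2 * (\<tau> + 1))"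
  have \<eta>: "\<eta> > 0" using e \<tau> by (simp add: \<eta>_def)
  obtain d where d: "d > 0" "\<And>s u. 0 \<le> s \<Longrightarrow> s \<le> u \<Longrightarrow> u \<le> t + \<tau> \<Longrightarrow> u - s < d \<Longrightarrow>
    expectation (\<lambda>\<omega>. \<bar>min (rate B s \<omega>) K - min (rate B u \<omega>) K\<bar>) \<le> \<eta>"
    using truncated_rate_mean_continuity[OF B _ K \<eta>, of "t + \<tau>"] t \<tau> by auto
  have "(\<lambda>n. K * mesh n) \<longlonglongrightarrow> K * 0" by (intro tendsto_intros mesh_tendsto_0)
  hence "\<forall>\<^sub>F n in sequentially. K * mesh n < e / 2" using e by (intro order_tendstoD(2)) auto
  moreover have "\<forall>\<^sub>F n in sequentially. mesh n < d" by (rule order_tendstoD(2)[OF mesh_tendsto_0 d(1)])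
  ultimately have "\<forall>\<^sub>F n in sequentially. norm (expectation (\<lambda>\<omega>. \<bar>riemann_sum B K (mesh n) t (steps n \<tau>) \<omega> - rate_integral B K t (t + \<tau>) \<omega>\<bar>) - 0) < e"
  proof eventually_elim
    case (elim n)
    let ?h = "mesh n" and ?k = "steps n \<tau>"
    let ?s = "t + real ?k * ?h"
    have h: "0 \<le> ?h" using mesh_pos[of n] by simp
    have kh: "real ?k * ?h \<le> \<tau>" "\<tau> - ?h \<le> real ?k * ?h" "0 \<le> real ?k * ?h"
      using steps_bounds[OF \<tau>, of n] h by auto
    let ?D = "\<lambda>\<omega>. \<bar>rate_integral B K t ?s \<omega> - riemann_sum B K ?h t ?k \<omega>\<bar>"
    have D: "integrable Q ?D"
      using integrable_riemann_diff[OF B K h, of t ?s t ?k] kh(3) by (simp add: abs_minus_commute)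
    have "expectation (\<lambda>\<omega>. \<bar>riemann_sum B K ?h t ?k \<omega> - rate_integral B K t (t + \<tau>) \<omega>\<bar>)
        \<le> expectation (\<lambda>\<omega>. ?D \<omega> + K * ?h)"
    proof (rule integral_mono)
      show "integrable Q (\<lambda>\<omega>. \<bar>riemann_sum B K ?h t ?k \<omega> - rate_integral B K t (t + \<tau>) \<omega>\<bar>)"
        using \<tau> by (intro integrable_riemann_diff B K h) auto
      show "integrable Q (\<lambda>\<omega>. ?D \<omega> + K * ?h)" using D by simp
      fix \<omega> assume \<omega>: "\<omega> \<in> space Q"
      have "rate_integral B K t (t + \<tau>) \<omega> = rate_integral B K t ?s \<omega> + rate_integral B K ?s (t + \<tau>) \<omega>"
        using kh by (intro rate_integral_add[OF B \<omega> K]) auto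
      moreover have "0 \<le> rate_integral B K ?s (t + \<tau>) \<omega>" "rate_integral B K ?s (t + \<tau>) \<omega> \<le> K * (t + \<tau> - ?s)"
        using rate_integral_bounds[OF B \<omega> K, of ?s "t + \<tau>"] kh by auto
      moreover have "K * (t + \<tau> - ?s) \<le> K * ?h" using kh K by (intro mult_left_mono) auto
      ultimately show "\<bar>riemann_sum B K ?h t ?k \<omega> - rate_integral B K t (t + \<tau>) \<omega>\<bar> \<le> ?D \<omega> + K * ?h" by linarith
    qed
    also have "\<dots> = expectation ?D + K * ?h" using D by (simp add: prob_space)
    also have "expectation ?D \<le> real ?k * ?h * \<eta>"
    proof (rule riemann_sum_error[OF B t h K])
      fix s u assume su: "0 \<le> s" "s \<le> u" "u \<le> t + real ?k * ?h" "u - s \<le> ?h"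
      show "expectation (\<lambda>\<omega>. \<bar>min (rate B s \<omega>) K - min (rate B u \<omega>) K\<bar>) \<le> \<eta>"
        using su kh elim(2) by (intro d(2)) auto
    qed
    also have "real ?k * ?h * \<eta> \<le> \<tau> * \<eta>" using kh \<eta> by (intro mult_right_mono) auto
    also have "\<tau> * \<eta> \<le> e / 2"
    proof -
      have "\<tau> * \<eta> \<le> (\<tau> + 1) * \<eta>" using \<eta> by (intro mult_right_mono) auto
      also have "\<dots> = e / 2" using \<tau> by (simp add: \<eta>_def field_simps add_nonneg_eq_0_iff)
      finally show ?thesis .
    qed
    also have "e / 2 + K * ?h < e" using elim(1) by simp
    finally show ?case by simp
  qed
  thus "\<exists>no. \<forall>n\<ge>no. norm (expectation (\<lambda>\<omega>. \<bar>riemann_sum B K (mesh n) t (steps n \<tau>) \<omega> - rate_integral B K t (t + \<tau>) \<omega>\<bar>) - 0) < e"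
    by (simp add: eventually_sequentially)
qed

section \<open>Tightness and removal of the truncation\<close>

definition rate_exceeds :: "real^'d^'d \<Rightarrow> real \<Rightarrow> real \<Rightarrow> real \<Rightarrow> nat \<Rightarrow> 'w set" where
  "rate_exceeds B K h t k = {\<omega> \<in> space Q. \<exists>j<k. K < rate B (t + real (Suc j) * h) \<omega>}"

lemma rate_exceeds_event: "rate_exceeds B K h t k \<in> events"
  unfolding rate_exceeds_def by measurable

text \<open>Containment is uniform over finite sets of times, hence over all grids at once, and the
  rate is at most a constant times \<open>trace (X s)\<close>.\<close>

lemma rate_exceeds_tight:
  assumes B: "B \<in> psd" and t: "0 \<le> t" and \<tau>: "0 \<le> \<tau>" and \<eta>: "\<eta> > 0"
  shows "\<exists>K>0. \<forall>K'\<ge>K. \<forall>n. prob (rate_exceeds B K' (mesh n) t (steps n \<tau>)) \<le> \<eta>"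
proof -
  have T: "0 \<le> t + \<tau>" using t \<tau> by simp
  obtain K where K: "K > 0" "\<And>S. finite S \<Longrightarrow> S \<subseteq> {0..t + \<tau>} \<Longrightarrow> prob {\<omega> \<in> space Q. \<exists>s\<in>S. K < trace (X s \<omega>)} \<le> \<eta>"
    using compact_containment[OF T \<eta>] by auto
  \<comment> \<open>The \<open>+ 1\<close> keeps \<open>c\<close> positive for
    \<open>B = 0\<close>.\<close>
  define c where "c = norm B + 1"
  have c: "c > 0" "norm B \<le> c" by (auto simp: c_def add_nonneg_pos)
  have "prob (rate_exceeds B K' (mesh n) t (steps n \<tau>)) \<le> \<eta>" if K': "K' \<ge> c * K" for K' n
  proof -
    define S where "S = (\<lambda>j. t + real (Suc j) * mesh n) ` {..<steps n \<tau>}"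
    have S: "finite S" "S \<subseteq> {0..t + \<tau>}"
    proof -
      have "real (Suc j) * mesh n \<le> \<tau>" if "j < steps n \<tau>" for j
      proof -
        have "real (Suc j) * mesh n \<le> real (steps n \<tau>) * mesh n"
          using that mesh_pos[of n] by (intro mult_right_mono) auto
        thus ?thesis using steps_bounds(1)[OF \<tau>, of n] by simp
      qed
      thus "S \<subseteq> {0..t + \<tau>}" using t mesh_pos[of n] by (auto simp: S_def intro!: add_nonneg_nonneg)
    qed (simp add: S_def)
    have "rate_exceeds B K' (mesh n) t (steps n \<tau>) \<subseteq> {\<omega> \<in> space Q. \<exists>s\<in>S. K < trace (X s \<omega>)}"
    proof
      fix \<omega> assume "\<omega> \<in> rate_exceeds B K' (mesh n) t (steps n \<tau>)"
      then obtain s where \<omega>: "\<omega> \<in> space Q" and s: "s \<in> S" "K' < rate B s \<omega>"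
        unfolding rate_exceeds_def S_def by blast
      have s0: "0 \<le> s" using s S by auto
      have "rate B s \<omega> \<le> c * trace (X s \<omega>)"
        unfolding rate_def using s0
        by (simp add: trace_mult_upper[OF norm_mat_diff_psd(1)[OF psd_symmetric[OF B] c(2)] X_psd[OF s0 \<omega>]])
      hence "c * K < c * trace (X s \<omega>)" using K' s(2) by linarith
      hence "K < trace (X s \<omega>)" using c(1) by simp
      thus "\<omega> \<in> {\<omega> \<in> space Q. \<exists>s\<in>S. K < trace (X s \<omega>)}" using \<omega> s(1) by blast
    qed
    moreover have "{\<omega> \<in> space Q. \<exists>s\<in>S. K < trace (X s \<omega>)} \<in> events"
    proof (rule sets.sets_Collect_finite_Ex[OF _ S(1)])
      fix s assume "s \<in> S"
      hence "0 \<le> s" using S by auto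
      thus "{\<omega> \<in> space Q. K < trace (X s \<omega>)} \<in> events" using trace_X_measurable[of s] by measurable
    qed
    ultimately have "prob (rate_exceeds B K' (mesh n) t (steps n \<tau>)) \<le> prob {\<omega> \<in> space Q. \<exists>s\<in>S. K < trace (X s \<omega>)}"
      by (rule finite_measure_mono)
    also have "\<dots> \<le> \<eta>" by (rule K(2)[OF S])
    finally show ?thesis .
  qed
  thus ?thesis using c(1) K(1) by (intro exI[of _ "c * K"]) auto
qed

text \<open>The point is that \<open>L\<close> does not depend on the truncation level. Off the
  exceedance event the Riemann sum is at most \<open>K0 * \<tau>\<close>, so exceeding this by
  \<open>1\<close> needs a Riemann error of at least \<open>1\<close>, whose mean tends to
  \<open>0\<close>.\<close>

lemma rate_integral_tight:
  assumes B: "B \<in> psd" and t: "0 \<le> t" and \<tau>: "0 \<le> \<tau>" and \<eta>: "\<eta> > 0"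
  shows "\<exists>L\<ge>0. \<forall>K\<ge>0. prob {\<omega> \<in> space Q. L < rate_integral B K t (t + \<tau>) \<omega>} \<le> \<eta>"
proof -
  obtain K0 where K0: "K0 > 0" "\<And>n. prob (rate_exceeds B K0 (mesh n) t (steps n \<tau>)) \<le> \<eta>"
    using rate_exceeds_tight[OF assms] by blast
  have "prob {\<omega> \<in> space Q. K0 * \<tau> + 1 < rate_integral B K t (t + \<tau>) \<omega>} \<le> \<eta>" if K: "K \<ge> 0" for K
  proof -
    define A where "A = {\<omega> \<in> space Q. K0 * \<tau> + 1 < rate_integral B K t (t + \<tau>) \<omega>}"
    have A: "A \<in> events" unfolding A_def by measurable
    have tt: "t \<le> t + \<tau>" using \<tau> by simp
    let ?D = "\<lambda>n \<omega>. \<bar>riemann_sum B K (mesh n) t (steps n \<tau>) \<omega> - rate_integral B K t (t + \<tau>) \<omega>\<bar>"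
    have le: "prob A \<le> \<eta> + expectation (?D n)" for n
    proof -
      let ?E = "rate_exceeds B K0 (mesh n) t (steps n \<tau>)"
      have iE: "integrable Q (indicator ?E :: 'w \<Rightarrow> real)" "integrable Q (indicator A :: 'w \<Rightarrow> real)"
        using rate_exceeds_event A by (auto intro!: integrable_real_indicator simp: emeasure_eq_measure)
      have iD: "integrable Q (?D n)" by (rule integrable_riemann_diff[OF B K less_imp_le[OF mesh_pos] tt])
      have "prob A = expectation (indicator A)" using A sets.sets_into_space[OF A] by (simp add: Int_absorb2)
      also have "\<dots> \<le> expectation (\<lambda>\<omega>. indicator ?E \<omega> + ?D n \<omega>)"
      proof (rule integral_mono[OF iE(2) Bochner_Integration.integrable_add[OF iE(1) iD]])
        fix \<omega> assume \<omega>: "\<omega> \<in> space Q"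
        show "indicator A \<omega> \<le> indicator ?E \<omega> + ?D n \<omega>"
        proof (cases "\<omega> \<in> A \<and> \<omega> \<notin> ?E")
          case True
          have "min (rate B (t + real (Suc j) * mesh n) \<omega>) K \<le> K0" if "j < steps n \<tau>" for j
          proof -
            have "\<not> K0 < rate B (t + real (Suc j) * mesh n) \<omega>"
              using True that \<omega> unfolding rate_exceeds_def by blast
            thus ?thesis by linarith
          qed
          hence "(\<Sum>j<steps n \<tau>. min (rate B (t + real (Suc j) * mesh n) \<omega>) K) \<le> real (steps n \<tau>) * K0"
            using sum_bounded_above[of "{..<steps n \<tau>}" "\<lambda>j. min (rate B (t + real (Suc j) * mesh n) \<omega>) K" K0] by simp
          from mult_left_mono[OF this less_imp_le[OF mesh_pos]]
          have "riemann_sum B K (mesh n) t (steps n \<tau>) \<omega> \<le> K0 * (real (steps n \<tau>) * mesh n)"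
            unfolding riemann_sum_def by (simp add: ac_simps)
          also have "\<dots> \<le> K0 * \<tau>" using steps_bounds(1)[OF \<tau>] K0(1) by (intro mult_left_mono) auto
          finally have "1 \<le> ?D n \<omega>" using True by (simp add: A_def)
          thus ?thesis using True by (simp add: indicator_def)
        qed (auto simp: indicator_def)
      qed
      also have "\<dots> = prob ?E + expectation (?D n)"
        using iE iD sets.sets_into_space[OF rate_exceeds_event] by (simp add: Int_absorb2)
      also have "\<dots> \<le> \<eta> + expectation (?D n)" using K0(2) by simp
      finally show ?thesis .
    qed
    have "(\<lambda>n. \<eta> + expectation (?D n)) \<longlonglongrightarrow> \<eta> + 0"
      by (intro tendsto_add tendsto_const riemann_sum_tendsto B t \<tau> K)
    hence "prob A \<le> \<eta> + 0" by (rule LIMSEQ_le_const) (use le in auto)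
    thus ?thesis by (simp add: A_def)
  qed
  thus ?thesis using K0(1) \<tau> by (intro exI[of _ "K0 * \<tau> + 1"]) auto
qed

text \<open>The extended integral \<open>N\<close> is the supremum of the truncated integrals. If it
  is infinite, some truncated integral exceeds \<open>L\<close>; these events increase with the
  level and all have probability at most \<open>\<eta>\<close>, with \<open>\<eta>\<close>
  arbitrary.\<close>

lemma AE_rate_integrable:
  assumes B: "B \<in> psd" and t: "0 \<le> t" and \<tau>: "0 \<le> \<tau>"
  shows "AE \<omega> in Q. set_integrable lborel {t<..t + \<tau>} (\<lambda>u. rate B u \<omega>)"
proof -
  define N where "N \<omega> = (\<integral>\<^sup>+u. ennreal (indicator {t<..t + \<tau>} u * rate B u \<omega>) \<partial>lborel)" for \<omega>
  have Nm: "N \<in> borel_measurable Q"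
  proof -
    have "(\<lambda>(\<omega>, u). ennreal (indicator {t<..t + \<tau>} u * rate B u \<omega>)) \<in> borel_measurable (Q \<Otimes>\<^sub>M lborel)"
      using rate_measurable_pair[of B] unfolding case_prod_beta by measurable
    from lborel.borel_measurable_nn_integral[OF this] show ?thesis unfolding N_def[abs_def] by simp
  qed
  have N_sup: "N \<omega> = (SUP i. ennreal (rate_integral B (real i) t (t + \<tau>) \<omega>))" if \<omega>: "\<omega> \<in> space Q" for \<omega>
  proof -
    have m: "(\<lambda>u. rate B u \<omega>) \<in> borel_measurable lborel" by (rule rate_path_measurable[OF \<omega>])
    have nn: "0 \<le> rate B u \<omega>" for u by (rule rate_nonneg[OF B \<omega>])
    have sup: "ennreal (indicator {t<..t + \<tau>} u * rate B u \<omega>)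
        = (SUP i. ennreal (indicator {t<..t + \<tau>} u * min (rate B u \<omega>) (real i)))" for u
    proof (rule antisym)
      obtain i where "rate B u \<omega> \<le> real i" using real_arch_simple by blast
      thus "ennreal (indicator {t<..t + \<tau>} u * rate B u \<omega>)
        \<le> (SUP i. ennreal (indicator {t<..t + \<tau>} u * min (rate B u \<omega>) (real i)))"
        by (intro SUP_upper2[of i]) (auto simp: min_def)
      show "(SUP i. ennreal (indicator {t<..t + \<tau>} u * min (rate B u \<omega>) (real i)))
        \<le> ennreal (indicator {t<..t + \<tau>} u * rate B u \<omega>)"
        by (intro SUP_least ennreal_leI mult_left_mono) auto
    qed
    have J: "(\<integral>\<^sup>+u. ennreal (indicator {t<..t + \<tau>} u * min (rate B u \<omega>) (real i)) \<partial>lborel)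
        = ennreal (rate_integral B (real i) t (t + \<tau>) \<omega>)" for i
    proof -
      have "integrable lborel (\<lambda>u. indicator {t<..t + \<tau>} u * min (rate B u \<omega>) (real i))"
        using set_integrable_truncated_rate[OF B \<omega>, of "real i" t "t + \<tau>"] by (simp add: set_integrable_def)
      thus ?thesis
        unfolding rate_integral_def set_lebesgue_integral_def
        using nn by (subst nn_integral_eq_integral) auto
    qed
    have "N \<omega> = (SUP i. \<integral>\<^sup>+u. ennreal (indicator {t<..t + \<tau>} u * min (rate B u \<omega>) (real i)) \<partial>lborel)"
      unfolding N_def sup
    proof (rule nn_integral_monotone_convergence_SUP)
      show "incseq (\<lambda>i u. ennreal (indicator {t<..t + \<tau>} u * min (rate B u \<omega>) (real i)))"
        by (intro incseq_SucI le_funI ennreal_leI mult_left_mono) auto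
      show "(\<lambda>u. ennreal (indicator {t<..t + \<tau>} u * min (rate B u \<omega>) (real i))) \<in> borel_measurable lborel" for i
        using m by measurable
    qed
    thus ?thesis unfolding J .
  qed
  have small: "prob {\<omega> \<in> space Q. N \<omega> = \<infinity>} \<le> \<eta>" if \<eta>: "\<eta> > 0" for \<eta>
  proof -
    obtain L where L: "L \<ge> 0" "\<And>K. K \<ge> 0 \<Longrightarrow> prob {\<omega> \<in> space Q. L < rate_integral B K t (t + \<tau>) \<omega>} \<le> \<eta>"
      using rate_integral_tight[OF B t \<tau> \<eta>] by blast
    define A where "A i = {\<omega> \<in> space Q. L < rate_integral B (real i) t (t + \<tau>) \<omega>}" for i :: nat
    have A: "range A \<subseteq> events" unfolding A_def by auto
    have inc: "incseq A"
    proof (rule incseq_SucI)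
      fix i
      have "rate_integral B (real i) t (t + \<tau>) \<omega> \<le> rate_integral B (real (Suc i)) t (t + \<tau>) \<omega>"
        if "\<omega> \<in> space Q" for \<omega>
        unfolding rate_integral_def
        by (intro set_integral_mono set_integrable_truncated_rate B that) auto
      thus "A i \<subseteq> A (Suc i)" unfolding A_def by (auto intro: less_le_trans)
    qed
    have "{\<omega> \<in> space Q. N \<omega> = \<infinity>} \<subseteq> (\<Union>i. A i)"
    proof
      fix \<omega> assume \<omega>: "\<omega> \<in> {\<omega> \<in> space Q. N \<omega> = \<infinity>}"
      show "\<omega> \<in> (\<Union>i. A i)"
      proof (rule ccontr)
        assume "\<omega> \<notin> (\<Union>i. A i)"
        hence "rate_integral B (real i) t (t + \<tau>) \<omega> \<le> L" for i using \<omega> by (auto simp: A_def not_less)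
        hence "(SUP i. ennreal (rate_integral B (real i) t (t + \<tau>) \<omega>)) \<le> ennreal L"
          by (intro SUP_least ennreal_leI)
        thus False using \<omega> N_sup[of \<omega>] by (auto simp: top_unique)
      qed
    qed
    hence "prob {\<omega> \<in> space Q. N \<omega> = \<infinity>} \<le> prob (\<Union>i. A i)"
      using A by (intro finite_measure_mono sets.countable_UN) auto
    also have "\<dots> \<le> \<eta>"
    proof (rule LIMSEQ_le_const2[OF finite_Lim_measure_incseq[OF A inc]])
      show "\<exists>N. \<forall>n\<ge>N. prob (A n) \<le> \<eta>" using L(2) by (auto simp: A_def)
    qed
    finally show ?thesis .
  qed
  have "prob {\<omega> \<in> space Q. N \<omega> = \<infinity>} = 0"
    using small by (meson dense_ge antisym measure_nonneg)
  hence "AE \<omega> in Q. N \<omega> \<noteq> \<infinity>"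
  proof -
    have "{\<omega> \<in> space Q. N \<omega> = \<infinity>} \<in> events" using Nm by measurable
    hence "{\<omega> \<in> space Q. N \<omega> = \<infinity>} \<in> null_sets Q"
      using \<open>prob {\<omega> \<in> space Q. N \<omega> = \<infinity>} = 0\<close> by (auto simp: null_sets_def emeasure_eq_measure)
    thus ?thesis by (intro AE_I'[of "{\<omega> \<in> space Q. N \<omega> = \<infinity>}"]) auto
  qed
  thus ?thesis
  proof (rule AE_mp, intro AE_I2 impI)
    fix \<omega> assume \<omega>: "\<omega> \<in> space Q" and "N \<omega> \<noteq> \<infinity>"
    hence "(\<integral>\<^sup>+u. ennreal (indicator {t<..t + \<tau>} u * rate B u \<omega>) \<partial>lborel) < \<infinity>" by (simp add: N_def less_top)
    moreover have "(\<lambda>u. indicator {t<..t + \<tau>} u * rate B u \<omega>) \<in> borel_measurable lborel"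
      using rate_path_measurable[OF \<omega>] by measurable
    ultimately show "set_integrable lborel {t<..t + \<tau>} (\<lambda>u. rate B u \<omega>)"
      unfolding set_integrable_def real_scaleR_def using rate_nonneg[OF B \<omega>] by (intro integrableI_nonneg) auto
  qed
qed

section \<open>The Feynman-Kac formula\<close>

lemma splitting_fst_nonneg:
  assumes "B \<in> psd" "0 \<le> h"
  shows "0 \<le> fst (splitting B h k)"
  by (induction k) (auto intro!: add_nonneg_nonneg phi_nonneg psd_add splitting_psd psd_scaleR assms)

lemma rate_integral_tendsto:
  assumes B: "B \<in> psd" and \<omega>: "\<omega> \<in> space Q" and int: "set_integrable lborel {s<..t} (\<lambda>u. rate B u \<omega>)"
  shows "(\<lambda>i. rate_integral B (real i) s t \<omega>) \<longlonglongrightarrow> (LINT u:{s<..t}|lborel. rate B u \<omega>)"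
  unfolding rate_integral_def set_lebesgue_integral_def real_scaleR_def
proof (rule integral_dominated_convergence[where w = "\<lambda>u. indicator {s<..t} u * rate B u \<omega>"])
  have m: "(\<lambda>u. rate B u \<omega>) \<in> borel_measurable lborel" by (rule rate_path_measurable[OF \<omega>])
  show "(\<lambda>u. indicator {s<..t} u * rate B u \<omega>) \<in> borel_measurable lborel"
    "(\<lambda>u. indicator {s<..t} u * min (rate B u \<omega>) (real i)) \<in> borel_measurable lborel" for i
    using m by measurable
  show "integrable lborel (\<lambda>u. indicator {s<..t} u * rate B u \<omega>)" using int by (simp add: set_integrable_def)
  show "AE u in lborel. (\<lambda>i. indicator {s<..t} u * min (rate B u \<omega>) (real i)) \<longlonglongrightarrow> indicator {s<..t} u * rate B u \<omega>"
  proof (rule AE_I2)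
    fix u
    obtain i0 where i0: "rate B u \<omega> \<le> real i0" using real_arch_simple by blast
    have "\<forall>\<^sub>F i in sequentially. indicator {s<..t} u * rate B u \<omega> = indicator {s<..t} u * min (rate B u \<omega>) (real i)"
      using eventually_ge_at_top[of i0] by eventually_elim (use i0 in \<open>simp add: min_def\<close>)
    thus "(\<lambda>i. indicator {s<..t} u * min (rate B u \<omega>) (real i)) \<longlonglongrightarrow> indicator {s<..t} u * rate B u \<omega>"
      by (rule Lim_transform_eventually[OF tendsto_const])
  qed
  show "AE u in lborel. norm (indicator {s<..t} u * min (rate B u \<omega>) (real i)) \<le> indicator {s<..t} u * rate B u \<omega>" for i
    by (rule AE_I2) (use rate_nonneg[OF B \<omega>] in \<open>auto simp: abs_mult indicator_def\<close>)
qed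

text \<open>The untruncated Riemann sums have explicit expectations, which converge to the right
  side along \<open>r\<close>. Their comparison with the time integral passes through the truncated
  rate, and the two limits combine because the exceedance probability is small uniformly in the
  mesh.\<close>

theorem feynman_kac:
  assumes B: "B \<in> psd" and t: "0 \<le> t" and \<tau>: "0 \<le> \<tau>" and r: "strict_mono r"
    and z: "(\<lambda>n. splitting_at B (r n) \<tau>) \<longlonglongrightarrow> z"
    and A: "A \<in> sets (\<F> t)"
  shows "expectation (\<lambda>\<omega>. indicator A \<omega> * exp (- (LINT u:{t<..t + \<tau>}|lborel. rate B u \<omega>)))
    = expectation (\<lambda>\<omega>. indicator A \<omega> * exp (- fst z - trace (snd z ** X t \<omega>)))"
proof -
  define I where "I \<omega> = (LINT u:{t<..t + \<tau>}|lborel. rate B u \<omega>)" for \<omega>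
  define c where "c = expectation (\<lambda>\<omega>. indicator A \<omega> * exp (- fst z - trace (snd z ** X t \<omega>)))"
  have A': "A \<in> events" using A subalgebra_filtration[OF t] by (auto simp: subalgebra_def)
  have tt: "t \<le> t + \<tau>" using \<tau> by simp
  have Xm [measurable]: "X t \<in> borel_measurable Q" by (rule X_measurable[OF t])
  define S where "S n \<omega> = mesh n * (\<Sum>j<steps n \<tau>. rate B (t + real (Suc j) * mesh n) \<omega>)" for n \<omega>
  have Sm [measurable]: "S n \<in> borel_measurable Q" for n unfolding S_def[abs_def] by measurable
  have S0: "0 \<le> S n \<omega>" if "\<omega> \<in> space Q" for n \<omega>
    unfolding S_def using rate_nonneg[OF B that] mesh_pos[of n] by (intro mult_nonneg_nonneg sum_nonneg) auto
  have int: "integrable Q (\<lambda>\<omega>. indicator A \<omega> * exp (- f \<omega>))"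
    if "f \<in> borel_measurable Q" "\<And>\<omega>. \<omega> \<in> space Q \<Longrightarrow> 0 \<le> f \<omega>" for f :: "'w \<Rightarrow> real"
    by (rule integrable_indicator_bounded[OF A', where C = 1]) (use that in auto)
  have ES: "expectation (\<lambda>\<omega>. indicator A \<omega> * exp (- S n \<omega>))
      = expectation (\<lambda>\<omega>. indicator A \<omega> * exp (- fst (splitting_at B n \<tau>) - trace (snd (splitting_at B n \<tau>) ** X t \<omega>)))" for n
  proof -
    have "rate B (t + real (Suc j) * mesh n) \<omega> = trace (B ** X (t + real (Suc j) * mesh n) \<omega>)" for j \<omega>
    proof -
      have "0 \<le> t + real (Suc j) * mesh n" using t mesh_pos[of n] by (intro add_nonneg_nonneg mult_nonneg_nonneg) auto
      thus ?thesis by (simp add: rate_def max_def)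
    qed
    hence S_eq: "S n = (\<lambda>\<omega>. mesh n * (\<Sum>j<steps n \<tau>. trace (B ** X (t + real (Suc j) * mesh n) \<omega>)))"
      by (simp only: S_def[abs_def])
    have "(indicator A :: 'w \<Rightarrow> real) \<in> borel_measurable (\<F> t)" using A by simp
    from expectation_splitting[OF B mesh_pos t this, of 1 n "steps n \<tau>"]
    show ?thesis unfolding splitting_at_def S_eq by (simp add: indicator_def)
  qed
  have "(\<lambda>n. expectation (\<lambda>\<omega>. indicator A \<omega> * exp (- fst (splitting_at B (r n) \<tau>) - trace (snd (splitting_at B (r n) \<tau>) ** X t \<omega>)))) \<longlonglongrightarrow> c"
    unfolding c_def
  proof (rule integral_dominated_convergence[where w = "\<lambda>_. 1"])
    show "(\<lambda>\<omega>. indicator A \<omega> * exp (- fst z - trace (snd z ** X t \<omega>))) \<in> borel_measurable Q"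
      "(\<lambda>\<omega>. indicator A \<omega> * exp (- fst (splitting_at B (r n) \<tau>) - trace (snd (splitting_at B (r n) \<tau>) ** X t \<omega>))) \<in> borel_measurable Q" for n
      using A' by measurable
    show "AE \<omega> in Q. (\<lambda>n. indicator A \<omega> * exp (- fst (splitting_at B (r n) \<tau>) - trace (snd (splitting_at B (r n) \<tau>) ** X t \<omega>)))
        \<longlonglongrightarrow> indicator A \<omega> * exp (- fst z - trace (snd z ** X t \<omega>))"
      by (intro AE_I2 tendsto_intros z)
    show "AE \<omega> in Q. norm (indicator A \<omega> * exp (- fst (splitting_at B (r n) \<tau>) - trace (snd (splitting_at B (r n) \<tau>) ** X t \<omega>))) \<le> 1" for n
    proof (rule AE_I2)
      fix \<omega> assume \<omega>: "\<omega> \<in> space Q"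
      have "0 \<le> fst (splitting_at B (r n) \<tau>)" "0 \<le> trace (snd (splitting_at B (r n) \<tau>) ** X t \<omega>)"
        unfolding splitting_at_def using mesh_pos[of "r n"]
        by (auto intro!: splitting_fst_nonneg trace_mult_psd_nonneg splitting_psd B X_psd t \<omega>)
      thus "norm (indicator A \<omega> * exp (- fst (splitting_at B (r n) \<tau>) - trace (snd (splitting_at B (r n) \<tau>) ** X t \<omega>))) \<le> 1"
        by (simp add: indicator_def)
    qed
  qed simp
  hence lim_c: "(\<lambda>n. expectation (\<lambda>\<omega>. indicator A \<omega> * exp (- S (r n) \<omega>))) \<longlonglongrightarrow> c" unfolding ES .
  \<comment> \<open>The mesh limit is taken here at fixed \<open>K\<close>; what survives is the
    exceedance probability, at most \<open>\<eta>\<close>.\<close>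
  have close: "\<exists>K0. \<forall>K\<ge>K0. \<bar>c - expectation (\<lambda>\<omega>. indicator A \<omega> * exp (- rate_integral B K t (t + \<tau>) \<omega>))\<bar> \<le> \<eta>"
    if \<eta>: "\<eta> > 0" for \<eta>
  proof -
    obtain K0 where K0: "K0 > 0" "\<And>K n. K \<ge> K0 \<Longrightarrow> prob (rate_exceeds B K (mesh n) t (steps n \<tau>)) \<le> \<eta>"
      using rate_exceeds_tight[OF B t \<tau> \<eta>] by blast
    have "\<bar>c - expectation (\<lambda>\<omega>. indicator A \<omega> * exp (- rate_integral B K t (t + \<tau>) \<omega>))\<bar> \<le> \<eta>" if KK: "K \<ge> K0" for K
    proof -
      have K: "0 \<le> K" using KK K0(1) by simp
      let ?J = "rate_integral B K t (t + \<tau>)"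
      let ?D = "\<lambda>n \<omega>. \<bar>riemann_sum B K (mesh n) t (steps n \<tau>) \<omega> - ?J \<omega>\<bar>"
      have J0: "0 \<le> ?J \<omega>" if "\<omega> \<in> space Q" for \<omega> by (rule rate_integral_bounds(1)[OF B that K tt])
      have le: "\<bar>expectation (\<lambda>\<omega>. indicator A \<omega> * exp (- S n \<omega>)) - expectation (\<lambda>\<omega>. indicator A \<omega> * exp (- ?J \<omega>))\<bar>
          \<le> \<eta> + expectation (?D n)" for n
      proof -
        let ?E = "rate_exceeds B K (mesh n) t (steps n \<tau>)"
        have iE: "integrable Q (indicator ?E :: 'w \<Rightarrow> real)"
          using rate_exceeds_event by (auto intro!: integrable_real_indicator simp: emeasure_eq_measure)
        have iD: "integrable Q (?D n)" by (rule integrable_riemann_diff[OF B K less_imp_le[OF mesh_pos] tt])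
        have i: "integrable Q (\<lambda>\<omega>. indicator A \<omega> * exp (- S n \<omega>))" "integrable Q (\<lambda>\<omega>. indicator A \<omega> * exp (- ?J \<omega>))"
          by (intro int S0 J0 Sm rate_integral_measurable; assumption)+
        have "\<bar>expectation (\<lambda>\<omega>. indicator A \<omega> * exp (- S n \<omega>)) - expectation (\<lambda>\<omega>. indicator A \<omega> * exp (- ?J \<omega>))\<bar>
            = \<bar>expectation (\<lambda>\<omega>. indicator A \<omega> * exp (- S n \<omega>) - indicator A \<omega> * exp (- ?J \<omega>))\<bar>"
          using i by simp
        also have "\<dots> \<le> expectation (\<lambda>\<omega>. \<bar>indicator A \<omega> * exp (- S n \<omega>) - indicator A \<omega> * exp (- ?J \<omega>)\<bar>)"
          by (rule integral_abs_bound)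
        also have "\<dots> \<le> expectation (\<lambda>\<omega>. indicator ?E \<omega> + ?D n \<omega>)"
        proof (rule integral_mono)
          show "integrable Q (\<lambda>\<omega>. indicator ?E \<omega> + ?D n \<omega>)" using iE iD by simp
          show "integrable Q (\<lambda>\<omega>. \<bar>indicator A \<omega> * exp (- S n \<omega>) - indicator A \<omega> * exp (- ?J \<omega>)\<bar>)" using i by auto
          fix \<omega> assume \<omega>: "\<omega> \<in> space Q"
          have e1: "\<bar>indicator A \<omega> * exp (- S n \<omega>) - indicator A \<omega> * exp (- ?J \<omega>)\<bar> \<le> \<bar>exp (- S n \<omega>) - exp (- ?J \<omega>)\<bar>"
            by (simp add: indicator_def)
          show "\<bar>indicator A \<omega> * exp (- S n \<omega>) - indicator A \<omega> * exp (- ?J \<omega>)\<bar> \<le> indicator ?E \<omega> + ?D n \<omega>"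
          proof (cases "\<omega> \<in> ?E")
            case True
            have "exp (- S n \<omega>) \<le> 1" "exp (- ?J \<omega>) \<le> 1" "0 < exp (- S n \<omega>)" "0 < exp (- ?J \<omega>)"
              using S0[OF \<omega>, of n] J0[OF \<omega>] by auto
            hence "\<bar>exp (- S n \<omega>) - exp (- ?J \<omega>)\<bar> \<le> 1" by linarith
            moreover have "indicator ?E \<omega> = (1 :: real)" "0 \<le> ?D n \<omega>" using True by auto
            ultimately show ?thesis using e1 by linarith
          next
            case False
            have "rate B (t + real (Suc j) * mesh n) \<omega> \<le> K" if "j < steps n \<tau>" for j
            proof (rule ccontr)
              assume "\<not> rate B (t + real (Suc j) * mesh n) \<omega> \<le> K"
              hence "K < rate B (t + real (Suc j) * mesh n) \<omega>" by simp
              thus False using False that \<omega> unfolding rate_exceeds_def by blast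
            qed
            \<comment> \<open>Off the exceedance event truncation changes no sampled value, so only
              the Riemann error of the truncated rate is left.\<close>
            hence "S n \<omega> = riemann_sum B K (mesh n) t (steps n \<tau>) \<omega>"
              unfolding S_def riemann_sum_def by (intro arg_cong2[where f = "(*)"] sum.cong refl) (simp add: min_def)
            hence "\<bar>exp (- S n \<omega>) - exp (- ?J \<omega>)\<bar> \<le> ?D n \<omega>"
              using abs_exp_minus_diff_le[OF S0[OF \<omega>, of n] J0[OF \<omega>]] by simp
            thus ?thesis using e1 False by simp
          qed
        qed
        also have "\<dots> = prob ?E + expectation (?D n)"
          using iE iD sets.sets_into_space[OF rate_exceeds_event] by (simp add: Int_absorb2)
        also have "\<dots> \<le> \<eta> + expectation (?D n)" using K0(2)[OF KK] by simp
        finally show ?thesis .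
      qed
      have "(\<lambda>n. \<bar>expectation (\<lambda>\<omega>. indicator A \<omega> * exp (- S (r n) \<omega>)) - expectation (\<lambda>\<omega>. indicator A \<omega> * exp (- ?J \<omega>))\<bar>)
          \<longlonglongrightarrow> \<bar>c - expectation (\<lambda>\<omega>. indicator A \<omega> * exp (- ?J \<omega>))\<bar>"
        by (intro tendsto_rabs tendsto_diff lim_c tendsto_const)
      moreover have "(\<lambda>n. \<eta> + expectation (?D (r n))) \<longlonglongrightarrow> \<eta> + 0"
        using LIMSEQ_subseq_LIMSEQ[OF riemann_sum_tendsto[OF B t \<tau> K] r] unfolding o_def
        by (intro tendsto_add tendsto_const)
      ultimately have "\<bar>c - expectation (\<lambda>\<omega>. indicator A \<omega> * exp (- ?J \<omega>))\<bar> \<le> \<eta> + 0"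
        by (rule LIMSEQ_le) (use le in auto)
      thus ?thesis by simp
    qed
    thus ?thesis by blast
  qed
  have Im: "I \<in> borel_measurable Q" unfolding I_def[abs_def] by (rule set_integral_rate_measurable)
  have lim_I: "(\<lambda>i. expectation (\<lambda>\<omega>. indicator A \<omega> * exp (- rate_integral B (real i) t (t + \<tau>) \<omega>)))
      \<longlonglongrightarrow> expectation (\<lambda>\<omega>. indicator A \<omega> * exp (- I \<omega>))"
  proof (rule integral_dominated_convergence[where w = "\<lambda>_. 1"])
    show "(\<lambda>\<omega>. indicator A \<omega> * exp (- I \<omega>)) \<in> borel_measurable Q"
      "(\<lambda>\<omega>. indicator A \<omega> * exp (- rate_integral B (real i) t (t + \<tau>) \<omega>)) \<in> borel_measurable Q" for i
      using A' Im by measurable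
    show "AE \<omega> in Q. (\<lambda>i. indicator A \<omega> * exp (- rate_integral B (real i) t (t + \<tau>) \<omega>)) \<longlonglongrightarrow> indicator A \<omega> * exp (- I \<omega>)"
      using AE_rate_integrable[OF B t \<tau>]
    proof (rule AE_mp, intro AE_I2 impI)
      fix \<omega> assume "\<omega> \<in> space Q" "set_integrable lborel {t<..t + \<tau>} (\<lambda>u. rate B u \<omega>)"
      from rate_integral_tendsto[OF B this]
      show "(\<lambda>i. indicator A \<omega> * exp (- rate_integral B (real i) t (t + \<tau>) \<omega>)) \<longlonglongrightarrow> indicator A \<omega> * exp (- I \<omega>)"
        unfolding I_def by (intro tendsto_intros)
    qed
    show "AE \<omega> in Q. norm (indicator A \<omega> * exp (- rate_integral B (real i) t (t + \<tau>) \<omega>)) \<le> 1" for i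
      by (rule AE_I2) (use rate_integral_bounds(1)[OF B _ _ tt] in \<open>auto simp: indicator_def\<close>)
  qed simp
  have "\<bar>c - expectation (\<lambda>\<omega>. indicator A \<omega> * exp (- I \<omega>))\<bar> \<le> \<eta>" if \<eta>: "\<eta> > 0" for \<eta>
  proof (rule LIMSEQ_le_const2)
    show "(\<lambda>i. \<bar>c - expectation (\<lambda>\<omega>. indicator A \<omega> * exp (- rate_integral B (real i) t (t + \<tau>) \<omega>))\<bar>)
        \<longlonglongrightarrow> \<bar>c - expectation (\<lambda>\<omega>. indicator A \<omega> * exp (- I \<omega>))\<bar>"
      by (intro tendsto_rabs tendsto_diff tendsto_const lim_I)
    obtain K0 where K0: "\<And>K. K \<ge> K0 \<Longrightarrow> \<bar>c - expectation (\<lambda>\<omega>. indicator A \<omega> * exp (- rate_integral B K t (t + \<tau>) \<omega>))\<bar> \<le> \<eta>"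
      using close[OF \<eta>] by blast
    obtain i0 where "K0 \<le> real i0" using real_arch_simple by blast
    thus "\<exists>N. \<forall>n\<ge>N. \<bar>c - expectation (\<lambda>\<omega>. indicator A \<omega> * exp (- rate_integral B (real n) t (t + \<tau>) \<omega>))\<bar> \<le> \<eta>"
      by (intro exI[of _ i0] allI impI K0) simp
  qed
  hence "\<bar>c - expectation (\<lambda>\<omega>. indicator A \<omega> * exp (- I \<omega>))\<bar> \<le> 0" by (rule field_le_epsilon) simp
  thus ?thesis by (simp add: c_def I_def)
qed


section \<open>Conditional expectation and the constant part of the rate\<close>

lemma set_integral_rate_closed:
  assumes \<omega>: "\<omega> \<in> space Q" and t: "0 \<le> t" and tT: "t \<le> T"
    and int: "set_integrable lborel {t<..T} (\<lambda>u. rate B u \<omega>)"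
  shows "(LINT u:{t..T}|lborel. a + trace (B ** X u \<omega>)) = a * (T - t) + (LINT u:{t<..T}|lborel. rate B u \<omega>)"
proof -
  have m: "(\<lambda>u. rate B u \<omega>) \<in> borel_measurable lborel" by (rule rate_path_measurable[OF \<omega>])
  have "(LINT u:{t..T}|lborel. a + trace (B ** X u \<omega>)) = (LINT u|lborel. indicator {t..T} u *\<^sub>R (a + rate B u \<omega>))"
    unfolding set_lebesgue_integral_def
    by (rule Bochner_Integration.integral_cong) (use t in \<open>auto simp: indicator_def rate_def max_def\<close>)
  also have "\<dots> = (LINT u|lborel. indicator {t<..T} u *\<^sub>R (a + rate B u \<omega>))"
  proof (rule integral_cong_AE)
    show "(\<lambda>u. indicator {t..T} u *\<^sub>R (a + rate B u \<omega>)) \<in> borel_measurable lborel"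
      "(\<lambda>u. indicator {t<..T} u *\<^sub>R (a + rate B u \<omega>)) \<in> borel_measurable lborel"
      using m by measurable
    show "AE u in lborel. indicator {t..T} u *\<^sub>R (a + rate B u \<omega>) = indicator {t<..T} u *\<^sub>R (a + rate B u \<omega>)"
      using AE_lborel_singleton[of t] by eventually_elim (auto simp: indicator_def)
  qed
  also have "\<dots> = (LINT u:{t<..T}|lborel. a) + (LINT u:{t<..T}|lborel. rate B u \<omega>)"
    unfolding set_lebesgue_integral_def[symmetric]
    by (rule set_integral_add(2)[OF _ int]) (use tT in \<open>auto simp: set_integrable_def\<close>)
  also have "(LINT u:{t<..T}|lborel. a) = a * (T - t)"
    using tT by (simp add: set_integral_const mult.commute)
  finally show ?thesis .
qed

text \<open>A conditional expectation is characterized by its integrals over the events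
  \<open>A\<close> of the past, which \<open>feynman_kac\<close> computes;
  \<open>exp (- a (T - t))\<close> is a deterministic factor.\<close>

theorem bond_price:
  assumes B: "B \<in> psd" and a: "0 \<le> a" and t: "0 \<le> t" and tT: "t \<le> T" and r: "strict_mono r"
    and z: "(\<lambda>n. splitting_at B (r n) (T - t)) \<longlonglongrightarrow> z"
  shows "AE \<omega> in Q. real_cond_exp Q (\<F> t) (\<lambda>\<omega>. exp (- (LINT u:{t..T}|lborel. a + trace (B ** X u \<omega>)))) \<omega>
    = exp (- (fst z + a * (T - t)) - trace (snd z ** X t \<omega>))"
proof -
  interpret S: finite_measure_subalgebra Q "\<F> t"
    by unfold_locales (rule subalgebra_filtration[OF t])
  let ?f = "\<lambda>\<omega>. exp (- (LINT u:{t..T}|lborel. a + trace (B ** X u \<omega>)))"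
  let ?g = "\<lambda>\<omega>. exp (- (fst z + a * (T - t)) - trace (snd z ** X t \<omega>))"
  have \<tau>: "0 \<le> T - t" "t + (T - t) = T" using tT by auto
  have f_eq: "?f \<omega> = exp (- (LINT u|lborel. indicator {t..T} u * (a + rate B u \<omega>)))" for \<omega>
    unfolding set_lebesgue_integral_def
    by (intro arg_cong[where f = exp] arg_cong[where f = uminus] Bochner_Integration.integral_cong)
       (use t in \<open>auto simp: indicator_def rate_def max_def\<close>)
  have fm: "?f \<in> borel_measurable Q"
  proof -
    have "(\<lambda>\<omega>. LINT u|lborel. indicator {t..T} u * (a + rate B u \<omega>)) \<in> borel_measurable Q"
      by (rule path_integral_measurable) (use rate_measurable_pair[of B] in \<open>unfold case_prod_beta, measurable\<close>)
    thus ?thesis unfolding f_eq by measurable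
  qed
  \<comment> \<open>True in every scenario: if the path is not integrable, the integral takes the
    default value \<open>0\<close> and the exponential is \<open>1\<close>.\<close>
  have f1: "?f \<omega> \<le> 1" if "\<omega> \<in> space Q" for \<omega>
    unfolding f_eq using rate_nonneg[OF B that] a by simp
  have gm: "?g \<in> borel_measurable (\<F> t)"
    using X_measurable_filtration_borel[OF t] by measurable
  have snd_z: "snd z \<in> psd"
  proof -
    have "snd (splitting_at B (r n) (T - t)) \<in> psd" for n
      unfolding splitting_at_def by (intro splitting_psd B less_imp_le mesh_pos)
    thus ?thesis using closed_sequentially[OF closed_psd _ tendsto_snd[OF z]] by blast
  qed
  show ?thesis
  proof (rule S.real_cond_exp_charact[OF _ _ _ gm])
    show "integrable Q ?f" by (rule integrable_bounded[OF fm, of 1]) (use f1 in auto)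
    show "integrable Q ?g"
    proof (rule integrable_bounded[where C = "exp (- (fst z + a * (T - t)))"])
      show "?g \<in> borel_measurable Q" by (rule measurable_from_subalg[OF subalgebra_filtration[OF t] gm])
      show "\<bar>?g \<omega>\<bar> \<le> exp (- (fst z + a * (T - t)))" if "\<omega> \<in> space Q" for \<omega>
        using trace_mult_psd_nonneg[OF snd_z X_psd[OF t that]] by simp
    qed
    fix A assume A: "A \<in> sets (\<F> t)"
    have A': "A \<in> events" using A subalgebra_filtration[OF t] by (auto simp: subalgebra_def)
    have "(LINT \<omega>:A|Q. ?f \<omega>) = expectation (\<lambda>\<omega>. exp (- (a * (T - t))) * (indicator A \<omega> * exp (- (LINT u:{t<..T}|lborel. rate B u \<omega>))))"
      unfolding set_lebesgue_integral_def[of Q A]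
    proof (rule integral_cong_AE)
      show "(\<lambda>\<omega>. indicator A \<omega> *\<^sub>R ?f \<omega>) \<in> borel_measurable Q" using fm A' by measurable
      note set_integral_rate_measurable[of t T B]
      moreover have "(\<lambda>\<omega>. exp (- (a * (T - t))) * (indicator A \<omega> * exp (- I \<omega>))) \<in> borel_measurable Q"
        if "I \<in> borel_measurable Q" for I :: "'w \<Rightarrow> real"
        using A' that by measurable
      ultimately show "(\<lambda>\<omega>. exp (- (a * (T - t))) * (indicator A \<omega> * exp (- (LINT u:{t<..T}|lborel. rate B u \<omega>)))) \<in> borel_measurable Q"
        by blast
      show "AE \<omega> in Q. indicator A \<omega> *\<^sub>R ?f \<omega> = exp (- (a * (T - t))) * (indicator A \<omega> * exp (- (LINT u:{t<..T}|lborel. rate B u \<omega>)))"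
        using AE_rate_integrable[OF B t \<tau>(1)] unfolding \<tau>(2)
      proof (rule AE_mp, intro AE_I2 impI)
        fix \<omega> assume "\<omega> \<in> space Q" "set_integrable lborel {t<..T} (\<lambda>u. rate B u \<omega>)"
        from set_integral_rate_closed[OF this(1) t tT this(2), of a]
        show "indicator A \<omega> *\<^sub>R ?f \<omega> = exp (- (a * (T - t))) * (indicator A \<omega> * exp (- (LINT u:{t<..T}|lborel. rate B u \<omega>)))"
          by (simp add: exp_add[symmetric] exp_diff exp_minus field_simps)
      qed
    qed
    also have "\<dots> = exp (- (a * (T - t))) * expectation (\<lambda>\<omega>. indicator A \<omega> * exp (- fst z - trace (snd z ** X t \<omega>)))"
      using feynman_kac[OF B t \<tau>(1) r z A] unfolding \<tau>(2) by simp
    also have "\<dots> = expectation (\<lambda>\<omega>. exp (- (a * (T - t))) * (indicator A \<omega> * exp (- fst z - trace (snd z ** X t \<omega>))))"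
      by simp
    also have "\<dots> = (LINT \<omega>:A|Q. ?g \<omega>)"
      unfolding set_lebesgue_integral_def
      by (intro Bochner_Integration.integral_cong refl) (simp add: exp_add[symmetric] indicator_def)
    finally show "(LINT \<omega>:A|Q. ?f \<omega>) = (LINT \<omega>:A|Q. ?g \<omega>)" .
  qed
qed

end

section \<open>The zero-coupon bond price\<close>

text \<open>One pair of functions serves all \<open>t\<close> and \<open>T\<close>. Derivatives are
  taken within the half-line, hence one-sided at \<open>0\<close>; the two integrability clauses
  guarantee that the integrals in the equations are not default values.\<close>

theorem proposition1:
  fixes Q :: "'w measure" and F :: "real \<Rightarrow> 'w measure"
    and p :: "real \<Rightarrow> real^'d^'d \<Rightarrow> (real^'d^'d) measure"
    and X :: "real \<Rightarrow> 'w \<Rightarrow> real^'d^'d"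
    and chi :: "real^'d^'d \<Rightarrow> real^'d^'d"
    and \<alpha> b :: "real^'d^'d" and \<beta> :: "'d \<Rightarrow> 'd \<Rightarrow> real^'d^'d"
    and m :: "(real^'d^'d) measure" and \<mu> :: "(real^'d^'d) set \<Rightarrow> real^'d^'d"
    and a :: real and B :: "real^'d^'d"
  assumes "prob_space Q" and "usual_conditions Q F"
    and "affine_process Q F p X" and "conservative p"
    and "jointly_measurable Q X"
    and "truncation_function chi"
    and "admissible_parameters chi \<alpha> b \<beta> m \<mu>"
    and "has_affine_generator p chi \<alpha> b \<beta> m \<mu>"
    and "0 \<le> a" and "B \<in> psd"
  shows "\<exists>(\<phi> :: real \<Rightarrow> real) (\<psi> :: real \<Rightarrow> real^'d^'d).
      \<phi> 0 = 0 \<and> \<psi> 0 = 0 \<and>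
      (\<forall>\<tau>\<ge>0. symmetric_matrix (\<psi> \<tau>) \<and>
         integrable m (\<lambda>\<xi>. exp (- trace (\<psi> \<tau> ** \<xi>)) - 1) \<and>
         (\<phi> has_real_derivative
            trace (b ** \<psi> \<tau>) - (LINT \<xi>|m. exp (- trace (\<psi> \<tau> ** \<xi>)) - 1) + a)
           (at \<tau> within {0..}) \<and>
         matrix_integrable \<mu> (\<lambda>\<xi>. (exp (- trace (\<psi> \<tau> ** \<xi>)) - 1 + trace (chi \<xi> ** \<psi> \<tau>))
                                    / min ((norm \<xi>)\<^sup>2) 1) \<and>
         (\<psi> has_vector_derivative
            - (2 *\<^sub>R (\<psi> \<tau> ** \<alpha> ** \<psi> \<tau>)) + drift_transpose \<beta> (\<psi> \<tau>)
            - matrix_integral \<mu> (\<lambda>\<xi>. (exp (- trace (\<psi> \<tau> ** \<xi>)) - 1 + trace (chi \<xi> ** \<psi> \<tau>))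
                                       / min ((norm \<xi>)\<^sup>2) 1)
            + B)
           (at \<tau> within {0..})) \<and>
      (\<forall>t T. 0 \<le> t \<longrightarrow> t \<le> T \<longrightarrow>
         (AE \<omega> in Q.
            real_cond_exp Q (F t)
              (\<lambda>\<omega>. exp (- (LINT u:{t..T}|lborel. a + trace (B ** X u \<omega>)))) \<omega>
            = exp (- \<phi> (T - t) - trace (\<psi> (T - t) ** X t \<omega>))))"
proof -
  have ap: "markov_process Q F p X" "stochastically_continuous p" "affine_transform p"
    using assms(3) by (simp_all add: affine_process_def)
  obtain \<phi>0 :: "real \<Rightarrow> real^'d^'d \<Rightarrow> real" and \<psi>0 :: "real \<Rightarrow> real^'d^'d \<Rightarrow> real^'d^'d" where
    \<phi>\<psi>: "\<forall>t\<ge>0. \<forall>u\<in>psd. 0 \<le> \<phi>0 t u \<and> \<psi>0 t u \<in> psd"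
    "\<forall>t\<ge>0. \<forall>u\<in>psd. \<forall>x\<in>psd. (LINT \<xi>|p t x. exp (- trace (u ** \<xi>))) = exp (- \<phi>0 t u - trace (\<psi>0 t u ** x))"
    using ap(3) unfolding affine_transform_def by blast
  interpret affine_process_semigroup chi \<alpha> b \<beta> m \<mu> p \<phi>0 \<psi>0 Q F X
  proof (intro affine_process_semigroup.intro affine_semigroup.intro affine_parameters.intro
      affine_semigroup_axioms.intro affine_process_semigroup_axioms.intro)
    show "truncation_function chi" "admissible_parameters chi \<alpha> b \<beta> m \<mu>" "conservative p"
      "stochastically_continuous p" "has_affine_generator p chi \<alpha> b \<beta> m \<mu>" "usual_conditions Q F"
      "markov_process Q F p X" "jointly_measurable Q X" "prob_space Q"
      by (fact assms ap)+
    show "transition_function p" using ap(1) by (simp add: markov_process_def)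
    show "0 \<le> \<phi>0 t u" "\<psi>0 t u \<in> psd" if "0 \<le> t" "u \<in> psd" for t u
      using \<phi>\<psi>(1) that by blast+
    show "(LINT \<xi>|p t x. exp_trace u \<xi>) = exp (- \<phi>0 t u - trace (\<psi>0 t u ** x))"
      if "0 \<le> t" "u \<in> psd" "x \<in> psd" for t u x
      by (rule \<phi>\<psi>(2)[rule_format, OF that])
  qed
  obtain z r where zr: "strict_mono r" "z 0 = 0" "\<And>t. 0 \<le> t \<Longrightarrow> snd (z t) \<in> psd"
    "\<And>t. 0 \<le> t \<Longrightarrow> (\<lambda>n. splitting_at B (r n) t) \<longlonglongrightarrow> z t"
    "\<And>t. 0 \<le> t \<Longrightarrow> (z has_vector_derivative riccati_field B (snd (z t))) (at t within {0..})"
    by (rule riccati_solution[OF \<open>B \<in> psd\<close>]) (rule that)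
  \<comment> \<open>The term \<open>a * \<tau>\<close> restores the constant part of the rate, left
    out of \<open>riccati_field\<close>.\<close>
  define \<phi> where "\<phi> \<tau> = fst (z \<tau>) + a * \<tau>" for \<tau>
  define \<psi> where "\<psi> \<tau> = snd (z \<tau>)" for \<tau>
  show ?thesis
  proof (intro exI[of _ \<phi>] exI[of _ \<psi>] conjI allI impI)
    show "\<phi> 0 = 0" "\<psi> 0 = 0" by (simp_all add: \<phi>_def \<psi>_def zr(2))
    fix \<tau> :: real assume \<tau>: "0 \<le> \<tau>"
    have psd: "\<psi> \<tau> \<in> psd" unfolding \<psi>_def by (rule zr(3)[OF \<tau>])
    show "symmetric_matrix (\<psi> \<tau>)" by (rule psd_symmetric[OF psd])
    show "integrable m (\<lambda>\<xi>. exp (- trace (\<psi> \<tau> ** \<xi>)) - 1)" by (rule integrable_m(1)[OF psd])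
    show "matrix_integrable \<mu> (\<lambda>\<xi>. (exp (- trace (\<psi> \<tau> ** \<xi>)) - 1 + trace (chi \<xi> ** \<psi> \<tau>)) / min ((norm \<xi>)\<^sup>2) 1)"
      using matrix_integrable_jump[OF psd] unfolding jump_integrand_def[abs_def] .
    have z': "(z has_vector_derivative (riccati_F b m (\<psi> \<tau>), riccati_R chi \<alpha> \<beta> \<mu> (\<psi> \<tau>) + B)) (at \<tau> within {0..})"
      using zr(5)[OF \<tau>] by (simp add: riccati_field_def riccati_def \<psi>_def)
    have "((\<lambda>\<tau>. fst (z \<tau>)) has_real_derivative riccati_F b m (\<psi> \<tau>)) (at \<tau> within {0..})"
      unfolding has_real_derivative_iff_has_vector_derivative
      using bounded_linear.has_vector_derivative[OF bounded_linear_fst z'] by simp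
    hence "(\<phi> has_real_derivative riccati_F b m (\<psi> \<tau>) + a) (at \<tau> within {0..})"
      unfolding \<phi>_def[abs_def] by (auto intro!: derivative_eq_intros)
    thus "(\<phi> has_real_derivative trace (b ** \<psi> \<tau>) - (LINT \<xi>|m. exp (- trace (\<psi> \<tau> ** \<xi>)) - 1) + a) (at \<tau> within {0..})"
      unfolding riccati_F_def .
    have "(\<psi> has_vector_derivative riccati_R chi \<alpha> \<beta> \<mu> (\<psi> \<tau>) + B) (at \<tau> within {0..})"
      unfolding \<psi>_def[abs_def]
      using bounded_linear.has_vector_derivative[OF bounded_linear_snd z'] by (simp add: \<psi>_def)
    thus "(\<psi> has_vector_derivative - (2 *\<^sub>R (\<psi> \<tau> ** \<alpha> ** \<psi> \<tau>)) + drift_transpose \<beta> (\<psi> \<tau>)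
        - matrix_integral \<mu> (\<lambda>\<xi>. (exp (- trace (\<psi> \<tau> ** \<xi>)) - 1 + trace (chi \<xi> ** \<psi> \<tau>)) / min ((norm \<xi>)\<^sup>2) 1)
        + B) (at \<tau> within {0..})"
      unfolding riccati_R_def jump_integrand_def[abs_def] .
  next
    fix t T :: real assume tT: "0 \<le> t" "t \<le> T"
    show "AE \<omega> in Q. real_cond_exp Q (F t) (\<lambda>\<omega>. exp (- (LINT u:{t..T}|lborel. a + trace (B ** X u \<omega>)))) \<omega>
        = exp (- \<phi> (T - t) - trace (\<psi> (T - t) ** X t \<omega>))"
      unfolding \<phi>_def \<psi>_def
      by (rule bond_price[OF \<open>B \<in> psd\<close> \<open>0 \<le> a\<close> tT zr(1) zr(4)]) (use tT in simp)
  qed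
qed

end
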